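(* Let $c\in C^4(\overline U\times\overline V)$ satisfy (B0)–(B3), fix $\tilde y\in\overline V$, and let $u=u^{c^*c}$ be a $c$-convex function on $\overline U$. Then $\tilde u(q):=u(x(q))+c(x(q),\tilde y)$ has convex level sets (i.e. convex sublevel sets $\{\tilde u\le \mathrm{const}\}$) as a function of the cost exponential coordinates $q\in\overline U_{\tilde y}$ from $\tilde y$. Moreover, $$\tilde u+M_c|q|^2\quad\text{is convex},$$ where $M_c:=(\beta_c^-)^2\|D^2_{xx}c\|_{L^\infty(U\times V)}+(\beta_c^-)^3\|D_xc\|_{L^\infty(U\times V)}\|D^2_{xx}D_yc\|_{L^\infty(U\times V)}$. If, in addition, $c$ satisfies (B4), then $\tilde u$ is convex on $\overline U_{\tilde y}$. In either case $\tilde u$ is minimized at $q_0$ if $\tilde y\in\partial^cu(x(q_0))$. Furthermore, $\tilde u$ is $\tilde c$-convex with respect to the modified cost $\tilde c(q,y):=c(x(q),y)-c(x(q),\tilde y)$ on $\overline U_{\tilde y}\times\overline V$, and $\partial^{\tilde c}\tilde u(q)=\partial^cu(x(q))$ for all $q\in\overline U_{\tilde y}$.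
   Context: $D_x, D_y$ denote derivatives in the first and second variables of $c$. Conditions on the cost: (B0) $U,V\subset\mathbb R^n$ are open and bounded and $c\in C^4(\overline U\times\overline V)$. (B1) For each $(\tilde x,\tilde y)\in\overline U\times\overline V$, the maps $x\in\overline U\mapsto -D_yc(x,\tilde y)$ and $y\in\overline V\mapsto -D_xc(\tilde x,y)$ are diffeomorphisms onto their ranges. (B2) For each $(\tilde x,\tilde y)\in\overline U\times\overline V$, the sets $U_{\tilde y}:=-D_yc(U,\tilde y)$ and $V_{\tilde x}:=-D_xc(\tilde x,V)$ are convex subsets of $\mathbb R^n$. (B3) For every curve $t\in[-1,1]\mapsto (D_yc(x(t),y(0)),D_xc(x(0),y(t)))\in\mathbb R^{2n}$ which is an affinely parameterized line segment, $-\frac{\partial^4}{\partial s^2\partial t^2}\big|_{(s,t)=(0,0)}c(x(s),y(t))\ge 0$ provided $\frac{\partial^2}{\partial s\partial t}\big|_{(s,t)=(0,0)}c(x(s),y(t))=0$. (B4) The inequality in (B3) holds for all such curves even without the vanishing condition on $\frac{\partial^2}{\partial s\partial t}c$. $c$-convexity: $v^c(x):=\sup_{y\in\overline V}-c(x,y)-v(y)$, $u^{c^*}(y):=\sup_{x\in\overline U}-c(x,y)-u(x)$; $u$ is $c$-convex if $u=u^{c^*c}:=(u^{c^*})^c$. $\partial^cu(x):=\{y\in\overline V: u(x)+u^{c^*}(y)+c(x,y)=0\}$. The same definitions with $(\overline U_{\tilde y},\tilde c)$ in place of $(\overline U,c)$ define $\tilde c$-convexity and $\partial^{\tilde c}$.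 Cost exponential coordinates from $\tilde y$: $x:\overline U_{\tilde y}\to\overline U$ is the inverse of $x\mapsto q(x)=-D_yc(x,\tilde y)$, i.e. $q=-D_yc(x(q),\tilde y)$. $\beta_c^\pm:=\|(D^2_{xy}c)^{\pm1}\|_{L^\infty(U\times V)}$. *)

theory Defs
  imports "HOL-Analysis.Analysis" "HOL-Probability.Essential_Supremum"
begin

text \<open>
  Throughout, \<open>\<real>\<^sup>n\<close> is an arbitrary type of class \<open>euclidean_space\<close>, and vectors are identified
  with covectors through the inner product, so that first derivatives of the cost are gradients.
\<close>

section \<open>Regularity up to the boundary\<close>

text \<open>
  For open \<open>S\<close>, this is the usual class \<open>C\<^sup>k(closure S)\<close>: all derivatives of order at most \<open>k\<close> exist
  on \<open>S\<close> and extend continuously to \<open>closure S\<close>. The values of \<open>f'\<close> on the boundary are exactly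
  these continuous extensions.
\<close>
primrec Ck_closure ::
  "nat \<Rightarrow> 'a::euclidean_space set \<Rightarrow> ('a \<Rightarrow> 'b::real_normed_vector) \<Rightarrow> bool" where
  "Ck_closure 0 S f \<longleftrightarrow> continuous_on (closure S) f"
| "Ck_closure (Suc k) S f \<longleftrightarrow> continuous_on (closure S) f \<and>
     (\<exists>f'. (\<forall>x\<in>S. (f has_derivative f' x) (at x)) \<and>
           (\<forall>b\<in>Basis. Ck_closure k S (\<lambda>x. f' x b)))"

text \<open>
  Diffeomorphism of \<open>closure U\<close> onto its range. For bounded \<open>U\<close> that range is
  \<open>closure (f ` U)\<close>, and \<open>f ` U\<close> is open by invariance of domain.
\<close>
definition diffeo_closure ::
  "'a::euclidean_space set \<Rightarrow> ('a \<Rightarrow> 'a) \<Rightarrow> bool" where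
  "diffeo_closure U f \<longleftrightarrow>
     inj_on f (closure U) \<and> Ck_closure 1 U f \<and> Ck_closure 1 (f ` U) (inv_into (closure U) f)"

section \<open>Derivatives of the cost\<close>

definition gradient :: "('a::euclidean_space \<Rightarrow> real) \<Rightarrow> 'a \<Rightarrow> 'a" where
  "gradient f x = (THE D. GDERIV f x :> D)"

definition Dx :: "('a::euclidean_space \<Rightarrow> 'a \<Rightarrow> real) \<Rightarrow> 'a \<Rightarrow> 'a \<Rightarrow> 'a" where
  "Dx c x y = gradient (\<lambda>x'. c x' y) x"

definition Dy :: "('a::euclidean_space \<Rightarrow> 'a \<Rightarrow> real) \<Rightarrow> 'a \<Rightarrow> 'a \<Rightarrow> 'a" where
  "Dy c x y = gradient (\<lambda>y'. c x y') y"

text \<open>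
  The continuous extensions of \<open>D\<^sub>x c\<close> and \<open>D\<^sub>y c\<close> from \<open>U \<times> V\<close> to \<open>closure U \<times> closure V\<close>.
  For a cost of class \<open>C\<^sup>1\<close> up to the boundary they agree with \<open>Dx\<close> and \<open>Dy\<close> on \<open>U \<times> V\<close>.
\<close>
definition Dx_closure ::
  "'a::euclidean_space set \<Rightarrow> 'a set \<Rightarrow> ('a \<Rightarrow> 'a \<Rightarrow> real) \<Rightarrow> 'a \<Rightarrow> 'a \<Rightarrow> 'a" where
  "Dx_closure U V c x y = Lim (at (x, y) within U \<times> V) (\<lambda>(x', y'). Dx c x' y')"

definition Dy_closure ::
  "'a::euclidean_space set \<Rightarrow> 'a set \<Rightarrow> ('a \<Rightarrow> 'a \<Rightarrow> real) \<Rightarrow> 'a \<Rightarrow> 'a \<Rightarrow> 'a" where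
  "Dy_closure U V c x y = Lim (at (x, y) within U \<times> V) (\<lambda>(x', y'). Dy c x' y')"

definition total_deriv ::
  "('a::euclidean_space \<Rightarrow> 'b::real_normed_vector) \<Rightarrow> 'a \<Rightarrow> 'a \<Rightarrow>\<^sub>L 'b" where
  "total_deriv f x = Blinfun (frechet_derivative f (at x))"

definition Dxx :: "('a::euclidean_space \<Rightarrow> 'a \<Rightarrow> real) \<Rightarrow> 'a \<Rightarrow> 'a \<Rightarrow> 'a \<Rightarrow>\<^sub>L 'a" where
  "Dxx c x y = total_deriv (\<lambda>x'. Dx c x' y) x"

definition Dxy :: "('a::euclidean_space \<Rightarrow> 'a \<Rightarrow> real) \<Rightarrow> 'a \<Rightarrow> 'a \<Rightarrow> 'a \<Rightarrow>\<^sub>L 'a" where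
  "Dxy c x y = total_deriv (\<lambda>x'. Dy c x' y) x"

definition DxxDy ::
  "('a::euclidean_space \<Rightarrow> 'a \<Rightarrow> real) \<Rightarrow> 'a \<Rightarrow> 'a \<Rightarrow> 'a \<Rightarrow>\<^sub>L 'a \<Rightarrow>\<^sub>L 'a" where
  "DxxDy c x y = total_deriv (\<lambda>x'. Dxy c x' y) x"

text \<open>
  The pointwise norm is the Euclidean norm for vectors and the operator norm for (multi)linear
  maps.
\<close>
definition Linf_norm ::
  "('a::euclidean_space \<times> 'a) set \<Rightarrow> ('a \<Rightarrow> 'a \<Rightarrow> 'b::real_normed_vector) \<Rightarrow> real" where
  "Linf_norm S F =
     real_of_ereal (esssup (lebesgue_on S) (\<lambda>(x, y). ereal (norm (F x y))))"

definition beta_minus ::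
  "'a::euclidean_space set \<Rightarrow> 'a set \<Rightarrow> ('a \<Rightarrow> 'a \<Rightarrow> real) \<Rightarrow> real" where
  "beta_minus U V c =
     Linf_norm (U \<times> V) (\<lambda>x y. Blinfun (inv (blinfun_apply (Dxy c x y))))"

definition M_const ::
  "'a::euclidean_space set \<Rightarrow> 'a set \<Rightarrow> ('a \<Rightarrow> 'a \<Rightarrow> real) \<Rightarrow> real" where
  "M_const U V c =
     (beta_minus U V c)^2 * Linf_norm (U \<times> V) (Dxx c)
     + (beta_minus U V c)^3 * Linf_norm (U \<times> V) (Dx c) * Linf_norm (U \<times> V) (DxxDy c)"

section \<open>Conditions on the cost\<close>

definition condB0 ::
  "'a::euclidean_space set \<Rightarrow> 'a set \<Rightarrow> ('a \<Rightarrow> 'a \<Rightarrow> real) \<Rightarrow> bool" where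
  "condB0 U V c \<longleftrightarrow>
     open U \<and> bounded U \<and> open V \<and> bounded V \<and> Ck_closure 4 (U \<times> V) (\<lambda>(x, y). c x y)"

definition condB1 ::
  "'a::euclidean_space set \<Rightarrow> 'a set \<Rightarrow> ('a \<Rightarrow> 'a \<Rightarrow> real) \<Rightarrow> bool" where
  "condB1 U V c \<longleftrightarrow> (\<forall>xt\<in>closure U. \<forall>yt\<in>closure V.
     diffeo_closure U (\<lambda>x. - Dy_closure U V c x yt) \<and>
     diffeo_closure V (\<lambda>y. - Dx_closure U V c xt y))"

definition U_coord ::
  "'a::euclidean_space set \<Rightarrow> 'a set \<Rightarrow> ('a \<Rightarrow> 'a \<Rightarrow> real) \<Rightarrow> 'a \<Rightarrow> 'a set" where
  "U_coord U V c yt = (\<lambda>x. - Dy_closure U V c x yt) ` U"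

definition V_coord ::
  "'a::euclidean_space set \<Rightarrow> 'a set \<Rightarrow> ('a \<Rightarrow> 'a \<Rightarrow> real) \<Rightarrow> 'a \<Rightarrow> 'a set" where
  "V_coord U V c xt = (\<lambda>y. - Dx_closure U V c xt y) ` V"

definition condB2 ::
  "'a::euclidean_space set \<Rightarrow> 'a set \<Rightarrow> ('a \<Rightarrow> 'a \<Rightarrow> real) \<Rightarrow> bool" where
  "condB2 U V c \<longleftrightarrow> (\<forall>xt\<in>closure U. \<forall>yt\<in>closure V.
     convex (U_coord U V c yt) \<and> convex (V_coord U V c xt))"

text \<open>
  No regularity of the curves \<open>x\<close> and \<open>y\<close> is imposed: it follows from the segment condition,
  as both are determined by their image segments under the diffeomorphisms of \<open>condB1\<close>.
\<close>
definition segment_curve ::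
  "'a::euclidean_space set \<Rightarrow> 'a set \<Rightarrow> ('a \<Rightarrow> 'a \<Rightarrow> real) \<Rightarrow> (real \<Rightarrow> 'a) \<Rightarrow> (real \<Rightarrow> 'a) \<Rightarrow> bool"
  where
  "segment_curve U V c x y \<longleftrightarrow>
     x ` {-1..1} \<subseteq> closure U \<and> y ` {-1..1} \<subseteq> closure V \<and>
     (\<exists>a v. \<forall>t\<in>{-1..1}.
        (Dy_closure U V c (x t) (y 0), Dx_closure U V c (x 0) (y t)) = a + t *\<^sub>R v)"

definition cross_deriv2 ::
  "('a \<Rightarrow> 'a \<Rightarrow> real) \<Rightarrow> (real \<Rightarrow> 'a) \<Rightarrow> (real \<Rightarrow> 'a) \<Rightarrow> real" where
  "cross_deriv2 c x y = deriv (\<lambda>s. deriv (\<lambda>t. c (x s) (y t)) 0) 0"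

definition cross_deriv4 ::
  "('a \<Rightarrow> 'a \<Rightarrow> real) \<Rightarrow> (real \<Rightarrow> 'a) \<Rightarrow> (real \<Rightarrow> 'a) \<Rightarrow> real" where
  "cross_deriv4 c x y = (deriv ^^ 2) (\<lambda>s. (deriv ^^ 2) (\<lambda>t. c (x s) (y t)) 0) 0"

definition condB3 ::
  "'a::euclidean_space set \<Rightarrow> 'a set \<Rightarrow> ('a \<Rightarrow> 'a \<Rightarrow> real) \<Rightarrow> bool" where
  "condB3 U V c \<longleftrightarrow> (\<forall>x y. segment_curve U V c x y \<longrightarrow>
     cross_deriv2 c x y = 0 \<longrightarrow> - cross_deriv4 c x y \<ge> 0)"

definition condB4 ::
  "'a::euclidean_space set \<Rightarrow> 'a set \<Rightarrow> ('a \<Rightarrow> 'a \<Rightarrow> real) \<Rightarrow> bool" where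
  "condB4 U V c \<longleftrightarrow> (\<forall>x y. segment_curve U V c x y \<longrightarrow> - cross_deriv4 c x y \<ge> 0)"

section \<open>Convexity with respect to a cost\<close>

text \<open>
  Here \<open>X\<close> and \<open>Y\<close> are the (closed) domains of the two variables. Potentials are real-valued.
  If the cost is bounded on \<open>X \<times> Y\<close>, both nonempty, then every real-valued \<open>u\<close> with
  \<open>c_convex_on X Y c u\<close> is bounded, so all suprema involved are suprema of bounded sets.
\<close>
definition c_transform ::
  "'b set \<Rightarrow> ('a \<Rightarrow> 'b \<Rightarrow> real) \<Rightarrow> ('b \<Rightarrow> real) \<Rightarrow> 'a \<Rightarrow> real" where
  "c_transform Y c v x = (SUP y\<in>Y. - c x y - v y)"

definition cstar_transform ::
  "'a set \<Rightarrow> ('a \<Rightarrow> 'b \<Rightarrow> real) \<Rightarrow> ('a \<Rightarrow> real) \<Rightarrow> 'b \<Rightarrow> real" where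
  "cstar_transform X c u y = (SUP x\<in>X. - c x y - u x)"

definition c_convex_on ::
  "'a set \<Rightarrow> 'b set \<Rightarrow> ('a \<Rightarrow> 'b \<Rightarrow> real) \<Rightarrow> ('a \<Rightarrow> real) \<Rightarrow> bool" where
  "c_convex_on X Y c u \<longleftrightarrow> (\<forall>x\<in>X. u x = c_transform Y c (cstar_transform X c u) x)"

definition c_subdiff ::
  "'a set \<Rightarrow> 'b set \<Rightarrow> ('a \<Rightarrow> 'b \<Rightarrow> real) \<Rightarrow> ('a \<Rightarrow> real) \<Rightarrow> 'a \<Rightarrow> 'b set" where
  "c_subdiff X Y c u x = {y \<in> Y. u x + cstar_transform X c u y + c x y = 0}"

section \<open>Cost exponential coordinates\<close>

definition cost_exp ::
  "'a::euclidean_space set \<Rightarrow> 'a set \<Rightarrow> ('a \<Rightarrow> 'a \<Rightarrow> real) \<Rightarrow> 'a \<Rightarrow> 'a \<Rightarrow> 'a" where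
  "cost_exp U V c yt = inv_into (closure U) (\<lambda>x. - Dy_closure U V c x yt)"

definition u_tilde ::
  "'a::euclidean_space set \<Rightarrow> 'a set \<Rightarrow> ('a \<Rightarrow> 'a \<Rightarrow> real) \<Rightarrow> 'a \<Rightarrow> ('a \<Rightarrow> real) \<Rightarrow> 'a \<Rightarrow> real" where
  "u_tilde U V c yt u q = u (cost_exp U V c yt q) + c (cost_exp U V c yt q) yt"

definition c_tilde ::
  "'a::euclidean_space set \<Rightarrow> 'a set \<Rightarrow> ('a \<Rightarrow> 'a \<Rightarrow> real) \<Rightarrow> 'a \<Rightarrow> 'a \<Rightarrow> 'a \<Rightarrow> real" where
  "c_tilde U V c yt q y = c (cost_exp U V c yt q) y - c (cost_exp U V c yt q) yt"

end

theory Submission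
  imports Defs
begin

text \<open>
  Since \<open>u\<close> is a supremum of functions \<open>- c x y - v y\<close>, \<open>u_tilde\<close> is a supremum of constants plus
  the functions \<open>f q = c (x q) yt - c (x q) y\<close>, and each convexity claim reduces to one about \<open>f\<close>.
  The Hessian of \<open>f\<close> is studied by moving \<open>y\<close> to \<open>yt\<close> along the curve \<open>y t\<close> on which
  \<open>D\<^sub>x c (x\<^sub>0, y t)\<close> is affine. The second derivative of \<open>f\<close> in a direction \<open>v\<close> then becomes a function of
  \<open>t\<close> that vanishes to first order at \<open>yt\<close> and whose second derivative in \<open>t\<close> is the cross-curvature;
  the mixed second derivative is constant in \<open>t\<close> and equals the derivative of \<open>f\<close> in direction \<open>v\<close>, up to sign.
  So (B4) makes the Hessian nonnegative, and (B3) makes it nonnegative in the directions tangent to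
  the level sets. As \<open>f\<close> has no critical points unless \<open>y = yt\<close>, the latter gives
  \<open>f'' \<ge> - K \<bar>f'\<bar>\<close> along segments, which excludes interior maxima and hence yields quasiconvexity without strictness in (B3).
  The bound by \<open>M_const\<close> is the chain rule. Everything is proved for points of the open sets
  \<open>U\<close> and \<open>V\<close> and passes to the closures by compactness.
\<close>

section \<open>Directional derivatives and the class of k times continuously differentiable maps\<close>

text \<open>(B3) speaks only of curves that are lines in the coordinates from their common base
  point, whereas the Hessian of \<open>f\<close> is taken along a line in the coordinates from
  \<open>yt\<close> and has to be followed through every \<open>y t\<close>. Exchanging the
  \<open>x\<close>-curve costs nothing: as D_x c(x0, y t) is affine in \<open>t\<close>, the second
  \<open>t\<close>-derivative of the cost has zero \<open>x\<close>-gradient at \<open>x0\<close>,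
  so the fourth derivative sees the velocity of the \<open>x\<close>-curve but not its acceleration.
  The quadratic term has its size because each of the two costs in \<open>f\<close> has second
  derivative at most \<open>M_const\<close> times |v|^2, while |q|^2 contributes 2 |v|^2. Two
  regularity gaps shape the rest. (B1) provides inverses of class C^1, but second derivatives of
  x(q) are needed. And \<open>beta_minus\<close> is an essential supremum turned into a real number,
  so an infinite one would read 0; it bounds something only once the inverses of \<open>Dxy\<close>
  are known to be uniformly bounded, which is extracted from (B1), including base points on the
  boundary of \<open>V\<close>.\<close>

definition dirderiv ::
  "'a::real_normed_vector \<Rightarrow> ('a \<Rightarrow> 'b::real_normed_vector) \<Rightarrow> 'a \<Rightarrow> 'b" where
  "dirderiv v f x = frechet_derivative f (at x) v"

text \<open>Derivatives are taken along fixed vectors, so that iterated derivatives keep the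
  codomain \<open>'b\<close> and can be nested and commuted freely. All directions are allowed, not
  only those of \<open>Basis\<close>, because the directions used later are velocities of
  curves.\<close>

primrec Ck_on ::
  "nat \<Rightarrow> 'a::euclidean_space set \<Rightarrow> ('a \<Rightarrow> 'b::real_normed_vector) \<Rightarrow> bool" where
  "Ck_on 0 S f \<longleftrightarrow> continuous_on S f"
| "Ck_on (Suc k) S f \<longleftrightarrow> (\<forall>x\<in>S. f differentiable at x) \<and> (\<forall>v. Ck_on k S (dirderiv v f))"

lemma has_derivative_dirderiv:
  "f differentiable at x \<Longrightarrow> (f has_derivative (\<lambda>v. dirderiv v f x)) (at x)"
  unfolding dirderiv_def by (simp add: frechet_derivative_works)

lemma dirderiv_eqI: "(f has_derivative f') (at x) \<Longrightarrow> dirderiv v f x = f' v"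
  unfolding dirderiv_def by (metis frechet_derivative_at)

lemma bounded_linear_dirderiv:
  "f differentiable at x \<Longrightarrow> bounded_linear (\<lambda>v. dirderiv v f x)"
  using has_derivative_dirderiv has_derivative_bounded_linear by blast

lemma dirderiv_dir_diff:
  "f differentiable at x \<Longrightarrow> dirderiv (v - w) f x = dirderiv v f x - dirderiv w f x"
  using bounded_linear.linear[OF bounded_linear_dirderiv] linear_diff by fastforce

lemma dirderiv_dir_scaleR:
  "f differentiable at x \<Longrightarrow> dirderiv (r *\<^sub>R v) f x = r *\<^sub>R dirderiv v f x"
  using bounded_linear.linear[OF bounded_linear_dirderiv] linear_scale by fastforce

lemma dirderiv_basis:
  fixes v :: "'a::euclidean_space"
  assumes "f differentiable at x"
  shows "dirderiv v f x = (\<Sum>b\<in>Basis. (v \<bullet> b) *\<^sub>R dirderiv b f x)"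
proof -
  interpret bounded_linear "\<lambda>v. dirderiv v f x"
    by (rule bounded_linear_dirderiv[OF assms])
  have "dirderiv v f x = dirderiv (\<Sum>b\<in>Basis. (v \<bullet> b) *\<^sub>R b) f x"
    by (simp only: euclidean_representation)
  then show ?thesis by (simp only: sum scaleR)
qed

lemma dirderiv_add:
  "f differentiable at x \<Longrightarrow> g differentiable at x \<Longrightarrow>
     dirderiv v (\<lambda>x. f x + g x) x = dirderiv v f x + dirderiv v g x"
  by (rule dirderiv_eqI) (auto intro!: derivative_eq_intros has_derivative_dirderiv)

lemma dirderiv_bounded_linear:
  "bounded_linear L \<Longrightarrow> f differentiable at x \<Longrightarrow>
     dirderiv v (\<lambda>x. L (f x)) x = L (dirderiv v f x)"
  by (rule dirderiv_eqI) (rule bounded_linear.has_derivative, auto intro: has_derivative_dirderiv)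

lemma dirderiv_scaleR:
  fixes f :: "'a::real_normed_vector \<Rightarrow> real"
  assumes "f differentiable at x" "g differentiable at x"
  shows "dirderiv v (\<lambda>x. f x *\<^sub>R g x) x = f x *\<^sub>R dirderiv v g x + dirderiv v f x *\<^sub>R g x"
  by (rule dirderiv_eqI)
    (rule has_derivative_scaleR[OF has_derivative_dirderiv has_derivative_dirderiv, OF assms])

text \<open>No differentiability is assumed: the two functions have the same derivative candidates,
  so even an unspecified choice in \<open>frechet_derivative\<close> comes out equal.\<close>

lemma dirderiv_cong:
  assumes "open S" "x \<in> S" "\<And>y. y \<in> S \<Longrightarrow> f y = g y"
  shows "dirderiv v f x = dirderiv v g x"
proof -
  have "(f has_derivative D) (at x) \<longleftrightarrow> (g has_derivative D) (at x)" for D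
    using has_derivative_transform_within_open[of f D x UNIV S g]
      has_derivative_transform_within_open[of g D x UNIV S f] assms by auto
  then show ?thesis unfolding dirderiv_def frechet_derivative_def by simp
qed

lemma Ck_on_cong:
  assumes "open S" "Ck_on k S f" "\<And>x. x \<in> S \<Longrightarrow> f x = g x"
  shows "Ck_on k S g"
  using assms(2,3)
proof (induction k arbitrary: f g)
  case 0
  then show ?case by (simp cong: continuous_on_cong)
next
  case (Suc k)
  have "g differentiable at x" if "x \<in> S" for x
    using that Suc.prems assms(1) unfolding differentiable_def Ck_on.simps
    by (meson has_derivative_transform_within_open)
  moreover have "Ck_on k S (dirderiv v g)" for v
    using Suc.IH[of "dirderiv v f" "dirderiv v g"] Suc.prems dirderiv_cong[OF assms(1)]
    by (metis Ck_on.simps(2))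
  ultimately show ?case by simp
qed

lemma Ck_on_Suc_imp: "Ck_on (Suc k) S f \<Longrightarrow> Ck_on k S f"
proof (induction k arbitrary: f)
  case 0
  then show ?case
    by (auto intro: continuous_at_imp_continuous_on differentiable_imp_continuous_within)
next
  case (Suc k)
  then show ?case by (metis Ck_on.simps(2))
qed

lemma Ck_on_mono: "Ck_on k S f \<Longrightarrow> j \<le> k \<Longrightarrow> Ck_on j S f"
proof (induction k)
  case (Suc k)
  then show ?case by (metis Ck_on_Suc_imp le_Suc_eq)
qed simp

lemma Ck_on_const: "Ck_on k (S::'a::euclidean_space set) (\<lambda>x. a)"
proof (induction k arbitrary: a)
  case (Suc k)
  have "dirderiv v (\<lambda>x. a) = (\<lambda>x. 0)" for v :: 'a by (auto simp: dirderiv_def)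
  then show ?case using Suc by simp
qed simp

lemma Ck_on_add:
  assumes "open S" "Ck_on k S f" "Ck_on k S g"
  shows "Ck_on k S (\<lambda>x. f x + g x)"
  using assms(2,3)
proof (induction k arbitrary: f g)
  case 0
  then show ?case by (auto intro: continuous_intros)
next
  case (Suc k)
  have "Ck_on k S (dirderiv v (\<lambda>x. f x + g x))" for v
    by (rule Ck_on_cong[OF assms(1) Suc.IH[of "dirderiv v f" "dirderiv v g"]])
      (use Suc.prems in \<open>auto simp: dirderiv_add\<close>)
  then show ?case using Suc.prems by (auto intro: derivative_intros)
qed

lemma Ck_on_sum:
  assumes "open S" "finite I" "\<And>i. i \<in> I \<Longrightarrow> Ck_on k S (f i)"
  shows "Ck_on k S (\<lambda>x. \<Sum>i\<in>I. f i x)"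
  using assms(2,3)
  by (induction I rule: finite_induct) (auto intro: Ck_on_const Ck_on_add[OF assms(1)])

lemma Ck_on_scaleR:
  fixes f :: "'a::euclidean_space \<Rightarrow> real"
  assumes "open S" "Ck_on k S f" "Ck_on k S g"
  shows "Ck_on k S (\<lambda>x. f x *\<^sub>R g x)"
  using assms(2,3)
proof (induction k arbitrary: f g)
  case 0
  then show ?case by (auto intro: continuous_intros)
next
  case (Suc k)
  have "Ck_on k S (dirderiv v (\<lambda>x. f x *\<^sub>R g x))" for v
  proof (rule Ck_on_cong[OF assms(1) Ck_on_add[OF assms(1)]])
    show "Ck_on k S (\<lambda>x. f x *\<^sub>R dirderiv v g x)" "Ck_on k S (\<lambda>x. dirderiv v f x *\<^sub>R g x)"
      using Suc.prems by (auto intro!: Suc.IH intro: Ck_on_Suc_imp)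
  qed (use Suc.prems in \<open>auto simp: dirderiv_scaleR\<close>)
  then show ?case using Suc.prems by (auto intro: derivative_intros)
qed

lemma Ck_on_bounded_linear:
  assumes "open S" "bounded_linear L" "Ck_on k S f"
  shows "Ck_on k S (\<lambda>x. L (f x))"
  using assms(3)
proof (induction k arbitrary: f)
  case 0
  then show ?case using assms(2) by (auto intro: bounded_linear.continuous_on)
next
  case (Suc k)
  have "Ck_on k S (dirderiv v (\<lambda>x. L (f x)))" for v
    by (rule Ck_on_cong[OF assms(1) Suc.IH[of "dirderiv v f"]])
      (use Suc.prems in \<open>auto simp: dirderiv_bounded_linear[OF assms(2)]\<close>)
  moreover have "(\<lambda>x. L (f x)) differentiable at x" if "x \<in> S" for x
    using Suc.prems that bounded_linear.has_derivative[OF assms(2)]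
    unfolding differentiable_def Ck_on.simps by blast
  ultimately show ?case by simp
qed

lemma Ck_on_diff:
  assumes "open S" "Ck_on k S f" "Ck_on k S g"
  shows "Ck_on k S (\<lambda>x. f x - g x)"
  using Ck_on_add[OF assms(1,2) Ck_on_bounded_linear[OF assms(1) bounded_linear_minus[OF bounded_linear_ident] assms(3)]]
  by simp

lemma dirderiv_compose:
  fixes g :: "'a::real_normed_vector \<Rightarrow> 'b::euclidean_space"
  assumes "g differentiable at x" "F differentiable at (g x)"
  shows "dirderiv v (\<lambda>x. F (g x)) x = dirderiv (dirderiv v g x) F (g x)"
  by (rule dirderiv_eqI)
    (rule has_derivative_compose[OF has_derivative_dirderiv has_derivative_dirderiv, OF assms])

lemma Ck_on_compose:
  fixes g :: "'a::euclidean_space \<Rightarrow> 'b::euclidean_space"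
  assumes "open S" "g ` S \<subseteq> T" "Ck_on k S g" "Ck_on k T F"
  shows "Ck_on k S (\<lambda>x. F (g x))"
  using assms(3,4)
proof (induction k arbitrary: F)
  case 0
  then show ?case using assms(2) by (auto intro: continuous_on_compose2)
next
  case (Suc k)
  have dg: "g differentiable at x" and dF: "F differentiable at (g x)" if "x \<in> S" for x
    using Suc.prems assms(2) that by auto
  \<comment> \<open>The chain rule yields a derivative of \<open>F\<close> in a direction that moves
    with \<open>x\<close>. Expanding that direction in \<open>Basis\<close> leaves products of
    scalar functions with derivatives in fixed directions, to which the induction hypothesis
    applies.\<close>
  have "Ck_on k S (dirderiv v (\<lambda>x. F (g x)))" for v
  proof (rule Ck_on_cong[OF assms(1)])
    show "Ck_on k S (\<lambda>x. \<Sum>b\<in>Basis. (dirderiv v g x \<bullet> b) *\<^sub>R dirderiv b F (g x))"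
    proof (intro Ck_on_sum Ck_on_scaleR assms(1))
      fix b :: 'b
      show "Ck_on k S (\<lambda>x. dirderiv v g x \<bullet> b)"
        using Suc.prems by (intro Ck_on_bounded_linear[OF assms(1) bounded_linear_inner_left]) auto
      show "Ck_on k S (\<lambda>x. dirderiv b F (g x))"
        using Suc.prems by (intro Suc.IH) (auto intro: Ck_on_Suc_imp simp del: Ck_on.simps(1))
    qed auto
  qed (simp add: dirderiv_compose dg dF flip: dirderiv_basis)
  then show ?case
    using dg dF by (auto intro: differentiable_chain_at[unfolded o_def])
qed

lemma Ck_on_bounded_linear_id: "bounded_linear L \<Longrightarrow> Ck_on k S L"
proof (cases k)
  case (Suc j)
  assume L: "bounded_linear L"
  have "dirderiv v L = (\<lambda>x. L v)" for v
    using L by (auto intro!: ext dirderiv_eqI bounded_linear_imp_has_derivative)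
  then show ?thesis using Suc L
    by (auto simp: Ck_on_const bounded_linear_imp_differentiable)
qed (simp add: linear_continuous_on)

lemma Ck_on_Pair_left:
  fixes F :: "'a::euclidean_space \<times> 'b::euclidean_space \<Rightarrow> 'c::real_normed_vector"
  assumes "open U" "Ck_on k W F" "U \<times> {y} \<subseteq> W"
  shows "Ck_on k U (\<lambda>x. F (x, y))"
proof (rule Ck_on_compose[OF assms(1) _ _ assms(2)])
  have "Ck_on k U (\<lambda>x. (x, 0) + (0, y))"
    by (intro Ck_on_add Ck_on_const assms Ck_on_bounded_linear_id bounded_linear_Pair
        bounded_linear_ident bounded_linear_zero)
  then show "Ck_on k U (\<lambda>x. (x, y))" by simp
qed (use assms in auto)

lemma Ck_on_Pair_right:
  fixes F :: "'a::euclidean_space \<times> 'b::euclidean_space \<Rightarrow> 'c::real_normed_vector"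
  assumes "open V" "Ck_on k W F" "{x} \<times> V \<subseteq> W"
  shows "Ck_on k V (\<lambda>y. F (x, y))"
proof (rule Ck_on_compose[OF assms(1) _ _ assms(2)])
  have "Ck_on k V (\<lambda>y. (0, y) + (x, 0))"
    by (intro Ck_on_add Ck_on_const assms Ck_on_bounded_linear_id bounded_linear_Pair
        bounded_linear_ident bounded_linear_zero)
  then show "Ck_on k V (\<lambda>y. (x, y))" by simp
qed (use assms in auto)

lemma has_derivative_Pair_left:
  fixes F :: "'a::real_normed_vector \<times> 'b::real_normed_vector \<Rightarrow> 'c::real_normed_vector"
  assumes "F differentiable at (x, y)"
  shows "((\<lambda>x. F (x, y)) has_derivative (\<lambda>v. dirderiv (v, 0) F (x, y))) (at x)"
  by (rule has_derivative_compose[where g=F and f="\<lambda>x. (x, y)" and f'="\<lambda>v. (v, 0)"])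
    (auto intro!: derivative_eq_intros has_derivative_dirderiv assms)

lemma has_derivative_Pair_right:
  fixes F :: "'a::real_normed_vector \<times> 'b::real_normed_vector \<Rightarrow> 'c::real_normed_vector"
  assumes "F differentiable at (x, y)"
  shows "((\<lambda>y. F (x, y)) has_derivative (\<lambda>v. dirderiv (0, v) F (x, y))) (at y)"
  by (rule has_derivative_compose[where g=F and f="\<lambda>y. (x, y)" and f'="\<lambda>v. (0, v)"])
    (auto intro!: derivative_eq_intros has_derivative_dirderiv assms)

lemmas dirderiv_Pair_left = dirderiv_eqI[OF has_derivative_Pair_left]

lemma has_real_derivative_line:
  fixes f :: "'a::real_normed_vector \<Rightarrow> real"
  assumes "f differentiable at (x + s *\<^sub>R v)"
  shows "((\<lambda>s. f (x + s *\<^sub>R v)) has_real_derivative dirderiv v f (x + s *\<^sub>R v)) (at s)"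
proof -
  have "((\<lambda>s. x + s *\<^sub>R v) has_derivative (\<lambda>t. t *\<^sub>R v)) (at s)"
    by (auto intro!: derivative_eq_intros)
  from has_derivative_compose[OF this has_derivative_dirderiv[OF assms]]
  show ?thesis
    by (simp add: has_field_derivative_def dirderiv_dir_scaleR[OF assms] mult_commute_abs)
qed

section \<open>Symmetry of second derivatives\<close>

text \<open>The mean value theorem is applied twice: along \<open>v\<close> to the increment in
  \<open>w\<close>, then along \<open>w\<close> to the derivative in \<open>v\<close>.\<close>

lemma second_difference:
  fixes f :: "'a::euclidean_space \<Rightarrow> real"
  assumes f: "Ck_on 2 S f" and h: "h > 0"
    and S: "\<And>a b. a \<in> {0..h} \<Longrightarrow> b \<in> {0..h} \<Longrightarrow> x + a *\<^sub>R v + b *\<^sub>R w \<in> S"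
  obtains a b where "a \<in> {0..h}" "b \<in> {0..h}"
    "f (x + h *\<^sub>R v + h *\<^sub>R w) - f (x + h *\<^sub>R v) - f (x + h *\<^sub>R w) + f x
       = h\<^sup>2 * dirderiv w (dirderiv v f) (x + a *\<^sub>R v + b *\<^sub>R w)"
proof -
  have d1: "f differentiable at y" and d2: "dirderiv v f differentiable at y" if "y \<in> S" for y
    using f that by (auto simp: numeral_2_eq_2)
  define g where "g s = f (x + s *\<^sub>R v + h *\<^sub>R w) - f (x + s *\<^sub>R v)" for s
  define g' where "g' s = dirderiv v f (x + s *\<^sub>R v + h *\<^sub>R w) - dirderiv v f (x + s *\<^sub>R v)" for s
  have "(g has_real_derivative g' s) (at s)" if "s \<in> {0..h}" for s
    unfolding g_def g'_def
    using S[OF that, of 0] S[OF that, of h] h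
      has_real_derivative_line[of f "x + h *\<^sub>R w" s v] has_real_derivative_line[of f x s v]
    by (auto intro!: derivative_intros d1 simp: algebra_simps)
  then obtain a where a: "a > 0" "a < h" "g h - g 0 = (h - 0) * g' a"
    using MVT2[OF h, of g g'] by auto
  define k where "k t = dirderiv v f (x + a *\<^sub>R v + t *\<^sub>R w)" for t
  have "(k has_real_derivative dirderiv w (dirderiv v f) (x + a *\<^sub>R v + t *\<^sub>R w)) (at t)"
    if "t \<in> {0..h}" for t
    unfolding k_def using S[of a t] a that
    by (intro has_real_derivative_line d2) auto
  then obtain b where b: "b > 0" "b < h"
    "k h - k 0 = (h - 0) * dirderiv w (dirderiv v f) (x + a *\<^sub>R v + b *\<^sub>R w)"
    using MVT2[OF h, of k "\<lambda>t. dirderiv w (dirderiv v f) (x + a *\<^sub>R v + t *\<^sub>R w)"] by auto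
  show thesis
    by (rule that[of a b])
      (use a b in \<open>auto simp: g_def g'_def k_def power2_eq_square algebra_simps\<close>)
qed

text \<open>The second difference over a small parallelogram is symmetric in \<open>v\<close> and
  \<open>w\<close>, so it produces a value of each mixed derivative, at two points near
  \<open>x\<close>, that must coincide. Continuity at \<open>x\<close> then rules out a gap.\<close>

lemma dirderiv_commute:
  fixes f :: "'a::euclidean_space \<Rightarrow> real"
  assumes "open S" "Ck_on 2 S f" "x \<in> S"
  shows "dirderiv v (dirderiv w f) x = dirderiv w (dirderiv v f) x"
proof (rule ccontr)
  let ?D1 = "dirderiv w (dirderiv v f)" and ?D2 = "dirderiv v (dirderiv w f)"
  assume "?D2 x \<noteq> ?D1 x"
  \<comment> \<open>Half the gap: numbers within \<open>e\<close> of the two different values cannot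
    be equal.\<close>
  define e where "e = dist (?D1 x) (?D2 x) / 2"
  have e: "e > 0" using \<open>?D2 x \<noteq> ?D1 x\<close> by (auto simp: e_def)
  have "isCont ?D1 x" "isCont ?D2 x"
    using assms by (auto simp: numeral_2_eq_2 continuous_on_eq_continuous_at)
  then have "\<forall>\<^sub>F y in nhds x. dist (?D1 y) (?D1 x) < e \<and> dist (?D2 y) (?D2 x) < e \<and> y \<in> S"
    using e assms by (intro eventually_conj eventually_nhds_in_open)
      (auto simp: isCont_def tendsto_iff eventually_at eventually_nhds_metric dist_commute,
        metis dist_self dist_commute e, metis dist_self dist_commute e)
  then obtain d where d: "d > 0"
    "\<And>y. dist y x < d \<Longrightarrow> dist (?D1 y) (?D1 x) < e \<and> dist (?D2 y) (?D2 x) < e \<and> y \<in> S"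
    by (auto simp: eventually_nhds_metric)
  \<comment> \<open>The whole parallelogram then stays within \<open>d / 2\<close> of
    \<open>x\<close>; the summand 1 keeps the denominator positive when both vectors vanish.\<close>
  define h where "h = d / (2 * (norm v + norm w + 1))"
  have nvw: "norm v + norm w + 1 > 0"
    by (smt (verit) norm_ge_zero)
  have h: "h > 0" using d nvw by (simp add: h_def)
  have near: "dist (x + a *\<^sub>R v + b *\<^sub>R w) x < d" if "a \<in> {0..h}" "b \<in> {0..h}" for a b
  proof -
    have "dist (x + a *\<^sub>R v + b *\<^sub>R w) x \<le> a * norm v + b * norm w"
      using that norm_triangle_ineq[of "a *\<^sub>R v" "b *\<^sub>R w"] by (simp add: dist_norm)
    also have "\<dots> \<le> h * norm v + h * norm w"
      using that by (intro add_mono mult_right_mono) auto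
    also have "\<dots> \<le> h * (norm v + norm w + 1)"
      using h by (simp add: algebra_simps)
    also have "\<dots> = d / 2"
      using nvw unfolding h_def by (simp add: field_simps)
    also have "\<dots> < d" using d by simp
    finally show ?thesis .
  qed
  obtain a b where ab: "a \<in> {0..h}" "b \<in> {0..h}"
    "f (x + h *\<^sub>R v + h *\<^sub>R w) - f (x + h *\<^sub>R v) - f (x + h *\<^sub>R w) + f x
       = h\<^sup>2 * ?D1 (x + a *\<^sub>R v + b *\<^sub>R w)"
    using second_difference[OF assms(2) h, of x v w] near d by blast
  have sym: "x + a *\<^sub>R w + b *\<^sub>R v = x + b *\<^sub>R v + a *\<^sub>R w" for a b by simp
  obtain a' b' where ab': "a' \<in> {0..h}" "b' \<in> {0..h}"
    "f (x + h *\<^sub>R w + h *\<^sub>R v) - f (x + h *\<^sub>R w) - f (x + h *\<^sub>R v) + f x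
       = h\<^sup>2 * ?D2 (x + a' *\<^sub>R w + b' *\<^sub>R v)"
    using second_difference[OF assms(2) h, of x w v] near d sym by metis
  have "h\<^sup>2 * ?D1 (x + a *\<^sub>R v + b *\<^sub>R w) = h\<^sup>2 * ?D2 (x + a' *\<^sub>R w + b' *\<^sub>R v)"
    using ab(3) ab'(3) by (simp add: sym algebra_simps)
  then have "?D1 (x + a *\<^sub>R v + b *\<^sub>R w) = ?D2 (x + a' *\<^sub>R w + b' *\<^sub>R v)"
    using h by simp
  moreover have "dist (?D1 (x + a *\<^sub>R v + b *\<^sub>R w)) (?D1 x) < e"
    using d near ab by blast
  moreover have "dist (?D2 (x + a' *\<^sub>R w + b' *\<^sub>R v)) (?D2 x) < e"
    using d near[OF ab'(2,1)] by (simp add: sym)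
  ultimately show False
    unfolding e_def by (smt (verit) dist_commute dist_triangle field_sum_of_halves)
qed

section \<open>Derivatives along curves\<close>

lemma has_real_derivative_curve:
  fixes g :: "'a::real_normed_vector \<Rightarrow> real"
  assumes "(z has_vector_derivative z1) (at t)" "g differentiable at (z t)"
  shows "((\<lambda>t. g (z t)) has_real_derivative dirderiv z1 g (z t)) (at t)"
proof -
  have "((\<lambda>t. g (z t)) has_derivative (\<lambda>h. dirderiv (h *\<^sub>R z1) g (z t))) (at t)"
    using has_derivative_compose[where f=z and g=g, OF _ has_derivative_dirderiv[OF assms(2)]]
      assms(1) by (simp add: has_vector_derivative_def)
  moreover have "(\<lambda>h. dirderiv (h *\<^sub>R z1) g (z t)) = (*) (dirderiv z1 g (z t))"
    by (auto simp: dirderiv_dir_scaleR[OF assms(2)])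
  ultimately show ?thesis
    by (simp only: has_field_derivative_def)
qed

lemma dirderiv_dirderiv_basis:
  fixes g :: "'a::euclidean_space \<Rightarrow> real"
  assumes "open S" "Ck_on 2 S g" "x \<in> S"
  shows "dirderiv u (dirderiv w g) x = (\<Sum>b\<in>Basis. (w \<bullet> b) * dirderiv u (dirderiv b g) x)"
proof -
  have d1: "g differentiable at y" and d2: "dirderiv v g differentiable at y" if "y \<in> S" for y v
    using assms(2) that by (auto simp: numeral_2_eq_2)
  have "dirderiv u (dirderiv w g) x = dirderiv u (\<lambda>x. \<Sum>b\<in>Basis. (w \<bullet> b) *\<^sub>R dirderiv b g x) x"
    by (rule dirderiv_cong[OF assms(1,3)]) (rule dirderiv_basis[OF d1])
  also have "\<dots> = (\<Sum>b\<in>Basis. (w \<bullet> b) * dirderiv u (dirderiv b g) x)"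
    by (rule dirderiv_eqI) (auto intro!: derivative_eq_intros has_derivative_dirderiv d2 assms)
  finally show ?thesis .
qed

text \<open>The direction \<open>z1 t\<close> moves while it is being differentiated in. Near
  \<open>t0\<close> it is expanded in \<open>Basis\<close>; differentiating the coefficients
  produces the acceleration term with \<open>z2\<close>, the remaining factors the pure second
  derivative.\<close>

lemma has_real_derivative_curve2:
  fixes g :: "'a::euclidean_space \<Rightarrow> real"
  assumes S: "open S" "Ck_on 2 S g" "z t0 \<in> S"
    and z: "(z has_vector_derivative z1 t0) (at t0)"
    and z1: "(z1 has_vector_derivative z2) (at t0)"
  shows "((\<lambda>t. dirderiv (z1 t) g (z t)) has_real_derivative
           dirderiv (z1 t0) (dirderiv (z1 t0) g) (z t0) + dirderiv z2 g (z t0)) (at t0)"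
proof -
  have d1: "g differentiable at y" and d2: "dirderiv v g differentiable at y" if "y \<in> S" for y v
    using S(2) that by (auto simp: numeral_2_eq_2)
  have "isCont z t0"
    using z by (rule has_vector_derivative_continuous)
  then have "\<forall>\<^sub>F t in nhds t0. z t \<in> S"
    using S by (simp add: continuous_at_open eventually_nhds)
  then have ev: "\<forall>\<^sub>F t in nhds t0. dirderiv (z1 t) g (z t)
      = (\<Sum>b\<in>Basis. (z1 t \<bullet> b) * dirderiv b g (z t))"
  proof eventually_elim
    case (elim t)
    then show ?case using dirderiv_basis[OF d1, of "z t" "z1 t"] by simp
  qed
  have zb: "((\<lambda>t. z1 t \<bullet> b) has_real_derivative (z2 \<bullet> b)) (at t0)" for b
    using bounded_linear.has_vector_derivative[OF bounded_linear_inner_left z1, of b]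
    by (simp add: has_real_derivative_iff_has_vector_derivative)
  have "((\<lambda>t. \<Sum>b\<in>Basis. (z1 t \<bullet> b) * dirderiv b g (z t)) has_real_derivative
      (\<Sum>b\<in>Basis. (z1 t0 \<bullet> b) * dirderiv (z1 t0) (dirderiv b g) (z t0)
        + (z2 \<bullet> b) * dirderiv b g (z t0))) (at t0)"
    by (intro DERIV_sum DERIV_mult' zb has_real_derivative_curve z d2 S)
  also have "(\<Sum>b\<in>Basis. (z1 t0 \<bullet> b) * dirderiv (z1 t0) (dirderiv b g) (z t0)
        + (z2 \<bullet> b) * dirderiv b g (z t0))
      = dirderiv (z1 t0) (dirderiv (z1 t0) g) (z t0) + dirderiv z2 g (z t0)"
    using dirderiv_dirderiv_basis[OF S, of "z1 t0" "z1 t0"] dirderiv_basis[OF d1[OF S(3)], of z2]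
    by (simp add: sum.distrib)
  finally show ?thesis
    by (subst DERIV_cong_ev[OF refl ev refl])
qed

section \<open>Second-order criteria on a segment\<close>

lemma nonneg_if_second_derivative_nonneg:
  fixes h :: "real \<Rightarrow> real"
  assumes "\<And>t. t \<in> {0..1} \<Longrightarrow> (h has_real_derivative h' t) (at t)"
    and "\<And>t. t \<in> {0..1} \<Longrightarrow> (h' has_real_derivative h'' t) (at t)"
    and "\<And>t. t \<in> {0..1} \<Longrightarrow> h'' t \<ge> 0"
    and "h 0 = 0" "h' 0 = 0"
  shows "h 1 \<ge> 0"
proof -
  have "h' 0 \<le> h' t" if "t \<in> {0..1}" for t
  proof (rule DERIV_nonneg_imp_nondecreasing[of 0 t h'])
    show "\<exists>y. (h' has_real_derivative y) (at x) \<and> 0 \<le> y" if "0 \<le> x" "x \<le> t" for x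
      using assms(2,3)[of x] that \<open>t \<in> {0..1}\<close> by auto
  qed (use that in auto)
  then have "h 0 \<le> h 1"
  proof (intro DERIV_nonneg_imp_nondecreasing[of 0 1 h])
    show "\<exists>y. (h has_real_derivative y) (at x) \<and> 0 \<le> y" if "0 \<le> x" "x \<le> 1" for x
      using assms(1)[of x] that \<open>\<And>t. t \<in> {0..1} \<Longrightarrow> h' 0 \<le> h' t\<close>[of x] assms(5) by auto
  qed auto
  then show ?thesis using assms by simp
qed

text \<open>At an interior maximum \<open>p'\<close> vanishes. Wherever \<open>p'\<close> is
  negative the hypothesis reads \<open>p'' t \<ge> K * p' t\<close>, so
  \<open>p' t * exp (- K * t)\<close> cannot decrease there, and \<open>p'\<close> cannot become
  negative after a zero. Hence \<open>p\<close> does not fall between the maximum and 1.\<close>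

lemma le_max_if_second_derivative_ge:
  fixes p :: "real \<Rightarrow> real"
  assumes p: "\<And>t. t \<in> {0..1} \<Longrightarrow> (p has_real_derivative p' t) (at t)"
    and p': "\<And>t. t \<in> {0..1} \<Longrightarrow> (p' has_real_derivative p'' t) (at t)"
    and K: "\<And>t. t \<in> {0..1} \<Longrightarrow> p'' t \<ge> - K * \<bar>p' t\<bar>"
    and s: "s \<in> {0..1}"
  shows "p s \<le> max (p 0) (p 1)"
proof (rule ccontr)
  assume contra: "\<not> p s \<le> max (p 0) (p 1)"
  have contp: "continuous_on {0..1} p" and contp': "continuous_on {0..1} p'"
    using p p' by (blast intro!: continuous_at_imp_continuous_on DERIV_isCont)+
  obtain m where m: "m \<in> {0..1}" "\<And>t. t \<in> {0..1} \<Longrightarrow> p t \<le> p m"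
    using continuous_attains_sup[OF _ _ contp] by auto
  have "p m > p 0" "p m > p 1" using m(2)[OF s] contra by auto
  then have m01: "0 < m" "m < 1" using m(1) by (auto simp: less_le)
  have "p' m = 0"
    by (rule DERIV_local_max[OF p[OF m(1)], of "min m (1 - m)"])
      (use m m01 in \<open>auto simp: abs_if split: if_splits\<close>)
  have "p' a \<ge> 0" if a: "a \<in> {m..1}" for a
  proof (rule ccontr)
    assume "\<not> p' a \<ge> 0"
    \<comment> \<open>The maximum \<open>b\<close> of \<open>N\<close> is the last time before
      \<open>a\<close> with \<open>p'\<close> nonnegative; on the rest of the interval
      \<open>p'\<close> is strictly negative.\<close>
    define N where "N = {t \<in> {m..a}. p' t \<ge> 0}"
    have "continuous_on {m..a} p'"
      using contp' m01 a by (auto intro: continuous_on_subset)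
    then have "closed N" unfolding N_def
      by (intro continuous_closed_preimage[of "{m..a}" p' "{0..}", simplified vimage_def, simplified]
          continuous_on_closed_Collect_le) (auto intro!: continuous_intros)
    moreover have "bounded N" by (rule bounded_subset[of "{m..a}"]) (auto simp: N_def)
    moreover have "m \<in> N" using \<open>p' m = 0\<close> a by (auto simp: N_def)
    ultimately obtain b where b: "b \<in> N" "\<And>t. t \<in> N \<Longrightarrow> t \<le> b"
      using compact_attains_sup[of N] compact_eq_bounded_closed by blast
    have "b < a" "b \<ge> m" "p' b \<ge> 0" using b(1) \<open>\<not> p' a \<ge> 0\<close> by (auto simp: N_def less_le)
    have neg: "p' t < 0" if "b < t" "t \<le> a" for t
      using b(2)[of t] that \<open>b \<ge> m\<close> by (force simp: N_def)
    \<comment> \<open>Integrating factor for the differential inequality; \<open>q\<close> has the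
      sign of \<open>p'\<close> and is nondecreasing between \<open>b\<close> and
      \<open>a\<close>.\<close>
    define q where "q t = p' t * exp (- K * t)" for t
    have q: "(q has_real_derivative (p'' t - K * p' t) * exp (- K * t)) (at t)"
      if "t \<in> {0..1}" for t
      unfolding q_def using p'[OF that] by (auto intro!: derivative_eq_intros simp: algebra_simps)
    have "q b \<le> q a"
    proof (rule DERIV_nonneg_imp_increasing_open[of b a q])
      show "continuous_on {b..a} q"
        by (intro continuous_at_imp_continuous_on ballI DERIV_isCont[OF q])
          (use \<open>b \<ge> m\<close> m01 a in auto)
      show "\<exists>y. (q has_real_derivative y) (at t) \<and> 0 \<le> y" if "b < t" "t < a" for t
        using q[of t] K[of t] neg[of t] that \<open>b \<ge> m\<close> m01 a by (intro exI conjI) auto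
    qed (use \<open>b < a\<close> in auto)
    moreover have "q a < 0" "q b \<ge> 0"
      using \<open>\<not> p' a \<ge> 0\<close> \<open>p' b \<ge> 0\<close> by (auto simp: q_def mult_neg_pos)
    ultimately show False by simp
  qed
  then have "p m \<le> p 1"
  proof (intro DERIV_nonneg_imp_nondecreasing[of m 1 p])
    show "\<exists>y. (p has_real_derivative y) (at x) \<and> 0 \<le> y" if "m \<le> x" "x \<le> 1" for x
      using p[of x] that \<open>\<And>a. a \<in> {m..1} \<Longrightarrow> p' a \<ge> 0\<close>[of x] m01 by auto
  qed (use m01 in auto)
  then show False using \<open>p m > p 1\<close> by simp
qed

lemma Ck_on_2D:
  assumes "Ck_on 2 S f" "x \<in> S"
  shows "f differentiable at x" "dirderiv v f differentiable at x"
  using assms by (auto simp: numeral_2_eq_2)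

lemma Ck_on_2_continuous:
  assumes "Ck_on 2 S f"
  shows "continuous_on S f" "continuous_on S (dirderiv v f)"
    "continuous_on S (dirderiv w (dirderiv v f))"
  using assms Ck_on_mono[OF assms, of 0] Ck_on_mono[OF assms, of 1]
  by (auto simp: numeral_2_eq_2 continuous_at_imp_continuous_on differentiable_imp_continuous_within)

lemma dirderiv_eq_inner:
  fixes f :: "'a::euclidean_space \<Rightarrow> real"
  assumes "f differentiable at x"
  shows "dirderiv v f x = v \<bullet> (\<Sum>b\<in>Basis. dirderiv b f x *\<^sub>R b)"
  using dirderiv_basis[OF assms, of v] by (simp add: inner_sum_right mult.commute)

text \<open>Along the segment, the velocity \<open>v\<close> is split into a vector tangent to the
  level set and \<open>l t\<close> times a normalised gradient. The tangential part contributes a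
  nonnegative second derivative, and everything else carries a factor \<open>l t\<close>, the
  derivative of \<open>f\<close> along the segment. The remaining factor is bounded by compactness,
  because the gradient has no zero.\<close>

proposition quasiconvex_second_order:
  fixes f :: "'a::euclidean_space \<Rightarrow> real"
  assumes T: "open T" "convex T" and f: "Ck_on 2 T f"
    and noncrit: "\<And>q. q \<in> T \<Longrightarrow> \<exists>v. dirderiv v f q \<noteq> 0"
    and tangential: "\<And>q v. q \<in> T \<Longrightarrow> dirderiv v f q = 0 \<Longrightarrow> dirderiv v (dirderiv v f) q \<ge> 0"
    and q: "q0 \<in> T" "q1 \<in> T" and s: "s \<in> {0..1}"
  shows "f (q0 + s *\<^sub>R (q1 - q0)) \<le> max (f q0) (f q1)"
proof -
  define v where "v = q1 - q0"
  define z where "z t = q0 + t *\<^sub>R v" for t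
  have z: "z t \<in> T" if "t \<in> {0..1}" for t
    using convexD_alt[OF T(2) q, of t] that by (simp add: z_def v_def algebra_simps)
  note d1 = Ck_on_2D(1)[OF f] and d2 = Ck_on_2D(2)[OF f]
  define n where "n x = (\<Sum>b\<in>Basis. dirderiv b f x *\<^sub>R b)" for x
  have n: "dirderiv u f x = u \<bullet> n x" if "x \<in> T" for u x
    unfolding n_def by (rule dirderiv_eq_inner[OF d1[OF that]])
  have n0: "n x \<noteq> 0" if "x \<in> T" for x
    using noncrit[OF that] n[OF that] by auto
  \<comment> \<open>Scaled so that the derivative of \<open>f\<close> in direction
    \<open>w t\<close> is 1; subtracting \<open>l t *\<^sub>R w t\<close> from \<open>v\<close> then
    removes exactly the derivative along \<open>v\<close>.\<close>
  define w where "w t = n (z t) /\<^sub>R (norm (n (z t)))\<^sup>2" for t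
  define B where "B a b t = dirderiv a (dirderiv b f) (z t)" for a b t
  define l where "l t = dirderiv v f (z t)" for t
  \<comment> \<open>In invariant form this is
    \<open>2 * B (w t) v t - l t * B (w t) (w t) t\<close>, the cofactor of \<open>l t\<close> in
    the expansion of \<open>B v v t\<close>. Coordinates are used so that its continuity in
    \<open>t\<close> reduces to second derivatives in fixed directions.\<close>
  define R where "R t = (\<Sum>b\<in>Basis. (w t \<bullet> b) * (2 * B b v t - l t * (\<Sum>c\<in>Basis. (w t \<bullet> c) * B b c t)))" for t
  have contz: "continuous_on {0..1} z" unfolding z_def by (intro continuous_intros)
  have cont: "continuous_on {0..1} (\<lambda>t. g (z t))" if "continuous_on T g" for g :: "'a \<Rightarrow> real"
    by (rule continuous_on_compose2[OF that contz]) (use z in auto)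
  have contn: "continuous_on {0..1} (\<lambda>t. n (z t))"
    unfolding n_def by (intro continuous_intros cont Ck_on_2_continuous[OF f])
  have "continuous_on {0..1} R"
    unfolding R_def B_def l_def w_def
    by (intro continuous_intros cont Ck_on_2_continuous[OF f] contn) (use n0 z in auto)
  then have "bounded (R ` {0..1})"
    by (intro compact_imp_bounded compact_continuous_image) auto
  then obtain K where "\<forall>t\<in>{0..1}. \<bar>R t\<bar> \<le> K"
    unfolding bounded_iff by auto
  then have K: "\<bar>R t\<bar> \<le> K" if "t \<in> {0..1}" for t
    using that by blast
  have second: "B v v t \<ge> - K * \<bar>l t\<bar>" if t: "t \<in> {0..1}" for t
  proof -
    have zt: "z t \<in> T" using z t .
    have sym: "B a b t = B b a t" for a b
      unfolding B_def by (rule dirderiv_commute[OF T(1) f zt])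
    have lin: "linear (\<lambda>a. B a b t)" for b
      unfolding B_def by (intro bounded_linear.linear bounded_linear_dirderiv d2 zt)
    note lin1 = linear_add[OF lin] linear_diff[OF lin] linear_scale[OF lin]
    have lin2: "linear (\<lambda>b. B a b t)" for a
    proof -
      have "(\<lambda>b. B a b t) = (\<lambda>b. B b a t)" by (rule ext) (rule sym)
      with lin[of a] show ?thesis by (simp only:)
    qed
    note lin2 = linear_add[OF lin2] linear_diff[OF lin2] linear_scale[OF lin2]
    have exp: "(\<Sum>b\<in>Basis. (w t \<bullet> b) * B b a t) = B (w t) a t" for a
      using linear_sum[OF lin, of "\<lambda>b. (w t \<bullet> b) *\<^sub>R b" Basis a] linear_scale[OF lin]
      by (simp add: euclidean_representation)
    have exp': "(\<Sum>c\<in>Basis. (w t \<bullet> c) * B b c t) = B b (w t) t" for b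
      using exp[of b] sym[of b "w t"] by (simp only: sym[of b])
    have R: "R t = 2 * B (w t) v t - l t * B (w t) (w t) t"
      unfolding R_def exp'
      using exp[of v] exp[of "w t"]
      by (simp add: algebra_simps sum_subtractf flip: sum_distrib_left)
    define u where "u = v - l t *\<^sub>R w t"
    have "dirderiv u f (z t) = 0"
      using n0[OF zt] n[OF zt] by (simp add: u_def w_def l_def inner_diff_left power2_norm_eq_inner)
    then have "B u u t \<ge> 0" unfolding B_def using tangential zt by blast
    moreover have "B v v t = B u u t + l t * R t"
      unfolding R u_def using sym[of v "w t"]
      by (simp add: lin1 lin2 algebra_simps power2_eq_square)
    moreover have "l t * R t \<ge> - K * \<bar>l t\<bar>"
      using K[OF t] by (smt (verit, best) abs_ge_zero abs_mult minus_mult_left mult.commute mult_right_mono)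
    ultimately show ?thesis by linarith
  qed
  have "f (z s) \<le> max (f (z 0)) (f (z 1))"
  proof (rule le_max_if_second_derivative_ge[where p' = l and p'' = "B v v" and K = K])
    show "((\<lambda>t. f (z t)) has_real_derivative l t) (at t)" if "t \<in> {0..1}" for t
      unfolding l_def z_def
      by (rule has_real_derivative_line) (use d1 z[OF that] in \<open>simp add: z_def\<close>)
    show "(l has_real_derivative B v v t) (at t)" if "t \<in> {0..1}" for t
      unfolding l_def B_def z_def
      by (rule has_real_derivative_line) (use d2 z[OF that] in \<open>simp add: z_def\<close>)
  qed (use second s in auto)
  then show ?thesis by (simp add: z_def v_def)
qed

section \<open>Second-order regularity of an inverse map\<close>

text \<open>A product rule in which \<open>n\<close> need only be continuous: the term that would
  contain the derivative of \<open>n\<close> is multiplied by \<open>k x = 0\<close>.\<close>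

lemma has_derivative_scaleR_zero:
  fixes k :: "'a::real_normed_vector \<Rightarrow> real" and n :: "'a \<Rightarrow> 'b::real_normed_vector"
  assumes k: "(k has_derivative k') (at x)" "k x = 0" and n: "isCont n x"
  shows "((\<lambda>y. k y *\<^sub>R n y) has_derivative (\<lambda>h. k' h *\<^sub>R n x)) (at x)"
proof -
  interpret k': bounded_linear k' using k(1) by (rule has_derivative_bounded_linear)
  obtain K where K: "\<And>h. norm (k' h) \<le> norm h * K" using k'.bounded by blast
  have 1: "((\<lambda>y. ((k y - k x - k' (y - x)) / norm (y - x)) *\<^sub>R n y) \<longlongrightarrow> 0 *\<^sub>R n x) (at x)"
  proof (intro tendsto_scaleR)
    show "((\<lambda>y. (k y - k x - k' (y - x)) / norm (y - x)) \<longlongrightarrow> 0) (at x)"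
      using k(1) by (simp add: has_derivative_at' has_derivative_iff_norm tendsto_norm_zero_iff
          flip: norm_divide tendsto_norm_zero_iff[of "\<lambda>y. (k y - k x - k' (y - x)) / norm (y - x)"])
    show "(n \<longlongrightarrow> n x) (at x)" using n by (simp add: isCont_def)
  qed
  have 2: "((\<lambda>y. (k' (y - x) / norm (y - x)) *\<^sub>R (n y - n x)) \<longlongrightarrow> 0) (at x)"
  proof (rule Lim_null_comparison)
    show "\<forall>\<^sub>F y in at x. norm ((k' (y - x) / norm (y - x)) *\<^sub>R (n y - n x)) \<le> \<bar>K\<bar> * norm (n y - n x)"
    proof (rule eventually_at_topological[THEN iffD2], intro exI[of _ UNIV] conjI ballI impI)
      fix y assume "y \<noteq> x"
      have "\<bar>k' (y - x)\<bar> \<le> norm (y - x) * \<bar>K\<bar>"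
        using K[of "y - x"] by (smt (verit) mult_left_mono norm_ge_zero real_norm_def)
      then show "norm ((k' (y - x) / norm (y - x)) *\<^sub>R (n y - n x)) \<le> \<bar>K\<bar> * norm (n y - n x)"
        using \<open>y \<noteq> x\<close> mult_right_mono[OF _ norm_ge_zero[of "n y - n x"]]
        by (fastforce simp: divide_simps ac_simps)
    qed auto
    have "((\<lambda>y. norm (n y - n x)) \<longlongrightarrow> 0) (at x)"
      using n by (simp add: isCont_def LIM_zero_iff tendsto_norm_zero_iff)
    then show "((\<lambda>y. \<bar>K\<bar> * norm (n y - n x)) \<longlongrightarrow> 0) (at x)"
      using tendsto_mult_right_zero by blast
  qed
  have "((\<lambda>y. (1 / norm (y - x)) *\<^sub>R (k y *\<^sub>R n y - (k x *\<^sub>R n x + k' (y - x) *\<^sub>R n x))) \<longlongrightarrow> 0) (at x)"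
    using tendsto_add[OF 1 2] k(2)
    by (simp add: algebra_simps diff_divide_distrib)
  then show ?thesis
    by (auto simp: has_derivative_within k'.bounded_linear_axioms
        intro: bounded_linear_scaleR_left[THEN bounded_linear_compose] k'.bounded_linear_axioms)
qed

text \<open>The derivative of \<open>g\<close> inverts that of \<open>G\<close> at
  \<open>g p\<close>. Instead of differentiating an inverse matrix, the increment of
  \<open>dirderiv b g\<close> is written as the derivative of \<open>g\<close> applied to a vector
  that vanishes at \<open>p\<close>, so that continuity of the first derivatives of \<open>g\<close>
  suffices.\<close>

lemma Ck_on_2_inverse:
  fixes G g :: "'a::euclidean_space \<Rightarrow> 'a"
  assumes S: "open S" "Ck_on 2 S G" and T: "open T" "Ck_on 1 T g" "g ` T \<subseteq> S"
    and inv: "\<And>p. p \<in> T \<Longrightarrow> G (g p) = p"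
  shows "Ck_on 2 T g"
proof -
  have G1: "G differentiable at x" and G2: "dirderiv v G differentiable at x" if "x \<in> S" for x v
    using Ck_on_2D[OF S(2) that] by auto
  have g1: "g differentiable at p" and gc: "continuous_on T (dirderiv v g)" if "p \<in> T" for p v
    using T(2) that by auto
  have right: "dirderiv (dirderiv b g p) G (g p) = b" if p: "p \<in> T" for b p
  proof -
    have "dirderiv b (\<lambda>p. G (g p)) p = dirderiv (dirderiv b g p) G (g p)"
      using g1[OF p] G1 T(3) p by (intro dirderiv_compose) auto
    moreover have "dirderiv b (\<lambda>p. G (g p)) p = dirderiv b (\<lambda>p. p) p"
      by (rule dirderiv_cong[OF T(1) p]) (rule inv)
    moreover have "dirderiv b (\<lambda>p. p) p = b"
      by (rule dirderiv_eqI) (rule has_derivative_ident)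
    ultimately show ?thesis by simp
  qed
  \<comment> \<open>Only \<open>G (g p) = p\<close> is given, so the chain rule supplies one order
    of composition; finite dimension supplies the other.\<close>
  have left: "dirderiv (dirderiv w G (g p)) g p = w" if p: "p \<in> T" for w p
  proof -
    define A where "A w = dirderiv w G (g p)" for w
    define N where "N b = dirderiv b g p" for b
    have lin: "linear A" "linear N"
      unfolding A_def N_def
      using bounded_linear_dirderiv[OF G1, of "g p"] bounded_linear_dirderiv[OF g1[OF p]] p T(3)
      by (auto intro: bounded_linear.linear)
    have AN: "A \<circ> N = id"
      using right[OF p] by (auto simp: A_def N_def)
    then have "N \<circ> A = id"
      using linear_inverse_left[OF lin] by blast
    then show ?thesis by (metis A_def N_def comp_apply id_apply)
  qed
  have deriv: "(dirderiv b g has_derivative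
      (\<lambda>d. - dirderiv (dirderiv (dirderiv d g p) (dirderiv (dirderiv b g p) G) (g p)) g p)) (at p)"
    if p: "p \<in> T" for b p
  proof -
    define w where "w = dirderiv b g p"
    define D where "D d = dirderiv (dirderiv d g p) (dirderiv w G) (g p)" for d
    have gp: "g p \<in> S" using p T(3) by auto
    \<comment> \<open>Since the derivative of \<open>g\<close> at \<open>y\<close> maps
      \<open>dirderiv w G (g y)\<close> to \<open>w\<close>, and \<open>dirderiv w G (g p)\<close>
      equals \<open>b\<close>, applying it to \<open>r y\<close> gives
      \<open>dirderiv b g y - w\<close>. As \<open>r p = 0\<close>, the product rule above applies
      to its expansion in \<open>Basis\<close>.\<close>
    define r where "r y = dirderiv w G (g p) - dirderiv w G (g y)" for y
    have "(g has_derivative (\<lambda>d. dirderiv d g p)) (at p)"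
      by (rule has_derivative_dirderiv[OF g1[OF p]])
    then have "((\<lambda>y. dirderiv w G (g y)) has_derivative D) (at p)"
      unfolding D_def
      using has_derivative_compose[where f = g and g = "dirderiv w G", OF _ has_derivative_dirderiv[OF G2[OF gp]]]
      by blast
    then have r: "(r has_derivative (\<lambda>d. - D d)) (at p)"
      unfolding r_def by (auto intro!: derivative_eq_intros)
    have "((\<lambda>y. \<Sum>j\<in>Basis. (r y \<bullet> j) *\<^sub>R dirderiv j g y) has_derivative
        (\<lambda>d. \<Sum>j\<in>Basis. (- D d \<bullet> j) *\<^sub>R dirderiv j g p)) (at p)"
    proof (intro has_derivative_sum has_derivative_scaleR_zero)
      show "((\<lambda>y. r y \<bullet> j) has_derivative (\<lambda>d. - D d \<bullet> j)) (at p)" for j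
        using r by (rule has_derivative_inner_left)
      show "r p \<bullet> j = 0" for j by (simp add: r_def)
      show "isCont (dirderiv j g) p" for j
        using gc[OF p] T(1) p by (simp add: continuous_on_eq_continuous_at)
    qed
    then have "((\<lambda>y. (\<Sum>j\<in>Basis. (r y \<bullet> j) *\<^sub>R dirderiv j g y) + w) has_derivative
        (\<lambda>d. \<Sum>j\<in>Basis. (- D d \<bullet> j) *\<^sub>R dirderiv j g p)) (at p)"
      using has_derivative_add[OF _ has_derivative_const[of w]] by fastforce
    moreover have "(\<Sum>j\<in>Basis. (r y \<bullet> j) *\<^sub>R dirderiv j g y) + w = dirderiv b g y" if y: "y \<in> T" for y
    proof -
      have "(\<Sum>j\<in>Basis. (r y \<bullet> j) *\<^sub>R dirderiv j g y) = dirderiv (r y) g y"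
        by (rule dirderiv_basis[OF g1[OF y], symmetric])
      also have "\<dots> = dirderiv b g y - w"
        unfolding r_def dirderiv_dir_diff[OF g1[OF y]] left[OF y]
        by (simp add: w_def right[OF p])
      finally show ?thesis by simp
    qed
    ultimately have "(dirderiv b g has_derivative
        (\<lambda>d. \<Sum>j\<in>Basis. (- D d \<bullet> j) *\<^sub>R dirderiv j g p)) (at p)"
      using has_derivative_transform_within_open[OF _ T(1) p] by force
    moreover have "(\<Sum>j\<in>Basis. (- D d \<bullet> j) *\<^sub>R dirderiv j g p) = - dirderiv (D d) g p" for d
      by (subst dirderiv_basis[OF g1[OF p]]) (simp add: sum_negf)
    ultimately show ?thesis by (simp add: D_def w_def)
  qed
  have second: "dirderiv d (dirderiv b g) p
      = - (\<Sum>j\<in>Basis. (dirderiv (dirderiv d g p) (dirderiv (dirderiv b g p) G) (g p) \<bullet> j) *\<^sub>R dirderiv j g p)"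
    if p: "p \<in> T" for b d p
    by (subst dirderiv_basis[OF g1[OF p], symmetric]) (rule dirderiv_eqI[OF deriv[OF p]])
  \<comment> \<open>Both directions will move with the point; this leaves moving scalars times
    second derivatives of \<open>G\<close> in fixed directions, whose continuity is known.\<close>
  have third: "dirderiv u (dirderiv w G) x \<bullet> j
      = (\<Sum>a\<in>Basis. \<Sum>c\<in>Basis. (u \<bullet> a) * (w \<bullet> c) * (dirderiv a (dirderiv c G) x \<bullet> j))"
    if x: "x \<in> S" for u w x j
  proof -
    have "dirderiv u (dirderiv w G) x
      = dirderiv u (\<lambda>x. \<Sum>c\<in>Basis. (w \<bullet> c) *\<^sub>R dirderiv c G x) x"
      by (rule dirderiv_cong[OF S(1) x]) (rule dirderiv_basis[OF G1])
    also have "\<dots> = (\<Sum>c\<in>Basis. (w \<bullet> c) *\<^sub>R dirderiv u (dirderiv c G) x)"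
      by (rule dirderiv_eqI) (auto intro!: derivative_eq_intros has_derivative_dirderiv G2 x)
    also have "\<dots> = (\<Sum>c\<in>Basis. (w \<bullet> c) *\<^sub>R (\<Sum>a\<in>Basis. (u \<bullet> a) *\<^sub>R dirderiv a (dirderiv c G) x))"
      using dirderiv_basis[OF G2[OF x], of u] by presburger
    also have "\<dots> = (\<Sum>a\<in>Basis. \<Sum>c\<in>Basis. ((u \<bullet> a) * (w \<bullet> c)) *\<^sub>R dirderiv a (dirderiv c G) x)"
      by (subst sum.swap) (simp add: scaleR_sum_right mult.commute)
    finally show ?thesis by (simp add: inner_sum_left)
  qed
  have contg: "continuous_on T g"
    using Ck_on_mono[OF T(2), of 0] by simp
  have "continuous_on T (\<lambda>p. dirderiv a (dirderiv c G) (g p))" for a c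
    by (rule continuous_on_compose2[OF Ck_on_2_continuous(3)[OF S(2)] contg T(3)])
  then have "continuous_on T (\<lambda>p. - (\<Sum>j\<in>Basis. (\<Sum>a\<in>Basis. \<Sum>c\<in>Basis.
      (dirderiv d g p \<bullet> a) * (dirderiv b g p \<bullet> c) * (dirderiv a (dirderiv c G) (g p) \<bullet> j))
        *\<^sub>R dirderiv j g p))" for b d
    using T(2) by (intro continuous_intros) auto
  then have "continuous_on T (dirderiv d (dirderiv b g))" for b d
    by (rule continuous_on_eq) (use second third T(3) in \<open>simp add: image_subset_iff\<close>)
  moreover have "dirderiv b g differentiable at p" if "p \<in> T" for b p
    using deriv[OF that] by (rule differentiableI)
  ultimately show ?thesis using g1 by (simp add: numeral_2_eq_2)
qed

section \<open>Functions that are regular up to the boundary\<close>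

lemma Ck_closure_scaleR_const:
  "Ck_closure k S f \<Longrightarrow> Ck_closure k S (\<lambda>x. r *\<^sub>R f x)"
proof (induction k arbitrary: f)
  case 0
  then show ?case by (auto intro: continuous_intros)
next
  case (Suc k)
  then obtain f' where "continuous_on (closure S) f" "\<forall>x\<in>S. (f has_derivative f' x) (at x)"
    "\<forall>b\<in>Basis. Ck_closure k S (\<lambda>x. f' x b)"
    by auto
  then show ?case
    using Suc.IH
    by (auto intro!: continuous_intros exI[of _ "\<lambda>x b. r *\<^sub>R f' x b"] has_derivative_scaleR_right)
qed

lemma Ck_closure_add:
  "Ck_closure k S f \<Longrightarrow> Ck_closure k S g \<Longrightarrow> Ck_closure k S (\<lambda>x. f x + g x)"
proof (induction k arbitrary: f g)
  case 0
  then show ?case by (auto intro: continuous_intros)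
next
  case (Suc k)
  then obtain f' g' where "continuous_on (closure S) f" "\<forall>x\<in>S. (f has_derivative f' x) (at x)"
    "\<forall>b\<in>Basis. Ck_closure k S (\<lambda>x. f' x b)"
    and "continuous_on (closure S) g" "\<forall>x\<in>S. (g has_derivative g' x) (at x)"
    "\<forall>b\<in>Basis. Ck_closure k S (\<lambda>x. g' x b)"
    by auto
  then show ?case
    using Suc.IH
    by (auto intro!: continuous_intros exI[of _ "\<lambda>x b. f' x b + g' x b"] has_derivative_add)
qed

lemma Ck_closure_zero: "Ck_closure k S (\<lambda>x. 0)"
  by (induction k) (auto intro!: exI[of _ "\<lambda>x b. 0"])

lemma Ck_closure_sum:
  "finite I \<Longrightarrow> (\<And>i. i \<in> I \<Longrightarrow> Ck_closure k S (f i)) \<Longrightarrow> Ck_closure k S (\<lambda>x. \<Sum>i\<in>I. f i x)"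
  by (induction I rule: finite_induct) (auto intro: Ck_closure_zero Ck_closure_add)

lemma Ck_closure_continuous: "Ck_closure k S f \<Longrightarrow> continuous_on (closure S) f"
  by (cases k) auto

text \<open>At boundary points \<open>dirderiv v f\<close> has no controlled value, so the
  continuous extension is carried by a separate function \<open>D v\<close> that agrees with it on
  \<open>S\<close>.\<close>

lemma Ck_closure_SucE:
  assumes "Ck_closure (Suc k) S f"
  obtains D where "\<And>v. Ck_closure k S (D v)" "\<And>v x. x \<in> S \<Longrightarrow> dirderiv v f x = D v x"
    "\<And>x. x \<in> S \<Longrightarrow> f differentiable at x"
proof -
  obtain f' where f': "\<And>x. x \<in> S \<Longrightarrow> (f has_derivative f' x) (at x)"
    "\<And>b. b \<in> Basis \<Longrightarrow> Ck_closure k S (\<lambda>x. f' x b)"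
    using assms by auto
  show thesis
  proof (rule that)
    show "Ck_closure k S (\<lambda>x. \<Sum>b\<in>Basis. (v \<bullet> b) *\<^sub>R f' x b)" for v
      by (intro Ck_closure_sum Ck_closure_scaleR_const f') auto
    show d: "f differentiable at x" if "x \<in> S" for x
      using f'(1)[OF that] by (rule differentiableI)
    show "dirderiv v f x = (\<Sum>b\<in>Basis. (v \<bullet> b) *\<^sub>R f' x b)" if "x \<in> S" for v x
      by (subst dirderiv_basis[OF d[OF that]]) (simp only: dirderiv_eqI[OF f'(1)[OF that]])
  qed
qed

lemma Ck_closure_imp_Ck_on:
  assumes "open S" "Ck_closure k S f"
  shows "Ck_on k S f"
  using assms(2)
proof (induction k arbitrary: f)
  case 0
  then show ?case using closure_subset by (auto intro: continuous_on_subset)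
next
  case (Suc k)
  from Suc.prems obtain D where D: "\<And>v. Ck_closure k S (D v)"
    "\<And>v x. x \<in> S \<Longrightarrow> dirderiv v f x = D v x" "\<And>x. x \<in> S \<Longrightarrow> f differentiable at x"
    by (rule Ck_closure_SucE) blast
  have "Ck_on k S (dirderiv v f)" for v
    by (rule Ck_on_cong[OF assms(1) Suc.IH[OF D(1)[of v]]]) (simp add: D)
  then show ?case using D(3) by simp
qed

lemma Ck_closure_imp_bounded:
  assumes "bounded S" "Ck_closure k S f"
  shows "bounded (f ` S)"
proof -
  have "bounded (f ` closure S)"
    using Ck_closure_continuous[OF assms(2)] assms(1)
    by (intro compact_imp_bounded compact_continuous_image) (auto simp: compact_closure)
  then show ?thesis
    by (rule bounded_subset) (auto simp: closure_subset image_mono)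
qed

section \<open>The cost and its exponential coordinates\<close>

lemma Ck_on_dirderiv: "Ck_on k S f \<Longrightarrow> Suc j = k \<Longrightarrow> Ck_on j S (dirderiv v f)"
  by (metis Ck_on.simps(2))

lemma Ck_on_differentiable: "Ck_on k S f \<Longrightarrow> 0 < k \<Longrightarrow> x \<in> S \<Longrightarrow> f differentiable at x"
  by (metis Ck_on.simps(2) gr0_conv_Suc)

lemma gradient_eqI:
  assumes "\<And>v. f' v = v \<bullet> D" "(f has_derivative f') (at x)"
  shows "gradient f x = D"
  unfolding gradient_def
proof (rule the_equality)
  have f': "f' = (\<lambda>h. h \<bullet> D)" using assms(1) by auto
  show "GDERIV f x :> D" using assms(2) by (simp add: gderiv_def f')
  show "D' = D" if "GDERIV f x :> D'" for D'
  proof -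
    have "(\<lambda>h. h \<bullet> D') = (\<lambda>h. h \<bullet> D)"
      using has_derivative_unique that assms(2) unfolding gderiv_def f' by blast
    then show ?thesis by (metis vector_eq_ldot)
  qed
qed

text \<open>An open set in a Euclidean space has no isolated points, so the punctured filter is
  nontrivial at interior points as well as on the boundary, and the limit is unique.\<close>

lemma Lim_at_closure:
  fixes f :: "'a::euclidean_space \<Rightarrow> 'b::t2_space"
  assumes "open W" "continuous_on (closure W) F" "\<And>z. z \<in> W \<Longrightarrow> f z = F z" "z \<in> closure W"
  shows "Lim (at z within W) f = F z"
proof (rule tendsto_Lim)
  show "at z within W \<noteq> bot"
    using assms(1,4) interior_limit_point[of z W] islimpt_in_closure trivial_limit_within
    by (metis closure_Un_frontier closure_iff_nhds_not_empty Un_iff closure_def interior_open mem_Collect_eq)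
  have "(F \<longlongrightarrow> F z) (at z within W)"
    using assms(2,4) closure_subset
    by (metis continuous_on_def tendsto_within_subset)
  then show "(f \<longlongrightarrow> F z) (at z within W)"
    by (rule Lim_transform_eventually) (use assms(3) in \<open>auto simp: eventually_at_filter\<close>)
qed

section \<open>Curves that are lines in exponential coordinates\<close>

text \<open>A curve straightened by \<open>G\<close>, bundled with its velocity and acceleration.
  With \<open>G\<close> equal to -D_y c(., y) or -D_x c(x, .) these are the two halves of a curve
  tested by (B3). The time set is open, so that derivatives are two-sided and the preimage of an
  open coordinate domain serves directly.\<close>

definition coord_lift ::
  "real set \<Rightarrow> 'a::euclidean_space set \<Rightarrow> ('a \<Rightarrow> 'a) \<Rightarrow> 'a \<Rightarrow> 'a
    \<Rightarrow> (real \<Rightarrow> 'a) \<Rightarrow> (real \<Rightarrow> 'a) \<Rightarrow> (real \<Rightarrow> 'a) \<Rightarrow> bool" where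
  "coord_lift J S G p v z z1 z2 \<longleftrightarrow> open J \<and> (\<forall>t\<in>J. z t \<in> S \<and> G (z t) = p + t *\<^sub>R v \<and>
     (z has_vector_derivative z1 t) (at t) \<and> (z1 has_vector_derivative z2 t) (at t))"

lemma has_vector_derivative_line:
  assumes "g differentiable at (p + t *\<^sub>R v)"
  shows "((\<lambda>t. g (p + t *\<^sub>R v)) has_vector_derivative dirderiv v g (p + t *\<^sub>R v)) (at t)"
proof -
  have "((\<lambda>s. p + s *\<^sub>R v) has_derivative (\<lambda>t. t *\<^sub>R v)) (at t)"
    by (auto intro!: derivative_eq_intros)
  from has_derivative_compose[OF this has_derivative_dirderiv[OF assms]]
  show ?thesis
    by (simp add: has_vector_derivative_def dirderiv_dir_scaleR[OF assms])
qed

text \<open>(B3) tests curves defined on [-1,1] at their centre 0. Recentring at \<open>t0\<close>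
  and slowing down by a small \<open>r\<close> brings any time of \<open>J\<close> into this form;
  every small \<open>r\<close> works, so two curves can share one factor.\<close>

lemma coord_lift_rescale:
  assumes "coord_lift J S G p v z z1 z2" "t0 \<in> J"
  obtains e where "0 < e"
    "\<And>r. \<lbrakk>0 < r; r \<le> e\<rbrakk> \<Longrightarrow> \<exists>J'. {-1..1} \<subseteq> J' \<and>
       coord_lift J' S G (p + t0 *\<^sub>R v) (r *\<^sub>R v) (\<lambda>t. z (t0 + r * t))
         (\<lambda>t. r *\<^sub>R z1 (t0 + r * t)) (\<lambda>t. r\<^sup>2 *\<^sub>R z2 (t0 + r * t))"
proof -
  have J: "open J" using assms(1) by (simp add: coord_lift_def)
  obtain e where e: "e > 0" "cball t0 e \<subseteq> J"
    using J assms(2) by (auto simp: open_contains_cball)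
  show thesis
  proof (rule that[OF e(1)])
    fix r assume r: "0 < r" "r \<le> e"
    let ?J = "(\<lambda>t. t0 + r * t) -` J"
    have "t0 + r * t \<in> cball t0 e" if "t \<in> {-1..1}" for t
    proof -
      have "\<bar>t\<bar> * r \<le> 1 * e" using that r by (intro mult_mono) auto
      then show ?thesis using r by (simp add: dist_real_def abs_mult mult.commute)
    qed
    then have "{-1..1} \<subseteq> ?J" using e(2) by blast
    moreover have "open ?J"
      by (rule open_vimage[OF J]) (intro continuous_intros)
    moreover have "((\<lambda>t. z (t0 + r * t)) has_vector_derivative r *\<^sub>R z1 (t0 + r * t)) (at t)"
      "((\<lambda>t. r *\<^sub>R z1 (t0 + r * t)) has_vector_derivative r\<^sup>2 *\<^sub>R z2 (t0 + r * t)) (at t)"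
      if "t0 + r * t \<in> J" for t
    proof -
      have aff: "((\<lambda>t. t0 + r * t) has_vector_derivative r) (at t)"
        by (auto intro!: derivative_eq_intros simp flip: has_real_derivative_iff_has_vector_derivative)
      have z: "(z has_vector_derivative z1 (t0 + r * t)) (at (t0 + r * t))"
        "(z1 has_vector_derivative z2 (t0 + r * t)) (at (t0 + r * t))"
        using assms(1) that by (auto simp: coord_lift_def)
      show "((\<lambda>t. z (t0 + r * t)) has_vector_derivative r *\<^sub>R z1 (t0 + r * t)) (at t)"
        using vector_diff_chain_at[OF aff z(1)] by (simp add: o_def)
      show "((\<lambda>t. r *\<^sub>R z1 (t0 + r * t)) has_vector_derivative r\<^sup>2 *\<^sub>R z2 (t0 + r * t)) (at t)"
        using bounded_linear.has_vector_derivative[OF bounded_linear_scaleR_right[of r]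
            vector_diff_chain_at[OF aff z(2)]]
        by (simp add: o_def power2_eq_square)
    qed
    ultimately show "\<exists>J'. {-1..1} \<subseteq> J' \<and>
       coord_lift J' S G (p + t0 *\<^sub>R v) (r *\<^sub>R v) (\<lambda>t. z (t0 + r * t))
         (\<lambda>t. r *\<^sub>R z1 (t0 + r * t)) (\<lambda>t. r\<^sup>2 *\<^sub>R z2 (t0 + r * t))"
      using assms(1) by (intro exI[of _ ?J]) (auto simp: coord_lift_def algebra_simps)
  qed
qed

lemma coord_lift_line:
  fixes g G :: "'a::euclidean_space \<Rightarrow> 'a"
  assumes "open T" "Ck_on 2 T g" "g ` T \<subseteq> S" "\<And>p. p \<in> T \<Longrightarrow> G (g p) = p"
  shows "coord_lift ((\<lambda>t. p + t *\<^sub>R v) -` T) S G p v (\<lambda>t. g (p + t *\<^sub>R v))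
    (\<lambda>t. dirderiv v g (p + t *\<^sub>R v)) (\<lambda>t. dirderiv v (dirderiv v g) (p + t *\<^sub>R v))"
  unfolding coord_lift_def
proof (intro conjI ballI)
  show "open ((\<lambda>t. p + t *\<^sub>R v) -` T)"
    by (rule open_vimage[OF assms(1)]) (intro continuous_intros)
  fix t assume t: "t \<in> (\<lambda>t. p + t *\<^sub>R v) -` T"
  then show "g (p + t *\<^sub>R v) \<in> S" "G (g (p + t *\<^sub>R v)) = p + t *\<^sub>R v" using assms by auto
  show "((\<lambda>t. g (p + t *\<^sub>R v)) has_vector_derivative dirderiv v g (p + t *\<^sub>R v)) (at t)"
    "((\<lambda>t. dirderiv v g (p + t *\<^sub>R v)) has_vector_derivative
      dirderiv v (dirderiv v g) (p + t *\<^sub>R v)) (at t)"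
    using t Ck_on_2D[OF assms(2)] by (auto intro!: has_vector_derivative_line)
qed

lemma diffeo_closure_inverse:
  fixes f :: "'a::euclidean_space \<Rightarrow> 'a"
  assumes S: "open S" and f: "diffeo_closure S f"
  defines "g \<equiv> inv_into (closure S) f"
  shows "open (f ` S)" "g ` (f ` S) \<subseteq> S" "\<And>p. p \<in> f ` S \<Longrightarrow> f (g p) = p"
    "\<And>x. x \<in> closure S \<Longrightarrow> g (f x) = x" "Ck_on 1 (f ` S) g"
    "Ck_on 2 S f \<Longrightarrow> Ck_on 2 (f ` S) g"
proof -
  have inj: "inj_on f (closure S)" and f1: "Ck_closure 1 S f" and g1: "Ck_closure 1 (f ` S) g"
    using f by (auto simp: diffeo_closure_def g_def)
  have "continuous_on S f"
    by (rule continuous_on_subset[OF Ck_closure_continuous[OF f1] closure_subset])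
  then show op: "open (f ` S)"
    using S inj_on_subset[OF inj closure_subset] by (rule invariance_of_domain)
  show gf: "g (f x) = x" if "x \<in> closure S" for x
    unfolding g_def by (rule inv_into_f_f[OF inj that])
  show gim: "g ` (f ` S) \<subseteq> S" using gf closure_subset by fastforce
  show fg: "f (g p) = p" if "p \<in> f ` S" for p
    using that gf closure_subset by fastforce
  show g1': "Ck_on 1 (f ` S) g"
    by (rule Ck_closure_imp_Ck_on[OF op g1])
  show "Ck_on 2 (f ` S) g" if "Ck_on 2 S f"
    by (rule Ck_on_2_inverse[OF S that op g1' gim fg])
qed

text \<open>(B3) and (B4) stay outside because the curvature lemmas take them as
  alternatives.\<close>

locale cost_domain =
  fixes U V :: "'a::euclidean_space set" and c :: "'a \<Rightarrow> 'a \<Rightarrow> real"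
  assumes B0: "condB0 U V c" and B1: "condB1 U V c" and B2: "condB2 U V c"
begin

abbreviation "W \<equiv> U \<times> V"

text \<open>Uncurried, so that derivatives in \<open>x\<close> and in \<open>y\<close> are
  \<open>dirderiv\<close> in directions \<open>(w, 0)\<close> and \<open>(0, w)\<close> of one
  function, and symmetry of second derivatives exchanges them.\<close>

definition C :: "'a \<times> 'a \<Rightarrow> real" where "C z = c (fst z) (snd z)"

lemma openU: "open U" and openV: "open V" and boundedU: "bounded U" and boundedV: "bounded V"
  using B0 by (auto simp: condB0_def)

lemma openW: "open W" and boundedW: "bounded W"
  using openU openV boundedU boundedV by (auto intro: open_Times bounded_Times)

lemma C_closure: "Ck_closure 4 W C"
proof -
  have "C = (\<lambda>(x, y). c x y)" by (auto simp: C_def)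
  then show ?thesis using B0 by (simp add: condB0_def)
qed

lemma C_Ck: "Ck_on 4 W C"
  by (rule Ck_closure_imp_Ck_on[OF openW C_closure])

lemma dC_Ck: "Ck_on 3 W (dirderiv a C)" "Ck_on 2 W (dirderiv a (dirderiv b C))"
  "Ck_on 1 W (dirderiv a (dirderiv b (dirderiv d C)))"
  by (intro Ck_on_dirderiv[where k = 4] Ck_on_dirderiv[where k = 3] Ck_on_dirderiv[where k = 2] C_Ck;
      simp)+

lemma C_diff: "z \<in> W \<Longrightarrow> C differentiable at z"
  "z \<in> W \<Longrightarrow> dirderiv a C differentiable at z"
  "z \<in> W \<Longrightarrow> dirderiv a (dirderiv b C) differentiable at z"
  "z \<in> W \<Longrightarrow> dirderiv a (dirderiv b (dirderiv d C)) differentiable at z"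
  using Ck_on_differentiable[OF C_Ck] Ck_on_differentiable[OF dC_Ck(1)]
    Ck_on_differentiable[OF dC_Ck(2)] Ck_on_differentiable[OF dC_Ck(3)] by auto

lemma inner_Dx: "x \<in> U \<Longrightarrow> y \<in> V \<Longrightarrow> w \<bullet> Dx c x y = dirderiv (w, 0) C (x, y)"
proof -
  assume "x \<in> U" "y \<in> V"
  then have d: "((\<lambda>x. C (x, y)) has_derivative (\<lambda>w. dirderiv (w, 0) C (x, y))) (at x)"
    by (intro has_derivative_Pair_left C_diff) auto
  have e: "dirderiv (w, 0) C (x, y) = w \<bullet> (\<Sum>b\<in>Basis. dirderiv (b, 0) C (x, y) *\<^sub>R b)" for w
    using dirderiv_eq_inner[OF differentiableI[OF d], of w] by (simp only: dirderiv_eqI[OF d])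
  then have "Dx c x y = (\<Sum>b\<in>Basis. dirderiv (b, 0) C (x, y) *\<^sub>R b)"
    unfolding Dx_def
    by (rule gradient_eqI) (use d in \<open>simp only: C_def fst_conv snd_conv\<close>)
  then show ?thesis using e[of w] by (simp only:)
qed

lemma inner_Dy: "x \<in> U \<Longrightarrow> y \<in> V \<Longrightarrow> w \<bullet> Dy c x y = dirderiv (0, w) C (x, y)"
proof -
  assume "x \<in> U" "y \<in> V"
  then have d: "((\<lambda>y. C (x, y)) has_derivative (\<lambda>w. dirderiv (0, w) C (x, y))) (at y)"
    by (intro has_derivative_Pair_right C_diff) auto
  have e: "dirderiv (0, w) C (x, y) = w \<bullet> (\<Sum>b\<in>Basis. dirderiv (0, b) C (x, y) *\<^sub>R b)" for w
    using dirderiv_eq_inner[OF differentiableI[OF d], of w] by (simp only: dirderiv_eqI[OF d])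
  then have "Dy c x y = (\<Sum>b\<in>Basis. dirderiv (0, b) C (x, y) *\<^sub>R b)"
    unfolding Dy_def
    by (rule gradient_eqI) (use d in \<open>simp only: C_def fst_conv snd_conv\<close>)
  then show ?thesis using e[of w] by (simp only:)
qed

lemma vec_eq_sum_inner: "(D :: 'a) = (\<Sum>b\<in>Basis. (b \<bullet> D) *\<^sub>R b)"
  by (simp only: inner_commute[of _ D] euclidean_representation)

lemma Dx_closure_eq: "x \<in> U \<Longrightarrow> y \<in> V \<Longrightarrow> Dx_closure U V c x y = Dx c x y"
  and Dy_closure_continuous: "continuous_on (closure W) (\<lambda>z. Dy_closure U V c (fst z) (snd z))"
  and Dy_closure_eq: "x \<in> U \<Longrightarrow> y \<in> V \<Longrightarrow> Dy_closure U V c x y = Dy c x y"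
proof -
  have "Ck_closure (Suc 3) W C"
    using C_closure by (simp del: Ck_closure.simps)
  then obtain D where D: "\<And>v. Ck_closure 3 W (D v)" "\<And>v z. z \<in> W \<Longrightarrow> dirderiv v C z = D v z"
    by (rule Ck_closure_SucE) blast
  define FX where "FX z = (\<Sum>b\<in>Basis. D (b, 0) z *\<^sub>R b)" for z
  define FY where "FY z = (\<Sum>b\<in>Basis. D (0, b) z *\<^sub>R b)" for z
  have cont: "continuous_on (closure W) FX" "continuous_on (closure W) FY"
    unfolding FX_def FY_def
    by (intro continuous_intros Ck_closure_continuous[OF D(1)])+
  have eq: "Dx c (fst z) (snd z) = FX z" "Dy c (fst z) (snd z) = FY z" if "z \<in> W" for z
    unfolding FX_def FY_def
    using that vec_eq_sum_inner[of "Dx c (fst z) (snd z)"] vec_eq_sum_inner[of "Dy c (fst z) (snd z)"]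
      inner_Dx inner_Dy D(2)[OF that] by auto
  have lim: "Dx_closure U V c (fst z) (snd z) = FX z" "Dy_closure U V c (fst z) (snd z) = FY z"
    if "z \<in> closure W" for z
    unfolding Dx_closure_def Dy_closure_def
    using Lim_at_closure[OF openW cont(1) _ that, of "\<lambda>(x, y). Dx c x y"]
      Lim_at_closure[OF openW cont(2) _ that, of "\<lambda>(x, y). Dy c x y"] eq
    by auto
  show "continuous_on (closure W) (\<lambda>z. Dy_closure U V c (fst z) (snd z))"
    using cont lim by (simp cong: continuous_on_cong)
  show "x \<in> U \<Longrightarrow> y \<in> V \<Longrightarrow> Dx_closure U V c x y = Dx c x y"
    "x \<in> U \<Longrightarrow> y \<in> V \<Longrightarrow> Dy_closure U V c x y = Dy c x y"
    using lim[of "(x, y)"] eq[of "(x, y)"] closure_subset[of W] by auto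
qed

lemma Dy_Ck: "y \<in> V \<Longrightarrow> Ck_on 2 U (\<lambda>x. - Dy_closure U V c x y)"
proof -
  assume y: "y \<in> V"
  have "Ck_on 2 U (\<lambda>x. \<Sum>b\<in>Basis. dirderiv (0, b) C (x, y) *\<^sub>R (- b))"
    using y dC_Ck(1)
    by (intro Ck_on_sum openU Ck_on_scaleR Ck_on_const Ck_on_Pair_left[where W = W])
      (auto intro: Ck_on_mono[OF dC_Ck(1)])
  then show ?thesis
    by (rule Ck_on_cong[OF openU])
      (use y vec_eq_sum_inner in \<open>simp add: Dy_closure_eq sum_negf flip: inner_Dy\<close>)
qed

lemma Dx_Ck: "x \<in> U \<Longrightarrow> Ck_on 2 V (\<lambda>y. - Dx_closure U V c x y)"
proof -
  assume x: "x \<in> U"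
  have "Ck_on 2 V (\<lambda>y. \<Sum>b\<in>Basis. dirderiv (b, 0) C (x, y) *\<^sub>R (- b))"
    using x dC_Ck(1)
    by (intro Ck_on_sum openV Ck_on_scaleR Ck_on_const Ck_on_Pair_right[where W = W])
      (auto intro: Ck_on_mono[OF dC_Ck(1)])
  then show ?thesis
    by (rule Ck_on_cong[OF openV])
      (use x vec_eq_sum_inner in \<open>simp add: Dx_closure_eq sum_negf flip: inner_Dx\<close>)
qed

text \<open>(B1) quantifies over a pair of base points at once, so its statement about the
  \<open>x\<close>-map can be used only when some base point in \<open>closure U\<close>
  exists.\<close>

lemma diffeo_x: "y \<in> closure V \<Longrightarrow> U \<noteq> {} \<Longrightarrow> diffeo_closure U (\<lambda>x. - Dy_closure U V c x y)"
  using B1 closure_subset[of U] unfolding condB1_def by blast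

lemma diffeo_y: "x \<in> closure U \<Longrightarrow> V \<noteq> {} \<Longrightarrow> diffeo_closure V (\<lambda>y. - Dx_closure U V c x y)"
  using B1 closure_subset[of V] unfolding condB1_def by blast

lemma convex_U_coord: "y \<in> closure V \<Longrightarrow> convex (U_coord U V c y)"
proof (cases "U = {}")
  case False
  then show "y \<in> closure V \<Longrightarrow> convex (U_coord U V c y)"
    using B2 closure_subset[of U] unfolding condB2_def by blast
qed (simp add: U_coord_def)

lemma convex_V_coord: "x \<in> closure U \<Longrightarrow> convex (V_coord U V c x)"
proof (cases "V = {}")
  case False
  then show "x \<in> closure U \<Longrightarrow> convex (V_coord U V c x)"
    using B2 closure_subset[of V] unfolding condB2_def by blast
qed (simp add: V_coord_def)

end

section \<open>Cross-curvature\<close>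

lemma deriv_eq_on_open:
  assumes "open J" "t \<in> J" "\<And>s. s \<in> J \<Longrightarrow> f s = g s"
    and "(g has_real_derivative d) (at t)"
  shows "deriv f t = d"
  by (rule DERIV_imp_deriv, rule has_field_derivative_transform_within_open[OF assms(4,1,2)])
    (simp add: assms(3))

lemma second_deriv_eq_on_open:
  assumes "open J" "t \<in> J" "\<And>s. s \<in> J \<Longrightarrow> (f has_real_derivative f' s) (at s)"
    and "(f' has_real_derivative d) (at t)"
  shows "(deriv ^^ 2) f t = d"
  using deriv_eq_on_open[OF assms(1,2) _ assms(4), of "deriv f"] DERIV_imp_deriv[OF assms(3)]
  by (simp add: numeral_2_eq_2)

context cost_domain
begin

abbreviation "Gx y \<equiv> (\<lambda>x. - Dy_closure U V c x y)"
abbreviation "Gy x \<equiv> (\<lambda>y. - Dx_closure U V c x y)"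

section \<open>Derivatives of the cost along straightened curves\<close>

lemma along_y:
  assumes "coord_lift J V G p h y y1 y2" "t \<in> J" "x \<in> U" "Ck_on 2 W H"
  shows "((\<lambda>t. H (x, y t)) has_real_derivative dirderiv (0, y1 t) H (x, y t)) (at t)"
    and "((\<lambda>t. dirderiv (0, y1 t) H (x, y t)) has_real_derivative
      dirderiv (0, y1 t) (dirderiv (0, y1 t) H) (x, y t) + dirderiv (0, y2 t) H (x, y t)) (at t)"
proof -
  have l: "y t \<in> V" "(y has_vector_derivative y1 t) (at t)" "(y1 has_vector_derivative y2 t) (at t)"
    using assms(1,2) by (auto simp: coord_lift_def)
  have z: "((\<lambda>t. (x, y t)) has_vector_derivative (0, y1 t)) (at t)"
    "((\<lambda>t. (0::'a, y1 t)) has_vector_derivative (0, y2 t)) (at t)"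
    by (intro has_vector_derivative_Pair has_vector_derivative_const l)+
  show "((\<lambda>t. H (x, y t)) has_real_derivative dirderiv (0, y1 t) H (x, y t)) (at t)"
    using has_real_derivative_curve[OF z(1)] Ck_on_2D(1)[OF assms(4)] l assms(3) by auto
  show "((\<lambda>t. dirderiv (0, y1 t) H (x, y t)) has_real_derivative
      dirderiv (0, y1 t) (dirderiv (0, y1 t) H) (x, y t) + dirderiv (0, y2 t) H (x, y t)) (at t)"
    using has_real_derivative_curve2[of W H "\<lambda>t. (x, y t)" t "\<lambda>t. (0, y1 t)", OF openW assms(4) _ z]
      l assms(3) by auto
qed

lemma along_x:
  assumes "coord_lift J U G p h x x1 x2" "t \<in> J" "y \<in> V" "Ck_on 2 W H"
  shows "((\<lambda>t. H (x t, y)) has_real_derivative dirderiv (x1 t, 0) H (x t, y)) (at t)"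
    and "((\<lambda>t. dirderiv (x1 t, 0) H (x t, y)) has_real_derivative
      dirderiv (x1 t, 0) (dirderiv (x1 t, 0) H) (x t, y) + dirderiv (x2 t, 0) H (x t, y)) (at t)"
proof -
  have l: "x t \<in> U" "(x has_vector_derivative x1 t) (at t)" "(x1 has_vector_derivative x2 t) (at t)"
    using assms(1,2) by (auto simp: coord_lift_def)
  have z: "((\<lambda>t. (x t, y)) has_vector_derivative (x1 t, 0)) (at t)"
    "((\<lambda>t. (x1 t, 0::'a)) has_vector_derivative (x2 t, 0)) (at t)"
    by (intro has_vector_derivative_Pair has_vector_derivative_const l)+
  show "((\<lambda>t. H (x t, y)) has_real_derivative dirderiv (x1 t, 0) H (x t, y)) (at t)"
    using has_real_derivative_curve[OF z(1)] Ck_on_2D(1)[OF assms(4)] l assms(3) by auto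
  show "((\<lambda>t. dirderiv (x1 t, 0) H (x t, y)) has_real_derivative
      dirderiv (x1 t, 0) (dirderiv (x1 t, 0) H) (x t, y) + dirderiv (x2 t, 0) H (x t, y)) (at t)"
    using has_real_derivative_curve2[of W H "\<lambda>t. (x t, y)" t "\<lambda>t. (x1 t, 0)", OF openW assms(4) _ z]
      l assms(3) by auto
qed

lemma dC_Ck2: "Ck_on 2 W C" "Ck_on 2 W (dirderiv a C)"
  using Ck_on_mono[OF C_Ck, of 2] Ck_on_mono[OF dC_Ck(1), of 2] by auto

text \<open>The straightening equation, paired with a fixed \<open>w\<close>, is an affine function
  of \<open>t\<close>; its derivatives of order 0, 1 and 2 are compared with the chain rule. The
  last one expresses the acceleration \<open>y2\<close> through the velocity
  \<open>y1\<close>.\<close>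

lemma lift_y:
  assumes l: "coord_lift J V (Gy x) p h y y1 y2" "t \<in> J" "x \<in> U"
  shows "dirderiv (w, 0) C (x, y t) = - (w \<bullet> p) - t * (w \<bullet> h)"
    and "dirderiv (0, y1 t) (dirderiv (w, 0) C) (x, y t) = - (w \<bullet> h)"
    and "dirderiv (0, y1 t) (dirderiv (0, y1 t) (dirderiv (w, 0) C)) (x, y t)
      + dirderiv (0, y2 t) (dirderiv (w, 0) C) (x, y t) = 0"
proof -
  have J: "open J" and yV: "y s \<in> V" and g: "- Dx_closure U V c x (y s) = p + s *\<^sub>R h" if "s \<in> J" for s
    using that l(1) by (auto simp: coord_lift_def)
  have 1: "dirderiv (w, 0) C (x, y s) = - (w \<bullet> p) - s * (w \<bullet> h)" if "s \<in> J" for s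
  proof -
    have "dirderiv (w, 0) C (x, y s) = - (w \<bullet> (p + s *\<^sub>R h))"
      by (simp add: yV that l(3) Dx_closure_eq flip: inner_Dx g)
    then show ?thesis by (simp add: inner_add_right)
  qed
  then show "dirderiv (w, 0) C (x, y t) = - (w \<bullet> p) - t * (w \<bullet> h)" using l(2) by blast
  note J = J[OF l(2)]
  have 2: "dirderiv (0, y1 s) (dirderiv (w, 0) C) (x, y s) = - (w \<bullet> h)" if "s \<in> J" for s
  proof -
    have "((\<lambda>s. - (w \<bullet> p) - s * (w \<bullet> h)) has_real_derivative - (w \<bullet> h)) (at s)"
      by (auto intro!: derivative_eq_intros)
    from has_field_derivative_transform_within_open[OF this J that]
    have "((\<lambda>s. dirderiv (w, 0) C (x, y s)) has_real_derivative - (w \<bullet> h)) (at s)"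
      using 1 by auto
    then show ?thesis using along_y(1)[OF l(1) that l(3) dC_Ck2(2)] DERIV_unique by blast
  qed
  then show "dirderiv (0, y1 t) (dirderiv (w, 0) C) (x, y t) = - (w \<bullet> h)" using l(2) by blast
  have "((\<lambda>s. - (w \<bullet> h)) has_real_derivative 0) (at t)" by simp
  from has_field_derivative_transform_within_open[OF this J l(2)]
  have "((\<lambda>s. dirderiv (0, y1 s) (dirderiv (w, 0) C) (x, y s)) has_real_derivative 0) (at t)"
    using 2 by auto
  then show "dirderiv (0, y1 t) (dirderiv (0, y1 t) (dirderiv (w, 0) C)) (x, y t)
      + dirderiv (0, y2 t) (dirderiv (w, 0) C) (x, y t) = 0"
    using along_y(2)[OF l dC_Ck2(2)] DERIV_unique by blast
qed

lemma lift_x: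
  assumes l: "coord_lift J U (Gx y) q v x x1 x2" "t \<in> J" "y \<in> V"
  shows "dirderiv (0, w) C (x t, y) = - (w \<bullet> q) - t * (w \<bullet> v)"
    and "dirderiv (x1 t, 0) (dirderiv (0, w) C) (x t, y) = - (w \<bullet> v)"
    and "dirderiv (x1 t, 0) (dirderiv (x1 t, 0) (dirderiv (0, w) C)) (x t, y)
      + dirderiv (x2 t, 0) (dirderiv (0, w) C) (x t, y) = 0"
proof -
  have J: "open J" and xU: "x s \<in> U" and g: "- Dy_closure U V c (x s) y = q + s *\<^sub>R v" if "s \<in> J" for s
    using that l(1) by (auto simp: coord_lift_def)
  have 1: "dirderiv (0, w) C (x s, y) = - (w \<bullet> q) - s * (w \<bullet> v)" if "s \<in> J" for s
  proof -
    have "dirderiv (0, w) C (x s, y) = - (w \<bullet> (q + s *\<^sub>R v))"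
      by (simp add: xU that l(3) Dy_closure_eq flip: inner_Dy g)
    then show ?thesis by (simp add: inner_add_right)
  qed
  then show "dirderiv (0, w) C (x t, y) = - (w \<bullet> q) - t * (w \<bullet> v)" using l(2) by blast
  note J = J[OF l(2)]
  have 2: "dirderiv (x1 s, 0) (dirderiv (0, w) C) (x s, y) = - (w \<bullet> v)" if "s \<in> J" for s
  proof -
    have "((\<lambda>s. - (w \<bullet> q) - s * (w \<bullet> v)) has_real_derivative - (w \<bullet> v)) (at s)"
      by (auto intro!: derivative_eq_intros)
    from has_field_derivative_transform_within_open[OF this J that]
    have "((\<lambda>s. dirderiv (0, w) C (x s, y)) has_real_derivative - (w \<bullet> v)) (at s)"
      using 1 by auto
    then show ?thesis using along_x(1)[OF l(1) that l(3) dC_Ck2(2)] DERIV_unique by blast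
  qed
  then show "dirderiv (x1 t, 0) (dirderiv (0, w) C) (x t, y) = - (w \<bullet> v)" using l(2) by blast
  have "((\<lambda>s. - (w \<bullet> v)) has_real_derivative 0) (at t)" by simp
  from has_field_derivative_transform_within_open[OF this J l(2)]
  have "((\<lambda>s. dirderiv (x1 s, 0) (dirderiv (0, w) C) (x s, y)) has_real_derivative 0) (at t)"
    using 2 by auto
  then show "dirderiv (x1 t, 0) (dirderiv (x1 t, 0) (dirderiv (0, w) C)) (x t, y)
      + dirderiv (x2 t, 0) (dirderiv (0, w) C) (x t, y) = 0"
    using along_x(2)[OF l dC_Ck2(2)] DERIV_unique by blast
qed

lemma dirderiv3_commute:
  fixes H :: "'a \<times> 'a \<Rightarrow> real"
  assumes "Ck_on 3 W H" "z \<in> W"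
  shows "dirderiv a (dirderiv b (dirderiv b H)) z = dirderiv b (dirderiv b (dirderiv a H)) z"
proof -
  have H: "Ck_on 2 W H" "Ck_on 2 W (dirderiv b H)"
    using Ck_on_mono[OF assms(1), of 2] Ck_on_dirderiv[OF assms(1), of 2] by auto
  have "dirderiv a (dirderiv b (dirderiv b H)) z = dirderiv b (dirderiv a (dirderiv b H)) z"
    by (rule dirderiv_commute[OF openW H(2) assms(2)])
  also have "\<dots> = dirderiv b (dirderiv b (dirderiv a H)) z"
    by (rule dirderiv_cong[OF openW assms(2)]) (rule dirderiv_commute[OF openW H(1)])
  finally show ?thesis .
qed

lemma dirderiv4_commute:
  assumes "z \<in> W"
  shows "dirderiv a (dirderiv a (dirderiv b (dirderiv b C))) z
    = dirderiv b (dirderiv b (dirderiv a (dirderiv a C))) z"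
proof -
  have "dirderiv a (dirderiv a (dirderiv b (dirderiv b C))) z
    = dirderiv a (dirderiv b (dirderiv b (dirderiv a C))) z"
    by (rule dirderiv_cong[OF openW assms]) (rule dirderiv3_commute[OF Ck_on_mono[OF C_Ck]], auto)
  also have "\<dots> = dirderiv b (dirderiv b (dirderiv a (dirderiv a C))) z"
    by (rule dirderiv3_commute[OF dC_Ck(1) assms])
  finally show ?thesis .
qed

text \<open>The left-hand side is \<open>cross_deriv4\<close> with the \<open>x\<close>-acceleration
  gone. In both variables the curve is taken through \<open>(x0, y0)\<close>, which makes the pair a
  \<open>segment_curve\<close>; the condition of (B3) is met because the mixed second derivative is
  \<open>- (x1 0 \<bullet> h)\<close>.\<close>

lemma cross_curvature_unit:
  assumes xl: "coord_lift I U (Gx y0) q v x x1 x2" "{-1..1} \<subseteq> I" "x 0 = x0"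
    and yl: "coord_lift J V (Gy x0) p h y y1 y2" "{-1..1} \<subseteq> J" "y 0 = y0"
    and cond: "(x1 0 \<bullet> h = 0 \<and> condB3 U V c) \<or> condB4 U V c"
  defines "A \<equiv> dirderiv (x1 0, 0) (dirderiv (x1 0, 0) C)"
  shows "dirderiv (0, y1 0) (dirderiv (0, y1 0) A) (x0, y0) + dirderiv (0, y2 0) A (x0, y0) \<le> 0"
proof -
  have I: "open I" "0 \<in> I" and J: "open J" "0 \<in> J"
    using xl yl by (auto simp: coord_lift_def)
  have xI: "x s \<in> U" if "s \<in> I" for s using that xl by (auto simp: coord_lift_def)
  have yJ: "y s \<in> V" if "s \<in> J" for s using that yl by (auto simp: coord_lift_def)
  have x0: "x0 \<in> U" and y0: "y0 \<in> V" using xI[OF I(2)] yJ[OF J(2)] xl yl by auto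
  have cC: "(\<lambda>t. c (x s) (y t)) = (\<lambda>t. C (x s, y t))" for s by (simp add: C_def)
  have seg: "segment_curve U V c x y"
    unfolding segment_curve_def
  proof (intro conjI exI ballI)
    show "x ` {- 1..1} \<subseteq> closure U" "y ` {- 1..1} \<subseteq> closure V"
      using xI yJ xl(2) yl(2) closure_subset by blast+
    show "(Dy_closure U V c (x t) (y 0), Dx_closure U V c (x 0) (y t)) = (- q, - p) + t *\<^sub>R (- v, - h)"
      if t: "t \<in> {- 1..1}" for t
    proof -
      have tt: "t \<in> I" "t \<in> J" using t xl(2) yl(2) by blast+
      have "- Dy_closure U V c (x t) y0 = q + t *\<^sub>R v" "- Dx_closure U V c x0 (y t) = p + t *\<^sub>R h"
        using xl(1) yl(1) tt unfolding coord_lift_def by blast+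
      from this[THEN arg_cong[where f = uminus]] show ?thesis
        by (simp add: xl(3) yl(3))
    qed
  qed
  define a where "a = (x1 0, 0::'a)"
  define b where "b = (0::'a, y1 0)"
  define b' where "b' = (0::'a, y2 0)"
  have first: "deriv (\<lambda>t. c (x s) (y t)) 0 = dirderiv b C (x s, y0)" if "s \<in> I" for s
    unfolding cC b_def using along_y(1)[OF yl(1) J(2) xI[OF that] dC_Ck2(1)] yl(3)
    by (simp add: DERIV_imp_deriv)
  have cross2: "cross_deriv2 c x y = 0" if "x1 0 \<bullet> h = 0"
    unfolding cross_deriv2_def
  proof (rule deriv_eq_on_open[OF I first])
    have "dirderiv a (dirderiv b C) (x0, y0) = dirderiv b (dirderiv a C) (x0, y0)"
      by (rule dirderiv_commute[OF openW dC_Ck2(1)]) (use x0 y0 in auto)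
    also have "\<dots> = 0"
      using lift_y(2)[OF yl(1) J(2) x0, of "x1 0"] that yl(3) by (simp add: a_def b_def)
    finally have "dirderiv a (dirderiv b C) (x0, y0) = 0" .
    then show "((\<lambda>s. dirderiv b C (x s, y0)) has_real_derivative 0) (at 0)"
      using along_x(1)[OF xl(1) I(2) y0 dC_Ck2(2)[of b]] by (simp add: a_def xl(3))
  qed
  \<comment> \<open>On points \<open>(x, y0)\<close> this is the second \<open>t\<close>-derivative
    of the cost along \<open>y\<close> at time 0; the outer two derivatives are then those of
    \<open>F\<close> along the \<open>x\<close>-curve.\<close>
  define F where "F z = dirderiv b (dirderiv b C) z + dirderiv b' C z" for z
  have F: "Ck_on 2 W F"
    unfolding F_def by (intro Ck_on_add openW dC_Ck dC_Ck2)
  have second: "(deriv ^^ 2) (\<lambda>t. c (x s) (y t)) 0 = F (x s, y0)" if "s \<in> I" for s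
    unfolding cC F_def b_def b'_def
    using along_y[OF yl(1) _ xI[OF that] dC_Ck2(1)] yl(3)
    by (intro second_deriv_eq_on_open[OF J, of _ "\<lambda>t. dirderiv (0, y1 t) C (x s, y t)"]) (use J in force)+
  have dF: "dirderiv w F z = dirderiv b (dirderiv b (dirderiv w C)) z + dirderiv b' (dirderiv w C) z"
    if "z \<in> W" for w z
  proof -
    have "dirderiv w F z = dirderiv w (dirderiv b (dirderiv b C)) z + dirderiv w (dirderiv b' C) z"
      unfolding F_def using that by (intro dirderiv_add C_diff)
    also have "dirderiv w (dirderiv b (dirderiv b C)) z = dirderiv b (dirderiv b (dirderiv w C)) z"
      using Ck_on_mono[OF C_Ck, of 3] that by (intro dirderiv3_commute) auto
    also have "dirderiv w (dirderiv b' C) z = dirderiv b' (dirderiv w C) z"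
      by (rule dirderiv_commute[OF openW dC_Ck2(1) that])
    finally show ?thesis .
  qed
  \<comment> \<open>The \<open>x\<close>-gradient of the cost at \<open>x0\<close> is affine along
    \<open>y\<close>, so its second \<open>t\<close>-derivative vanishes. This kills the term with
    \<open>x2 0\<close>.\<close>
  have dF0: "dirderiv (w, 0) F (x0, y0) = 0" for w
    using dF[of "(x0, y0)" "(w, 0)"] lift_y(3)[OF yl(1) J(2) x0, of w] x0 y0 yl(3)
    by (simp add: b_def b'_def)
  have ddF: "dirderiv a (dirderiv a F) (x0, y0) = dirderiv b (dirderiv b A) (x0, y0) + dirderiv b' A (x0, y0)"
  proof -
    have z: "(x0, y0) \<in> W" using x0 y0 by simp
    have "dirderiv a (dirderiv a F) (x0, y0)
      = dirderiv a (\<lambda>z. dirderiv a (dirderiv b (dirderiv b C)) z + dirderiv a (dirderiv b' C) z) (x0, y0)"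
      unfolding F_def by (rule dirderiv_cong[OF openW z]) (intro dirderiv_add C_diff)
    also have "\<dots> = dirderiv a (dirderiv a (dirderiv b (dirderiv b C))) (x0, y0)
        + dirderiv a (dirderiv a (dirderiv b' C)) (x0, y0)"
      using z by (intro dirderiv_add C_diff)
    also have "dirderiv a (dirderiv a (dirderiv b (dirderiv b C))) (x0, y0) = dirderiv b (dirderiv b A) (x0, y0)"
      unfolding A_def using dirderiv4_commute[OF z, of a b] by (simp only: a_def)
    also have "dirderiv a (dirderiv a (dirderiv b' C)) (x0, y0) = dirderiv b' A (x0, y0)"
      unfolding A_def using dirderiv3_commute[OF Ck_on_mono[OF C_Ck, of 3] z, of b' a]
      by (simp add: a_def)
    finally show ?thesis .
  qed
  have "cross_deriv4 c x y = dirderiv a (dirderiv a F) (x0, y0) + dirderiv (x2 0, 0) F (x0, y0)"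
    unfolding cross_deriv4_def
  proof (rule second_deriv_eq_on_open[OF I])
    show "((\<lambda>s. (deriv ^^ 2) (\<lambda>t. c (x s) (y t)) 0) has_real_derivative dirderiv (x1 s, 0) F (x s, y0)) (at s)"
      if "s \<in> I" for s
      by (rule has_field_derivative_transform_within_open[OF along_x(1)[OF xl(1) that y0 F] I(1) that])
        (simp add: second)
    show "((\<lambda>s. dirderiv (x1 s, 0) F (x s, y0)) has_real_derivative
        dirderiv a (dirderiv a F) (x0, y0) + dirderiv (x2 0, 0) F (x0, y0)) (at 0)"
      using along_x(2)[OF xl(1) I(2) y0 F] xl(3) by (simp add: a_def)
  qed
  then have "cross_deriv4 c x y = dirderiv b (dirderiv b A) (x0, y0) + dirderiv b' A (x0, y0)"
    using dF0 ddF by simp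
  moreover have "- cross_deriv4 c x y \<ge> 0"
    using cond seg cross2 unfolding condB3_def condB4_def by blast
  ultimately show ?thesis by (simp add: b_def b'_def)
qed

lemma dirderiv_cmult_cong:
  fixes H H' :: "'a \<times> 'a \<Rightarrow> real"
  assumes "\<And>z. z \<in> W \<Longrightarrow> H' z = r * H z" "z \<in> W" "H differentiable at z"
  shows "dirderiv b H' z = r * dirderiv b H z"
proof -
  have "dirderiv b H' z = dirderiv b (\<lambda>z. r * H z) z"
    by (rule dirderiv_cong[OF openW assms(2,1)])
  also have "\<dots> = r * dirderiv b H z"
    by (rule dirderiv_bounded_linear[OF bounded_linear_mult_right assms(3)])
  finally show ?thesis .
qed

lemma dirderiv2_scaleR:
  fixes H :: "'a \<times> 'a \<Rightarrow> real"
  assumes "Ck_on 2 W H" "z \<in> W"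
  shows "dirderiv (r *\<^sub>R a) (dirderiv (r *\<^sub>R a) H) z = r\<^sup>2 * dirderiv a (dirderiv a H) z"
proof -
  have "dirderiv (r *\<^sub>R a) (dirderiv (r *\<^sub>R a) H) z = r * dirderiv a (dirderiv (r *\<^sub>R a) H) z"
    using dirderiv_dir_scaleR[OF Ck_on_2D(2)[OF assms]] by simp
  also have "dirderiv a (dirderiv (r *\<^sub>R a) H) z = r * dirderiv a (dirderiv a H) z"
    by (rule dirderiv_cmult_cong[OF _ assms(2) Ck_on_2D(2)[OF assms]])
      (simp add: dirderiv_dir_scaleR[OF Ck_on_2D(1)[OF assms(1)]])
  finally show ?thesis by (simp add: power2_eq_square)
qed

lemma exp_x:
  assumes y: "y \<in> V" and U: "U \<noteq> {}"
  shows "open (U_coord U V c y)" "Ck_on 2 (U_coord U V c y) (cost_exp U V c y)"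
    "cost_exp U V c y ` U_coord U V c y \<subseteq> U"
    "\<And>q. q \<in> U_coord U V c y \<Longrightarrow> Gx y (cost_exp U V c y q) = q"
    "\<And>x. x \<in> U \<Longrightarrow> cost_exp U V c y (Gx y x) = x"
proof -
  have d: "diffeo_closure U (Gx y)"
    using diffeo_x[OF _ U] y closure_subset by blast
  note inv = diffeo_closure_inverse[OF openU d]
  show "open (U_coord U V c y)" "Ck_on 2 (U_coord U V c y) (cost_exp U V c y)"
    "cost_exp U V c y ` U_coord U V c y \<subseteq> U"
    "\<And>q. q \<in> U_coord U V c y \<Longrightarrow> Gx y (cost_exp U V c y q) = q"
    "\<And>x. x \<in> U \<Longrightarrow> cost_exp U V c y (Gx y x) = x"
    unfolding U_coord_def cost_exp_def
    using inv(1,2,3,4) inv(6)[OF Dy_Ck[OF y]] closure_subset[of U] by blast+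
qed

lemma exp_y:
  assumes x: "x \<in> U" and V: "V \<noteq> {}"
  defines "Y \<equiv> inv_into (closure V) (Gy x)"
  shows "open (V_coord U V c x)" "Ck_on 2 (V_coord U V c x) Y"
    "Y ` V_coord U V c x \<subseteq> V"
    "\<And>p. p \<in> V_coord U V c x \<Longrightarrow> Gy x (Y p) = p"
    "\<And>y. y \<in> V \<Longrightarrow> Y (Gy x y) = y"
proof -
  have d: "diffeo_closure V (Gy x)"
    using diffeo_y[OF _ V] x closure_subset by blast
  note inv = diffeo_closure_inverse[OF openV d]
  show "open (V_coord U V c x)" "Ck_on 2 (V_coord U V c x) Y"
    "Y ` V_coord U V c x \<subseteq> V"
    "\<And>p. p \<in> V_coord U V c x \<Longrightarrow> Gy x (Y p) = p"
    "\<And>y. y \<in> V \<Longrightarrow> Y (Gy x y) = y"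
    unfolding V_coord_def Y_def
    using inv(1,2,3,4) inv(6)[OF Dx_Ck[OF x]] closure_subset[of V] by blast+
qed

text \<open>Since only the velocity of the \<open>x\<close>-curve matters, any \<open>k\<close> can
  be tested at any time: a line in the coordinates from \<open>y t\<close> with velocity
  \<open>k\<close> at \<open>x0\<close> is built, and both curves are rescaled to [-1,1].\<close>

lemma cross_curvature:
  assumes yl: "coord_lift J V (Gy x0) p h y y1 y2" "t \<in> J" and x0: "x0 \<in> U"
    and cond: "(k \<bullet> h = 0 \<and> condB3 U V c) \<or> condB4 U V c"
  defines "A \<equiv> dirderiv (k, 0) (dirderiv (k, 0) C)"
  shows "dirderiv (0, y1 t) (dirderiv (0, y1 t) A) (x0, y t) + dirderiv (0, y2 t) A (x0, y t) \<le> 0"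
proof -
  define y0 where "y0 = y t"
  have y0: "y0 \<in> V" using yl by (auto simp: coord_lift_def y0_def)
  have z0: "(x0, y0) \<in> W" using x0 y0 by simp
  have U: "U \<noteq> {}" using x0 by auto
  note X = exp_x[OF y0 U]
  define X where "X = cost_exp U V c y0"
  \<comment> \<open>The coordinate velocity that the inverse map \<open>X\<close> sends back to
    \<open>k\<close>.\<close>
  define v where "v = dirderiv k (Gx y0) x0"
  define q where "q = Gx y0 x0"
  have q: "q \<in> U_coord U V c y0" unfolding q_def U_coord_def using x0 by blast
  have Xq: "X q = x0" unfolding X_def q_def using X(5) x0 by simp
  have "dirderiv k (\<lambda>x. X (Gx y0 x)) x0 = dirderiv (dirderiv k (Gx y0) x0) X (Gx y0 x0)"
    using Ck_on_2D(1)[OF Dy_Ck[OF y0] x0] Ck_on_2D(1)[OF X(2) q]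
    by (intro dirderiv_compose) (auto simp: X_def q_def)
  moreover have "dirderiv k (\<lambda>x. X (Gx y0 x)) x0 = dirderiv k (\<lambda>x. x) x0"
    by (rule dirderiv_cong[OF openU x0]) (simp add: X_def X(5))
  moreover have "dirderiv k (\<lambda>x. x) x0 = k"
    by (rule dirderiv_eqI) (rule has_derivative_ident)
  ultimately have k: "dirderiv v X q = k" by (simp add: v_def q_def)
  have xl: "coord_lift ((\<lambda>s. q + s *\<^sub>R v) -` U_coord U V c y0) U (Gx y0) q v
      (\<lambda>s. X (q + s *\<^sub>R v)) (\<lambda>s. dirderiv v X (q + s *\<^sub>R v))
      (\<lambda>s. dirderiv v (dirderiv v X) (q + s *\<^sub>R v))"
    unfolding X_def by (rule coord_lift_line[OF X(1-4)])
  have "0 \<in> (\<lambda>s. q + s *\<^sub>R v) -` U_coord U V c y0" using q by simp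
  from coord_lift_rescale[OF xl this] obtain e where e: "e > 0"
    "\<And>r. \<lbrakk>0 < r; r \<le> e\<rbrakk> \<Longrightarrow> \<exists>J'. {-1..1} \<subseteq> J' \<and>
       coord_lift J' U (Gx y0) (q + 0 *\<^sub>R v) (r *\<^sub>R v) (\<lambda>s. X (q + (0 + r * s) *\<^sub>R v))
         (\<lambda>s. r *\<^sub>R dirderiv v X (q + (0 + r * s) *\<^sub>R v))
         (\<lambda>s. r\<^sup>2 *\<^sub>R dirderiv v (dirderiv v X) (q + (0 + r * s) *\<^sub>R v))"
    by blast
  from coord_lift_rescale[OF yl] obtain e' where e': "e' > 0"
    "\<And>r. \<lbrakk>0 < r; r \<le> e'\<rbrakk> \<Longrightarrow> \<exists>J'. {-1..1} \<subseteq> J' \<and>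
       coord_lift J' V (Gy x0) (p + t *\<^sub>R h) (r *\<^sub>R h) (\<lambda>s. y (t + r * s))
         (\<lambda>s. r *\<^sub>R y1 (t + r * s)) (\<lambda>s. r\<^sup>2 *\<^sub>R y2 (t + r * s))"
    by blast
  define r where "r = min e e'"
  have r: "0 < r" "r \<le> e" "r \<le> e'" using e(1) e'(1) by (auto simp: r_def)
  obtain I' where I': "{-1..1} \<subseteq> I'" "coord_lift I' U (Gx y0) (q + 0 *\<^sub>R v) (r *\<^sub>R v)
        (\<lambda>s. X (q + (0 + r * s) *\<^sub>R v)) (\<lambda>s. r *\<^sub>R dirderiv v X (q + (0 + r * s) *\<^sub>R v))
         (\<lambda>s. r\<^sup>2 *\<^sub>R dirderiv v (dirderiv v X) (q + (0 + r * s) *\<^sub>R v))"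
    using e(2)[OF r(1,2)] by blast
  obtain J' where J': "{-1..1} \<subseteq> J'" "coord_lift J' V (Gy x0) (p + t *\<^sub>R h) (r *\<^sub>R h)
        (\<lambda>s. y (t + r * s)) (\<lambda>s. r *\<^sub>R y1 (t + r * s)) (\<lambda>s. r\<^sup>2 *\<^sub>R y2 (t + r * s))"
    using e'(2)[OF r(1,3)] by blast
  define A' where "A' = dirderiv (r *\<^sub>R (k, 0)) (dirderiv (r *\<^sub>R (k, 0)) C)"
  have unit: "dirderiv (r *\<^sub>R (0, y1 t)) (dirderiv (r *\<^sub>R (0, y1 t)) A') (x0, y0)
      + dirderiv (r\<^sup>2 *\<^sub>R (0, y2 t)) A' (x0, y0) \<le> 0"
  proof -
    have ends: "(\<lambda>s. X (q + (0 + r * s) *\<^sub>R v)) 0 = x0" "(\<lambda>s. y (t + r * s)) 0 = y0"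
      by (simp_all add: Xq y0_def)
    have cond': "((\<lambda>s. r *\<^sub>R dirderiv v X (q + (0 + r * s) *\<^sub>R v)) 0 \<bullet> (r *\<^sub>R h) = 0 \<and> condB3 U V c)
        \<or> condB4 U V c"
      using cond by (auto simp: k)
    show ?thesis
      using cross_curvature_unit[OF I'(2,1) ends(1) J'(2,1) ends(2) cond']
      by (simp add: k A'_def)
  qed
  have A: "Ck_on 2 W A" unfolding A_def by (rule dC_Ck)
  have A': "A' z = r\<^sup>2 * A z" if "z \<in> W" for z
    unfolding A'_def A_def by (rule dirderiv2_scaleR[OF dC_Ck2(1) that])
  have dA': "dirderiv b A' z = r\<^sup>2 * dirderiv b A z" if "z \<in> W" for b z
    by (rule dirderiv_cmult_cong[OF A' that Ck_on_2D(1)[OF A that]])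
  have ddA': "dirderiv b (dirderiv b' A') z = r\<^sup>2 * dirderiv b (dirderiv b' A) z" if "z \<in> W" for b b' z
    by (rule dirderiv_cmult_cong[OF dA' that Ck_on_2D(2)[OF A that]])
  \<comment> \<open>The rescaling enters twice through the \<open>x\<close>-velocity in
    \<open>A'\<close> and twice through the \<open>y\<close>-curve, whose acceleration scales by
    \<open>r\<^sup>2\<close>; a positive factor does not affect the sign.\<close>
  have "r ^ 4 * (dirderiv (0, y1 t) (dirderiv (0, y1 t) A) (x0, y0) + dirderiv (0, y2 t) A (x0, y0)) \<le> 0"
    using unit
    unfolding ddA'[OF z0] dA'[OF z0] dirderiv2_scaleR[OF A z0]
      dirderiv_dir_scaleR[OF Ck_on_2D(1)[OF A z0]]
    by (simp add: algebra_simps flip: power_add)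
  then show ?thesis
    using r(1) by (simp add: mult_le_0_iff y0_def)
qed

text \<open>The segment from \<open>Gy (x 0) yA\<close> to \<open>Gy (x 0) yB\<close> stays in the
  coordinate domain by (B2) and lifts to a curve \<open>y\<close>. Its velocity \<open>h\<close> in
  coordinates is constant, so a single orthogonality condition makes (B3) available at every time,
  and the second derivative of the difference is nonnegative throughout.\<close>

lemma hessian_nonneg:
  assumes xl: "coord_lift I U (Gx yA) q v x x1 x2" "0 \<in> I"
    and yA: "yA \<in> V" and yB: "yB \<in> V"
    and cond: "(x1 0 \<bullet> (Gy (x 0) yB - Gy (x 0) yA) = 0 \<and> condB3 U V c) \<or> condB4 U V c"
  defines "A \<equiv> dirderiv (x1 0, 0) (dirderiv (x1 0, 0) C)"
  shows "A (x 0, yB) + dirderiv (x2 0, 0) C (x 0, yB) \<le> A (x 0, yA) + dirderiv (x2 0, 0) C (x 0, yA)"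
proof -
  define x0 where "x0 = x 0"
  have x0: "x0 \<in> U" using xl by (auto simp: coord_lift_def x0_def)
  have V: "V \<noteq> {}" using yA by auto
  note Y = exp_y[OF x0 V]
  define Y where "Y = inv_into (closure V) (Gy x0)"
  define p where "p = Gy x0 yA"
  define h where "h = Gy x0 yB - Gy x0 yA"
  define y where "y t = Y (p + t *\<^sub>R h)" for t
  define y1 where "y1 t = dirderiv h Y (p + t *\<^sub>R h)" for t
  define y2 where "y2 t = dirderiv h (dirderiv h Y) (p + t *\<^sub>R h)" for t
  define J where "J = (\<lambda>t. p + t *\<^sub>R h) -` V_coord U V c x0"
  have yl: "coord_lift J V (Gy x0) p h y y1 y2"
    unfolding J_def y_def y1_def y2_def Y_def by (rule coord_lift_line[OF Y(1-4)])
  have ends: "p \<in> V_coord U V c x0" "Gy x0 yB \<in> V_coord U V c x0"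
    unfolding p_def V_coord_def using yA yB by blast+
  have J: "t \<in> J" if "t \<in> {0..1}" for t
  proof -
    have "convex (V_coord U V c x0)" using convex_V_coord x0 closure_subset by blast
    then show ?thesis
      using convexD_alt[OF _ ends, of t] that by (simp add: J_def h_def p_def algebra_simps)
  qed
  have y01: "y 0 = yA" "y 1 = yB"
    using Y(5) yA yB by (simp_all add: y_def p_def h_def Y_def)
  have A: "Ck_on 2 W A" unfolding A_def by (rule dC_Ck)
  have zA: "(x0, yA) \<in> W" using x0 yA by simp
  \<comment> \<open>The difference of the two sides of the claim with \<open>y t\<close> in place of
    \<open>yB\<close>; the first-order part of the cost is already replaced by
    \<open>t * (x2 0 \<bullet> h)\<close>, because the \<open>x\<close>-gradient is affine along
    \<open>y\<close>.\<close>
  define D where "D t = - A (x0, y t) + A (x0, yA) + t * (x2 0 \<bullet> h)" for t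
  define D' where "D' t = - dirderiv (0, y1 t) A (x0, y t) + x2 0 \<bullet> h" for t
  define D'' where "D'' t = - (dirderiv (0, y1 t) (dirderiv (0, y1 t) A) (x0, y t)
      + dirderiv (0, y2 t) A (x0, y t))" for t
  have "D 1 \<ge> 0"
  proof (rule nonneg_if_second_derivative_nonneg[where h' = D' and h'' = D''])
    fix t :: real assume t: "t \<in> {0..1}"
    note l = along_y[OF yl J[OF t] x0 A]
    show "(D has_real_derivative D' t) (at t)"
      unfolding D_def D'_def using l(1) by (auto intro!: derivative_eq_intros)
    show "(D' has_real_derivative D'' t) (at t)"
      unfolding D'_def D''_def using DERIV_add[OF DERIV_minus[OF l(2)] DERIV_const[of "x2 0 \<bullet> h"]]
      by simp
    show "0 \<le> D'' t"
      unfolding D''_def A_def using cross_curvature[OF yl J[OF t] x0, of "x1 0"] cond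
      by (simp add: x0_def h_def)
  next
    show "D 0 = 0" by (simp add: D_def y01)
    have J0: "0 \<in> J" using J by simp
    define a where "a = (x1 0, 0::'a)"
    define b where "b = (0::'a, y1 0)"
    \<comment> \<open>Here it matters that \<open>x\<close> is a line in the coordinates from
      \<open>yA\<close>: D_y c(x s, yA) is affine in \<open>s\<close>, which trades the second
      derivative along the velocity for the acceleration \<open>x2 0\<close>. The result cancels the
      linear term of \<open>D\<close>.\<close>
    have "dirderiv b A (x0, yA) = dirderiv a (dirderiv a (dirderiv b C)) (x0, yA)"
      using dirderiv3_commute[OF Ck_on_mono[OF C_Ck, of 3] zA, of b a] by (simp add: A_def a_def)
    also have "\<dots> = - dirderiv (x2 0, 0) (dirderiv b C) (x0, yA)"
      using lift_x(3)[OF xl yA, of "y1 0"] by (simp add: a_def b_def x0_def)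
    also have "dirderiv (x2 0, 0) (dirderiv b C) (x0, yA) = dirderiv b (dirderiv (x2 0, 0) C) (x0, yA)"
      by (rule dirderiv_commute[OF openW dC_Ck2(1) zA])
    also have "\<dots> = - (x2 0 \<bullet> h)"
      using lift_y(2)[OF yl J0 x0, of "x2 0"] by (simp add: b_def y01)
    finally show "D' 0 = 0" by (simp add: D'_def y01 b_def)
  qed
  then have "A (x0, yB) \<le> A (x0, yA) + x2 0 \<bullet> h" by (simp add: D_def y01)
  moreover have "dirderiv (x2 0, 0) C (x0, yB) = dirderiv (x2 0, 0) C (x0, yA) - x2 0 \<bullet> h"
    using lift_y(1)[OF yl J x0, of 0 "x2 0"] lift_y(1)[OF yl J x0, of 1 "x2 0"] by (simp add: y01)
  ultimately show ?thesis by (simp add: x0_def)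
qed

section \<open>The Hessian of a difference of costs\<close>

text \<open>Minus the modified cost \<open>c_tilde U V c yA q yB\<close>, with \<open>yA\<close> in
  the role of \<open>yt\<close>; it is studied for interior \<open>yA\<close> and \<open>yB\<close>,
  where the coordinates are open and everything is differentiable.\<close>

definition mountain :: "'a \<Rightarrow> 'a \<Rightarrow> 'a \<Rightarrow> real" where
  "mountain yA yB q = C (cost_exp U V c yA q, yA) - C (cost_exp U V c yA q, yB)"

context
  fixes yA yB
  assumes yA: "yA \<in> V" and yB: "yB \<in> V" and U: "U \<noteq> {}"
begin

abbreviation "T \<equiv> U_coord U V c yA"
abbreviation "X \<equiv> cost_exp U V c yA"

lemma T_props: "open T" "convex T" "q \<in> T \<Longrightarrow> X q \<in> U"
  using exp_x[OF yA U] convex_U_coord yA closure_subset by blast+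

lemma X_Ck: "Ck_on 2 T X"
  by (rule exp_x(2)[OF yA U])

lemma C_X_Ck: "y \<in> V \<Longrightarrow> Ck_on 2 T (\<lambda>q. C (X q, y))"
  by (rule Ck_on_compose[OF T_props(1) _ X_Ck Ck_on_Pair_left[OF openU dC_Ck2(1)]])
    (use T_props in auto)

lemma mountain_Ck: "Ck_on 2 T (mountain yA yB)"
  unfolding mountain_def by (intro Ck_on_diff T_props C_X_Ck yA yB)

lemma lift_X: "coord_lift ((\<lambda>s. q + s *\<^sub>R v) -` T) U (Gx yA) q v
  (\<lambda>s. X (q + s *\<^sub>R v)) (\<lambda>s. dirderiv v X (q + s *\<^sub>R v)) (\<lambda>s. dirderiv v (dirderiv v X) (q + s *\<^sub>R v))"
  by (rule coord_lift_line[OF exp_x(1-4)[OF yA U]])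

lemma dirderiv_C_X:
  assumes q: "q \<in> T" and y: "y \<in> V"
  shows "dirderiv v (\<lambda>q. C (X q, y)) q = dirderiv (dirderiv v X q, 0) C (X q, y)"
    and "dirderiv v (dirderiv v (\<lambda>q. C (X q, y))) q
      = dirderiv (dirderiv v X q, 0) (dirderiv (dirderiv v X q, 0) C) (X q, y)
        + dirderiv (dirderiv v (dirderiv v X) q, 0) C (X q, y)"
proof -
  let ?J = "(\<lambda>s. q + s *\<^sub>R v) -` T" and ?f = "\<lambda>q. C (X q, y)"
  have J: "open ?J" "0 \<in> ?J"
    using lift_X[of q v] q by (auto simp: coord_lift_def)
  have d: "dirderiv v ?f (q + s *\<^sub>R v) = dirderiv (dirderiv v X (q + s *\<^sub>R v), 0) C (X (q + s *\<^sub>R v), y)"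
    if "s \<in> ?J" for s
    using along_x(1)[OF lift_X that y dC_Ck2(1)]
      has_real_derivative_line[OF Ck_on_2D(1)[OF C_X_Ck[OF y]], of q s v] that DERIV_unique by blast
  from d[OF J(2)] show "dirderiv v ?f q = dirderiv (dirderiv v X q, 0) C (X q, y)" by simp
  have "((\<lambda>s. dirderiv v ?f (q + s *\<^sub>R v)) has_real_derivative dirderiv v (dirderiv v ?f) q) (at 0)"
    using has_real_derivative_line[OF Ck_on_2D(2)[OF C_X_Ck[OF y]], of q 0 v] q by simp
  moreover have "((\<lambda>s. dirderiv v ?f (q + s *\<^sub>R v)) has_real_derivative
      dirderiv (dirderiv v X q, 0) (dirderiv (dirderiv v X q, 0) C) (X q, y)
        + dirderiv (dirderiv v (dirderiv v X) q, 0) C (X q, y)) (at 0)"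
    using has_field_derivative_transform_within_open[OF along_x(2)[OF lift_X J(2) y dC_Ck2(1)] J] d
    by simp
  ultimately show "dirderiv v (dirderiv v ?f) q
      = dirderiv (dirderiv v X q, 0) (dirderiv (dirderiv v X q, 0) C) (X q, y)
        + dirderiv (dirderiv v (dirderiv v X) q, 0) C (X q, y)"
    using DERIV_unique by blast
qed

lemma dirderiv_mountain:
  assumes q: "q \<in> T"
  shows "dirderiv v (mountain yA yB) q = dirderiv v X q \<bullet> (Gy (X q) yB - Gy (X q) yA)"
    and "dirderiv v (dirderiv v (mountain yA yB)) q
      = dirderiv v (dirderiv v (\<lambda>q. C (X q, yA))) q - dirderiv v (dirderiv v (\<lambda>q. C (X q, yB))) q"
proof -
  have dd: "dirderiv v (mountain yA yB) r = dirderiv v (\<lambda>q. C (X q, yA)) r - dirderiv v (\<lambda>q. C (X q, yB)) r"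
    if "r \<in> T" for r
    unfolding mountain_def
    using Ck_on_2D(1)[OF C_X_Ck[OF yA] that] Ck_on_2D(1)[OF C_X_Ck[OF yB] that]
    by (intro dirderiv_eqI) (auto intro!: derivative_eq_intros has_derivative_dirderiv)
  show "dirderiv v (mountain yA yB) q = dirderiv v X q \<bullet> (Gy (X q) yB - Gy (X q) yA)"
    unfolding dd[OF q] dirderiv_C_X(1)[OF q yA] dirderiv_C_X(1)[OF q yB]
    using T_props(3)[OF q] yA yB
    by (simp add: Dx_closure_eq inner_diff_right flip: inner_Dx)
  have "dirderiv v (dirderiv v (mountain yA yB)) q
      = dirderiv v (\<lambda>r. dirderiv v (\<lambda>q. C (X q, yA)) r - dirderiv v (\<lambda>q. C (X q, yB)) r) q"
    by (rule dirderiv_cong[OF T_props(1) q dd])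
  also have "\<dots> = dirderiv v (dirderiv v (\<lambda>q. C (X q, yA))) q - dirderiv v (dirderiv v (\<lambda>q. C (X q, yB))) q"
    using Ck_on_2D(2)[OF C_X_Ck[OF yA] q] Ck_on_2D(2)[OF C_X_Ck[OF yB] q]
    by (intro dirderiv_eqI) (auto intro!: derivative_eq_intros has_derivative_dirderiv)
  finally show "dirderiv v (dirderiv v (mountain yA yB)) q
      = dirderiv v (dirderiv v (\<lambda>q. C (X q, yA))) q - dirderiv v (dirderiv v (\<lambda>q. C (X q, yB))) q" .
qed

lemma mountain_hessian:
  assumes q: "q \<in> T"
    and cond: "(dirderiv v (mountain yA yB) q = 0 \<and> condB3 U V c) \<or> condB4 U V c"
  shows "dirderiv v (dirderiv v (mountain yA yB)) q \<ge> 0"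
  using hessian_nonneg[OF lift_X _ yA yB, of q v] cond q
  unfolding dirderiv_mountain(2)[OF q] dirderiv_C_X(2)[OF q yA] dirderiv_C_X(2)[OF q yB]
    dirderiv_mountain(1)[OF q]
  by simp

lemma mountain_noncritical:
  assumes q: "q \<in> T" and "yA \<noteq> yB"
  shows "\<exists>v. dirderiv v (mountain yA yB) q \<noteq> 0"
proof -
  have x: "X q \<in> U" using T_props(3)[OF q] .
  define h where "h = Gy (X q) yB - Gy (X q) yA"
  have "V \<noteq> {}" using yA by auto
  have "Gy (X q) yB \<noteq> Gy (X q) yA"
    using exp_y(5)[OF x \<open>V \<noteq> {}\<close>] yA yB assms(2) by metis
  then have h: "h \<noteq> 0" by (simp add: h_def)
  \<comment> \<open>Chosen so that \<open>X\<close> moves with velocity \<open>h\<close>; the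
    derivative then equals \<open>h \<bullet> h\<close>, which is nonzero because
    \<open>Gy (X q)\<close> is injective.\<close>
  define v where "v = dirderiv h (Gx yA) (X q)"
  have "dirderiv h (\<lambda>x. X (Gx yA x)) (X q) = dirderiv v X (Gx yA (X q))"
    unfolding v_def
    using Ck_on_2D(1)[OF Dy_Ck[OF yA] x] Ck_on_2D(1)[OF X_Ck q] exp_x(4)[OF yA U q]
    by (intro dirderiv_compose) auto
  moreover have "dirderiv h (\<lambda>x. X (Gx yA x)) (X q) = dirderiv h (\<lambda>x. x) (X q)"
    by (rule dirderiv_cong[OF openU x]) (simp add: exp_x(5)[OF yA U])
  moreover have "dirderiv h (\<lambda>x. x) (X q) = h"
    by (rule dirderiv_eqI) (rule has_derivative_ident)
  ultimately have "dirderiv v X q = h" using exp_x(4)[OF yA U q] by simp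
  then have "dirderiv v (mountain yA yB) q = h \<bullet> h"
    unfolding dirderiv_mountain(1)[OF q] by (simp add: h_def)
  then show ?thesis using h by (metis inner_eq_zero_iff)
qed

lemma mountain_quasiconvex:
  assumes "condB3 U V c" "q0 \<in> T" "q1 \<in> T" "s \<in> {0..1}"
  shows "mountain yA yB (q0 + s *\<^sub>R (q1 - q0)) \<le> max (mountain yA yB q0) (mountain yA yB q1)"
proof (cases "yA = yB")
  case True
  then show ?thesis by (simp add: mountain_def)
next
  case False
  show ?thesis
    by (rule quasiconvex_second_order[OF T_props(1,2) mountain_Ck])
      (use assms mountain_hessian mountain_noncritical[OF _ False] in auto)
qed

text \<open>The factor 2 is the second derivative of \<open>K * (norm q)\<^sup>2\<close> along
  \<open>v\<close>, namely \<open>2 * K * (norm v)\<^sup>2\<close>.\<close>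

lemma convex_on_if_hessian:
  assumes f: "Ck_on 2 T f" "\<And>q v. q \<in> T \<Longrightarrow> dirderiv v (dirderiv v f) q \<ge> - 2 * K * (norm v)\<^sup>2"
    and q: "q0 \<in> T" "q1 \<in> T" "s \<in> {0..1}"
  shows "f (q0 + s *\<^sub>R (q1 - q0)) + K * (norm (q0 + s *\<^sub>R (q1 - q0)))\<^sup>2
    \<le> (1 - s) * (f q0 + K * (norm q0)\<^sup>2) + s * (f q1 + K * (norm q1)\<^sup>2)"
proof -
  define v where "v = q1 - q0"
  have z: "q0 + t *\<^sub>R v \<in> T" if "t \<in> {0..1}" for t
    using convexD_alt[OF T_props(2) q(1,2), of t] that by (simp add: v_def algebra_simps)
  define g where "g t = f (q0 + t *\<^sub>R v) + K * (norm (q0 + t *\<^sub>R v))\<^sup>2" for t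
  have "convex_on {0..1} g"
  proof (rule f''_ge0_imp_convex)
    fix t :: real assume t: "t \<in> {0..1}"
    have n: "(norm (q0 + t *\<^sub>R v))\<^sup>2 = q0 \<bullet> q0 + 2 * t * (q0 \<bullet> v) + t\<^sup>2 * (v \<bullet> v)" for t
      unfolding power2_norm_eq_inner
      by (simp add: inner_add_left inner_add_right inner_commute power2_eq_square)
    show "(g has_real_derivative dirderiv v f (q0 + t *\<^sub>R v) + K * (2 * (q0 \<bullet> v) + 2 * t * (v \<bullet> v))) (at t)"
      unfolding g_def n
      using has_real_derivative_line[OF Ck_on_2D(1)[OF f(1) z[OF t]]]
      by (auto intro!: derivative_eq_intros)
    show "((\<lambda>t. dirderiv v f (q0 + t *\<^sub>R v) + K * (2 * (q0 \<bullet> v) + 2 * t * (v \<bullet> v))) has_real_derivative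
        dirderiv v (dirderiv v f) (q0 + t *\<^sub>R v) + K * (2 * (v \<bullet> v))) (at t)"
      using has_real_derivative_line[OF Ck_on_2D(2)[OF f(1) z[OF t]]]
      by (auto intro!: derivative_eq_intros)
    show "0 \<le> dirderiv v (dirderiv v f) (q0 + t *\<^sub>R v) + K * (2 * (v \<bullet> v))"
      using f(2)[OF z[OF t], of v] by (simp add: power2_norm_eq_inner)
  qed simp
  from convex_onD[OF this, of s 0 1] q(3) show ?thesis
    by (simp add: g_def v_def)
qed

end

end

section \<open>The semiconvexity constant\<close>

text \<open>By continuity, the set where the norm exceeds the essential supremum is open; it is also
  null, hence empty. Boundedness excludes an infinite essential supremum, which
  \<open>real_of_ereal\<close> would turn into 0.\<close>

lemma norm_le_Linf_norm:
  assumes S: "open S" and F: "continuous_on S (\<lambda>z. F (fst z) (snd z))"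
    and bdd: "bounded ((\<lambda>z. F (fst z) (snd z)) ` S)" and xy: "(x, y) \<in> S"
  shows "norm (F x y) \<le> Linf_norm S F"
proof -
  define f where "f z = ereal (norm (F (fst z) (snd z)))" for z
  have eq: "(\<lambda>(x, y). ereal (norm (F x y))) = f" by (auto simp: f_def)
  have cont: "continuous_on S f"
    unfolding f_def using F by (intro continuous_intros)
  have leb: "S \<in> sets lebesgue" using S by auto
  have "(\<lambda>z. norm (F (fst z) (snd z))) \<in> borel_measurable (lebesgue_on S)"
    by (rule continuous_imp_measurable_on_sets_lebesgue[OF _ leb]) (use F in \<open>intro continuous_intros\<close>)
  then have meas: "f \<in> borel_measurable (lebesgue_on S)"
    unfolding f_def by measurable
  define e where "e = esssup (lebesgue_on S) f"
  obtain B where B: "\<And>z. z \<in> S \<Longrightarrow> norm (F (fst z) (snd z)) \<le> B"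
    using bdd by (auto simp: bounded_iff)
  have "e \<le> ereal B"
    unfolding e_def using B by (intro esssup_I meas AE_I2) (auto simp: f_def)
  moreover have "f (x, y) \<le> e"
  proof (rule ccontr)
    assume "\<not> f (x, y) \<le> e"
    define N where "N = S \<inter> f -` {e<..}"
    have "open N" unfolding N_def
      by (rule continuous_open_preimage[OF cont S]) auto
    moreover have "(x, y) \<in> N" using \<open>\<not> f (x, y) \<le> e\<close> xy by (auto simp: N_def)
    moreover have "emeasure lebesgue N = 0"
    proof -
      have "emeasure (lebesgue_on S) {z \<in> space (lebesgue_on S). f z > e} = 0"
        unfolding e_def by (rule esssup_zero_measure)
      moreover have "{z \<in> space (lebesgue_on S). f z > e} = N" by (auto simp: N_def)
      ultimately show ?thesis
        using emeasure_restrict_space[of S lebesgue N] leb by (auto simp: N_def)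
    qed
    ultimately have "negligible N"
      by (subst negligible_iff_emeasure0) auto
    then show False
      using \<open>open N\<close> \<open>(x, y) \<in> N\<close> open_not_negligible by blast
  qed
  ultimately show ?thesis
    unfolding Linf_norm_def eq e_def[symmetric] by (cases e) (auto simp: f_def)
qed

section \<open>Bounded linear maps by columns\<close>

text \<open>A rank-one map. Sums of these rebuild a bounded linear map from its values on
  \<open>Basis\<close>, so that regularity can be checked column by column, also when the codomain
  is itself a space of linear maps as for \<open>DxxDy\<close>.\<close>

definition blinfun_column :: "'a::euclidean_space \<Rightarrow> 'b::real_normed_vector \<Rightarrow> 'a \<Rightarrow>\<^sub>L 'b" where
  "blinfun_column a w = blinfun_scaleR_left w o\<^sub>L blinfun_inner_left a"

lemma blinfun_column_apply [simp]: "blinfun_column a w v = (v \<bullet> a) *\<^sub>R w"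
  by (simp add: blinfun_column_def blinfun_scaleR_left.rep_eq)

lemma bounded_linear_blinfun_column:
  "bounded_linear (blinfun_column (a::'a::euclidean_space) :: 'b::real_normed_vector \<Rightarrow> _)"
proof (rule bounded_linear_intro[where K = "norm a"])
  show "norm (blinfun_column a w) \<le> norm w * norm a" for w :: 'b
  proof (rule norm_blinfun_bound)
    fix v
    have "\<bar>v \<bullet> a\<bar> * norm w \<le> (norm v * norm a) * norm w"
      by (intro mult_right_mono Cauchy_Schwarz_ineq2) auto
    then show "norm (blinfun_column a w v) \<le> norm w * norm a * norm v" by (simp add: ac_simps)
  qed auto
qed (auto intro!: blinfun_eqI simp: blinfun.bilinear_simps algebra_simps)

lemma blinfun_eq_sum_columns:
  fixes L :: "'a::euclidean_space \<Rightarrow>\<^sub>L 'b::real_normed_vector"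
  shows "L = (\<Sum>a\<in>Basis. blinfun_column a (L a))"
proof (rule blinfun_eqI)
  fix v
  have "L v = L (\<Sum>a\<in>Basis. (v \<bullet> a) *\<^sub>R a)" by (simp add: euclidean_representation)
  also have "\<dots> = (\<Sum>a\<in>Basis. blinfun_column a (L a)) v"
    by (simp add: blinfun.bilinear_simps)
  finally show "L v = (\<Sum>a\<in>Basis. blinfun_column a (L a)) v" .
qed

lemma blinfun_differentiable:
  fixes L :: "'c::real_normed_vector \<Rightarrow> 'a::euclidean_space \<Rightarrow>\<^sub>L 'b::real_normed_vector"
  assumes "\<And>a. a \<in> Basis \<Longrightarrow> (\<lambda>x. L x a) differentiable at x"
  shows "L differentiable at x"
proof -
  have "(\<lambda>x. blinfun_column a (L x a)) differentiable at x" if "a \<in> Basis" for a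
    using assms[OF that] bounded_linear.has_derivative[OF bounded_linear_blinfun_column]
    unfolding differentiable_def by blast
  then have "(\<lambda>x. \<Sum>a\<in>Basis. blinfun_column a (L x a)) differentiable at x"
    by (intro differentiable_sum) auto
  then show ?thesis by (simp flip: blinfun_eq_sum_columns)
qed

lemma total_deriv_apply:
  "f differentiable at x \<Longrightarrow> blinfun_apply (total_deriv f x) v = dirderiv v f x"
  unfolding total_deriv_def dirderiv_def
  by (metis bounded_linear_Blinfun_apply frechet_derivative_works has_derivative_bounded_linear)

context cost_domain
begin

section \<open>Continuous extension of the derivatives to the boundary\<close>

text \<open>Values outside \<open>W\<close> are ignored, since nested derivatives mean nothing
  there. Continuity and boundedness on \<open>W\<close>, the two inputs for the essential suprema,
  follow at once.\<close>

definition extends :: "('a \<times> 'a \<Rightarrow> 'b::real_normed_vector) \<Rightarrow> bool" where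
  "extends f \<longleftrightarrow> (\<exists>g. continuous_on (closure W) g \<and> (\<forall>z\<in>W. f z = g z))"

lemma extends_cong: "extends f \<Longrightarrow> (\<And>z. z \<in> W \<Longrightarrow> f z = g z) \<Longrightarrow> extends g"
  unfolding extends_def by metis

lemma extends_continuous:
  assumes "extends f" shows "continuous_on W f"
proof -
  obtain g where g: "continuous_on (closure W) g" "\<And>z. z \<in> W \<Longrightarrow> f z = g z"
    using assms by (auto simp: extends_def)
  have "continuous_on W g" by (rule continuous_on_subset[OF g(1) closure_subset])
  then show ?thesis using g(2) by (simp cong: continuous_on_cong)
qed

lemma extends_bounded:
  assumes "extends f" shows "bounded (f ` W)"
proof -
  obtain g where g: "continuous_on (closure W) g" "\<And>z. z \<in> W \<Longrightarrow> f z = g z"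
    using assms by (auto simp: extends_def)
  have "bounded (g ` closure W)"
    using g(1) boundedW by (intro compact_imp_bounded compact_continuous_image) (auto simp: compact_closure)
  moreover have "f ` W \<subseteq> g ` closure W" using g(2) closure_subset[of W] by force
  ultimately show ?thesis by (rule bounded_subset)
qed

lemma extends_bounded_linear:
  assumes "bounded_linear L" "extends f"
  shows "extends (\<lambda>z. L (f z))"
proof -
  obtain g where g: "continuous_on (closure W) g" "\<And>z. z \<in> W \<Longrightarrow> f z = g z"
    using assms(2) by (auto simp: extends_def)
  then show ?thesis
    unfolding extends_def using bounded_linear.continuous_on[OF assms(1) g(1)] by auto
qed

lemma extends_sum:
  assumes "finite I" "\<And>i. i \<in> I \<Longrightarrow> extends (f i)"
  shows "extends (\<lambda>z. \<Sum>i\<in>I. f i z)"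
proof -
  obtain g where "\<And>i. i \<in> I \<Longrightarrow> continuous_on (closure W) (g i)" "\<And>i z. i \<in> I \<Longrightarrow> z \<in> W \<Longrightarrow> f i z = g i z"
    using assms(2) unfolding extends_def by metis
  then show ?thesis
    unfolding extends_def
    by (intro exI[of _ "\<lambda>z. \<Sum>i\<in>I. g i z"] conjI continuous_on_sum) auto
qed

lemma extends_vector:
  fixes F :: "'a \<times> 'a \<Rightarrow> 'a"
  assumes "\<And>b. extends (\<lambda>z. b \<bullet> F z)"
  shows "extends F"
proof -
  have "extends (\<lambda>z. \<Sum>b\<in>Basis. (b \<bullet> F z) *\<^sub>R b)"
    by (intro extends_sum extends_bounded_linear[OF bounded_linear_scaleR_left] assms) auto
  then show ?thesis by (rule extends_cong) (rule vec_eq_sum_inner[symmetric])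
qed

lemma extends_blinfun:
  fixes L :: "'a \<times> 'a \<Rightarrow> 'a \<Rightarrow>\<^sub>L 'b::real_normed_vector"
  assumes "\<And>a. extends (\<lambda>z. L z a)"
  shows "extends L"
proof -
  have "extends (\<lambda>z. \<Sum>a\<in>Basis. blinfun_column a (L z a))"
    by (intro extends_sum extends_bounded_linear[OF bounded_linear_blinfun_column] assms) auto
  then show ?thesis by (rule extends_cong) (rule blinfun_eq_sum_columns[symmetric])
qed

lemma extends_dC: "extends (dirderiv a C)" "extends (dirderiv a (dirderiv b C))"
  "extends (dirderiv a (dirderiv b (dirderiv d C)))"
proof -
  \<comment> \<open>Passing to a representative \<open>g\<close> makes the step iterable: a
    \<open>dirderiv\<close> itself need not be regular at the boundary.\<close>
  have step: "\<exists>g. Ck_closure k W g \<and> (\<forall>z\<in>W. dirderiv v f z = g z)"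
    if f: "\<exists>g. Ck_closure (Suc k) W g \<and> (\<forall>z\<in>W. f z = g z)" for k v and f :: "'a \<times> 'a \<Rightarrow> real"
  proof -
    obtain g where g: "Ck_closure (Suc k) W g" "\<And>z. z \<in> W \<Longrightarrow> f z = g z" using f by blast
    from g(1) obtain D where D: "\<And>v. Ck_closure k W (D v)" "\<And>v z. z \<in> W \<Longrightarrow> dirderiv v g z = D v z"
      by (rule Ck_closure_SucE) blast
    have "dirderiv v f z = D v z" if "z \<in> W" for z
      using dirderiv_cong[OF openW that g(2)] D(2)[OF that] by simp
    then show ?thesis using D(1) by blast
  qed
  have "\<exists>g. Ck_closure (Suc 3) W g \<and> (\<forall>z\<in>W. C z = g z)"
    using C_closure by (intro exI[of _ C]) (simp del: Ck_closure.simps)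
  then have 3: "\<exists>g. Ck_closure 3 W g \<and> (\<forall>z\<in>W. dirderiv v C z = g z)" for v by (rule step)
  then have "\<exists>g. Ck_closure (Suc 2) W g \<and> (\<forall>z\<in>W. dirderiv v C z = g z)" for v
    by (simp del: Ck_closure.simps)
  then have 2: "\<exists>g. Ck_closure 2 W g \<and> (\<forall>z\<in>W. dirderiv w (dirderiv v C) z = g z)" for v w by (rule step)
  then have "\<exists>g. Ck_closure (Suc 1) W g \<and> (\<forall>z\<in>W. dirderiv w (dirderiv v C) z = g z)" for v w
    unfolding Suc_1 .
  then have 1: "\<exists>g. Ck_closure 1 W g \<and> (\<forall>z\<in>W. dirderiv u (dirderiv w (dirderiv v C)) z = g z)" for u v w
    by (rule step)
  show "extends (dirderiv a C)" "extends (dirderiv a (dirderiv b C))"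
    "extends (dirderiv a (dirderiv b (dirderiv d C)))"
    unfolding extends_def using 1 2 3 Ck_closure_continuous by blast+
qed

lemma Dx_dirderiv:
  assumes "x \<in> U" "y \<in> V"
  shows "(\<lambda>x. Dx c x y) differentiable at x"
    and "b \<bullet> dirderiv v (\<lambda>x. Dx c x y) x = dirderiv (v, 0) (dirderiv (b, 0) C) (x, y)"
proof -
  have Dx: "Dx c x' y = (\<Sum>b\<in>Basis. dirderiv (b, 0) C (x', y) *\<^sub>R b)" if "x' \<in> U" for x'
    using vec_eq_sum_inner[of "Dx c x' y"] inner_Dx[OF that assms(2)] by simp
  have "((\<lambda>x. \<Sum>b\<in>Basis. dirderiv (b, 0) C (x, y) *\<^sub>R b) has_derivative
      (\<lambda>v. \<Sum>b\<in>Basis. dirderiv (v, 0) (dirderiv (b, 0) C) (x, y) *\<^sub>R b)) (at x)"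
    using assms by (intro has_derivative_sum has_derivative_scaleR_left has_derivative_Pair_left C_diff) auto
  from has_derivative_transform_within_open[OF this openU assms(1), of "\<lambda>x. Dx c x y"] Dx
  show d: "(\<lambda>x. Dx c x y) differentiable at x"
    by (auto simp: differentiable_def)
  have "b \<bullet> dirderiv v (\<lambda>x. Dx c x y) x = dirderiv v (\<lambda>x. b \<bullet> Dx c x y) x"
    by (rule dirderiv_bounded_linear[OF bounded_linear_inner_right d, symmetric])
  also have "\<dots> = dirderiv v (\<lambda>x. dirderiv (b, 0) C (x, y)) x"
    by (rule dirderiv_cong[OF openU assms(1)]) (use assms(2) inner_Dx in auto)
  also have "\<dots> = dirderiv (v, 0) (dirderiv (b, 0) C) (x, y)"
    using assms by (intro dirderiv_Pair_left C_diff) auto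
  finally show "b \<bullet> dirderiv v (\<lambda>x. Dx c x y) x = dirderiv (v, 0) (dirderiv (b, 0) C) (x, y)" .
qed

lemma Dy_dirderiv:
  assumes "x \<in> U" "y \<in> V"
  shows "(\<lambda>x. Dy c x y) differentiable at x"
    and "b \<bullet> dirderiv v (\<lambda>x. Dy c x y) x = dirderiv (v, 0) (dirderiv (0, b) C) (x, y)"
proof -
  have Dy: "Dy c x' y = (\<Sum>b\<in>Basis. dirderiv (0, b) C (x', y) *\<^sub>R b)" if "x' \<in> U" for x'
    using vec_eq_sum_inner[of "Dy c x' y"] inner_Dy[OF that assms(2)] by simp
  have "((\<lambda>x. \<Sum>b\<in>Basis. dirderiv (0, b) C (x, y) *\<^sub>R b) has_derivative
      (\<lambda>v. \<Sum>b\<in>Basis. dirderiv (v, 0) (dirderiv (0, b) C) (x, y) *\<^sub>R b)) (at x)"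
    using assms by (intro has_derivative_sum has_derivative_scaleR_left has_derivative_Pair_left C_diff) auto
  from has_derivative_transform_within_open[OF this openU assms(1), of "\<lambda>x. Dy c x y"] Dy
  show d: "(\<lambda>x. Dy c x y) differentiable at x"
    by (auto simp: differentiable_def)
  have "b \<bullet> dirderiv v (\<lambda>x. Dy c x y) x = dirderiv v (\<lambda>x. b \<bullet> Dy c x y) x"
    by (rule dirderiv_bounded_linear[OF bounded_linear_inner_right d, symmetric])
  also have "\<dots> = dirderiv v (\<lambda>x. dirderiv (0, b) C (x, y)) x"
    by (rule dirderiv_cong[OF openU assms(1)]) (use assms(2) inner_Dy in auto)
  also have "\<dots> = dirderiv (v, 0) (dirderiv (0, b) C) (x, y)"
    using assms by (intro dirderiv_Pair_left C_diff) auto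
  finally show "b \<bullet> dirderiv v (\<lambda>x. Dy c x y) x = dirderiv (v, 0) (dirderiv (0, b) C) (x, y)" .
qed

lemma inner_Dxx: "x \<in> U \<Longrightarrow> y \<in> V \<Longrightarrow> b \<bullet> Dxx c x y v = dirderiv (v, 0) (dirderiv (b, 0) C) (x, y)"
  unfolding Dxx_def by (simp add: total_deriv_apply Dx_dirderiv)

lemma inner_Dxy: "x \<in> U \<Longrightarrow> y \<in> V \<Longrightarrow> b \<bullet> Dxy c x y v = dirderiv (v, 0) (dirderiv (0, b) C) (x, y)"
  unfolding Dxy_def by (simp add: total_deriv_apply Dy_dirderiv)

lemma inner_DxxDy:
  assumes "x \<in> U" "y \<in> V"
  shows "b \<bullet> DxxDy c x y v w = dirderiv (v, 0) (dirderiv (w, 0) (dirderiv (0, b) C)) (x, y)"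
proof -
  have comp: "Dxy c x' y w = (\<Sum>b\<in>Basis. dirderiv (w, 0) (dirderiv (0, b) C) (x', y) *\<^sub>R b)" if "x' \<in> U" for x' w
    using vec_eq_sum_inner[of "Dxy c x' y w"] inner_Dxy[OF that assms(2)] by simp
  have dw: "(\<lambda>x. Dxy c x y w) differentiable at x" for w
  proof -
    have "((\<lambda>x. \<Sum>b\<in>Basis. dirderiv (w, 0) (dirderiv (0, b) C) (x, y) *\<^sub>R b) has_derivative
        (\<lambda>v. \<Sum>b\<in>Basis. dirderiv (v, 0) (dirderiv (w, 0) (dirderiv (0, b) C)) (x, y) *\<^sub>R b)) (at x)"
      using assms by (intro has_derivative_sum has_derivative_scaleR_left has_derivative_Pair_left C_diff) auto
    from has_derivative_transform_within_open[OF this openU assms(1), of "\<lambda>x. Dxy c x y w"] comp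
    show ?thesis by (auto simp: differentiable_def)
  qed
  then have d: "(\<lambda>x. Dxy c x y) differentiable at x" by (intro blinfun_differentiable)
  have "b \<bullet> DxxDy c x y v w = b \<bullet> dirderiv v (\<lambda>x. Dxy c x y) x w"
    unfolding DxxDy_def by (simp add: total_deriv_apply[OF d])
  also have "dirderiv v (\<lambda>x. Dxy c x y) x w = dirderiv v (\<lambda>x. Dxy c x y w) x"
    by (rule dirderiv_bounded_linear[OF blinfun.bounded_linear_left d, symmetric])
  also have "b \<bullet> \<dots> = dirderiv v (\<lambda>x. b \<bullet> Dxy c x y w) x"
    by (rule dirderiv_bounded_linear[OF bounded_linear_inner_right dw, symmetric])
  also have "\<dots> = dirderiv v (\<lambda>x. dirderiv (w, 0) (dirderiv (0, b) C) (x, y)) x"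
    by (rule dirderiv_cong[OF openU assms(1)]) (use assms(2) inner_Dxy in auto)
  also have "\<dots> = dirderiv (v, 0) (dirderiv (w, 0) (dirderiv (0, b) C)) (x, y)"
    using assms by (intro dirderiv_Pair_left C_diff) auto
  finally show ?thesis .
qed

lemma extends_Dx: "extends (\<lambda>z. Dx c (fst z) (snd z))"
  by (intro extends_vector, rule extends_cong[OF extends_dC(1)]) (auto simp: inner_Dx)

lemma extends_Dxx: "extends (\<lambda>z. Dxx c (fst z) (snd z))"
  by (intro extends_blinfun extends_vector, rule extends_cong[OF extends_dC(2)]) (auto simp: inner_Dxx)

lemma extends_Dxy: "extends (\<lambda>z. Dxy c (fst z) (snd z))"
  by (intro extends_blinfun extends_vector, rule extends_cong[OF extends_dC(2)]) (auto simp: inner_Dxy)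

lemma extends_DxxDy: "extends (\<lambda>z. DxxDy c (fst z) (snd z))"
  by (intro extends_blinfun extends_vector, rule extends_cong[OF extends_dC(3)]) (auto simp: inner_DxxDy)

lemma Linf_bounds:
  assumes "x \<in> U" "y \<in> V"
  shows "norm (Dx c x y) \<le> Linf_norm W (Dx c)" "norm (Dxx c x y) \<le> Linf_norm W (Dxx c)"
    "norm (DxxDy c x y) \<le> Linf_norm W (DxxDy c)"
  using assms
  by (intro norm_le_Linf_norm openW extends_continuous extends_bounded extends_Dx extends_Dxx extends_DxxDy; simp)+

section \<open>Uniform invertibility of the mixed derivative\<close>

lemma Gx_has_derivative:
  assumes "x \<in> U" "y \<in> V"
  shows "(Gx y has_derivative (\<lambda>h. - Dxy c x y h)) (at x)"
proof -
  have "((\<lambda>x. Dy c x y) has_derivative blinfun_apply (Dxy c x y)) (at x)"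
    using has_derivative_dirderiv[OF Dy_dirderiv(1)[OF assms]]
    by (simp add: Dxy_def total_deriv_apply[OF Dy_dirderiv(1)[OF assms], abs_def])
  then have "((\<lambda>x. - Dy c x y) has_derivative (\<lambda>h. - Dxy c x y h)) (at x)"
    by (rule has_derivative_minus)
  then show ?thesis
    by (rule has_derivative_transform_within_open[OF _ openU assms(1)])
      (use assms(2) in \<open>simp add: Dy_closure_eq\<close>)
qed

text \<open>For \<open>y\<close> on the boundary of \<open>V\<close>, \<open>Gx y\<close> is only a
  limit of the maps with interior \<open>y\<close>. Their derivatives converge uniformly on a ball
  around \<open>x\<close>, by uniform continuity of \<open>E\<close> on a compact set, so limit and
  derivative may be exchanged.\<close>

lemma Gx_has_derivative_closure:
  assumes E: "continuous_on (closure W) E" "\<And>x y. x \<in> U \<Longrightarrow> y \<in> V \<Longrightarrow> E (x, y) = Dxy c x y"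
    and x: "x \<in> U" and y: "y \<in> closure V"
  shows "(Gx y has_derivative (\<lambda>h. - E (x, y) h)) (at x)"
proof -
  obtain r where r: "r > 0" "ball x r \<subseteq> U"
    using openU x by (auto simp: open_contains_ball)
  obtain s where s: "\<And>n. s n \<in> V" "s \<longlonglongrightarrow> y"
    using y by (auto simp: closure_sequential)
  have cl: "(x', y) \<in> closure W" "(x', s n) \<in> W" if "x' \<in> U" for x' n
    using that y s closure_subset[of U] by (auto simp: closure_Times)
  have conv: "(\<lambda>n. Gx (s n) x') \<longlonglongrightarrow> Gx y x'" if "x' \<in> U" for x'
  proof (rule tendsto_minus)
    have "(\<lambda>n. (x', s n)) \<longlonglongrightarrow> (x', y)" by (intro tendsto_intros s)
    from continuous_on_tendsto_compose[OF Dy_closure_continuous this cl(1)[OF that]]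
    show "(\<lambda>n. Dy_closure U V c x' (s n)) \<longlonglongrightarrow> Dy_closure U V c x' y"
      using cl(2)[OF that] closure_subset[of W] by (simp add: subset_iff)
  qed
  have unif: "uniformly_continuous_on (closure W) E"
    using E(1) boundedW by (intro compact_uniformly_continuous) (auto simp: compact_closure)
  have "\<exists>g. \<forall>x'\<in>ball x r. (\<lambda>n. Gx (s n) x') \<longlonglongrightarrow> g x' \<and>
      (g has_derivative (\<lambda>h. - E (x', y) h)) (at x' within ball x r)"
  proof (rule has_derivative_sequence[where f' = "\<lambda>n x' h. - E (x', s n) h"])
    show "(Gx (s n) has_derivative (\<lambda>h. - E (x', s n) h)) (at x' within ball x r)"
      if "x' \<in> ball x r" for n x'
    proof -
      have x': "x' \<in> U" using that r(2) by blast
      show ?thesis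
        using has_derivative_at_withinI[OF Gx_has_derivative[OF x' s(1)]]
        by (simp only: E(2)[OF x' s(1)])
    qed
    show "\<forall>\<^sub>F n in sequentially. \<forall>x'\<in>ball x r. \<forall>h.
        norm (- E (x', s n) h - - E (x', y) h) \<le> e * norm h" if "e > 0" for e
    proof -
      obtain d where d: "d > 0" "\<And>z z'. z \<in> closure W \<Longrightarrow> z' \<in> closure W \<Longrightarrow> dist z' z < d \<Longrightarrow> dist (E z') (E z) < e"
        using unif \<open>e > 0\<close> unfolding uniformly_continuous_on_def by metis
      have "\<forall>\<^sub>F n in sequentially. dist (s n) y < d"
        using s(2) d(1) by (simp add: tendsto_iff)
      then show ?thesis
      proof eventually_elim
        case (elim n)
        show ?case
        proof (intro ballI allI)
          fix x' h assume "x' \<in> ball x r"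
          then have "x' \<in> U" using r by blast
          then have "dist (E (x', y)) (E (x', s n)) < e"
            using d(2)[of "(x', s n)" "(x', y)"] cl(1)[of x'] cl(2)[of x' n] elim closure_subset[of W]
            by (auto simp: dist_Pair_Pair dist_commute)
          then have "norm (E (x', y) - E (x', s n)) \<le> e" by (simp add: dist_norm)
          then have "norm ((E (x', y) - E (x', s n)) h) \<le> e * norm h"
            using norm_blinfun[of "E (x', y) - E (x', s n)" h]
            by (meson mult_right_mono norm_ge_zero order_trans)
          then show "norm (- E (x', s n) h - - E (x', y) h) \<le> e * norm h"
            by (simp add: blinfun.diff_left norm_minus_commute)
        qed
      qed
    qed
    show "x \<in> ball x r" using r by simp
    show "(\<lambda>n. Gx (s n) x) \<longlonglongrightarrow> Gx y x" by (rule conv[OF x])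
  qed simp
  then obtain g where g: "\<And>x'. x' \<in> ball x r \<Longrightarrow> (\<lambda>n. Gx (s n) x') \<longlonglongrightarrow> g x'"
    "(g has_derivative (\<lambda>h. - E (x, y) h)) (at x within ball x r)"
    using r(1) by (meson centre_in_ball)
  have "g x' = Gx y x'" if "x' \<in> ball x r" for x'
    using g(1)[OF that] conv[of x'] that r(2) LIMSEQ_unique by blast
  moreover have "(g has_derivative (\<lambda>h. - E (x, y) h)) (at x)"
    using g(2) r(1) by (simp add: at_within_open[OF _ open_ball])
  ultimately show ?thesis
    using has_derivative_transform_within_open[of g _ x UNIV "ball x r" "Gx y"] r(1) by auto
qed

text \<open>Injectivity at each interior point would not give a uniform constant. (B1) is therefore
  used to make the extension \<open>E\<close> injective on all of \<open>closure W\<close>; the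
  positive function \<open>norm (E z v)\<close> then attains its minimum over unit vectors.\<close>

lemma Dxy_lower_bound:
  obtains m where "m > 0" "\<And>x y v. x \<in> U \<Longrightarrow> y \<in> V \<Longrightarrow> m * norm v \<le> norm (Dxy c x y v)"
proof (cases "U = {} \<or> V = {}")
  case True
  then show ?thesis using that[of 1] by auto
next
  case False
  then have ne: "U \<noteq> {}" "V \<noteq> {}" by auto
  obtain E where E: "continuous_on (closure W) E" "\<And>x y. x \<in> U \<Longrightarrow> y \<in> V \<Longrightarrow> E (x, y) = Dxy c x y"
    using extends_Dxy unfolding extends_def by (metis SigmaI fst_conv snd_conv)
  have inj: "E (x, y) v \<noteq> 0" if x: "x \<in> closure U" and y: "y \<in> closure V" and v: "v \<noteq> 0" for x y v
  proof -
    define f where "f = Gx y"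
    define g where "g = inv_into (closure U) f"
    have diff: "diffeo_closure U f" unfolding f_def by (rule diffeo_x[OF y ne(1)])
    note inv = diffeo_closure_inverse[OF openU diff, folded g_def]
    have f1: "Ck_closure 1 U f" and g1: "Ck_closure (Suc 0) (f ` U) g"
      using diff by (simp_all add: diffeo_closure_def g_def)
    have bdd: "bounded (f ` U)"
      by (rule Ck_closure_imp_bounded[OF boundedU f1])
    from g1 obtain D where D: "\<And>v. Ck_closure 0 (f ` U) (D v)" "\<And>v p. p \<in> f ` U \<Longrightarrow> dirderiv v g p = D v p"
      "\<And>p. p \<in> f ` U \<Longrightarrow> g differentiable at p"
      by (rule Ck_closure_SucE) blast
    have "\<exists>B. \<forall>p\<in>f ` U. norm (D b p) \<le> B" for b
      using Ck_closure_imp_bounded[OF bdd D(1)[of b]] by (auto simp: bounded_iff)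
    then obtain B where B: "\<And>b p. p \<in> f ` U \<Longrightarrow> norm (D b p) \<le> B b" by metis
    \<comment> \<open>A bound for the derivative of the inverse, which (B1) makes regular up to the
      boundary of its bounded domain. \<open>K\<close> depends on \<open>y\<close> but not on the
      point of \<open>U\<close>, so the estimate passes to \<open>x\<close> on the boundary.\<close>
    define K where "K = (\<Sum>b\<in>Basis. B b)"
    have gK: "norm (dirderiv w g p) \<le> K * norm w" if p: "p \<in> f ` U" for w p
    proof -
      have "norm (dirderiv w g p) = norm (\<Sum>b\<in>Basis. (w \<bullet> b) *\<^sub>R D b p)"
        by (subst dirderiv_basis[OF D(3)[OF p]]) (simp only: D(2)[OF p])
      also have "\<dots> \<le> (\<Sum>b\<in>Basis. norm w * B b)"
        by (rule order_trans[OF norm_sum sum_mono])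
          (auto intro!: mult_mono Basis_le_norm B[OF p])
      finally show ?thesis by (simp add: K_def sum_distrib_left mult.commute)
    qed
    have "norm v \<le> K * norm (E (x', y) v)" if x': "x' \<in> U" for x'
    proof -
      have df: "(f has_derivative (\<lambda>h. - E (x', y) h)) (at x')"
        unfolding f_def by (rule Gx_has_derivative_closure[OF E x' y])
      have fx: "f x' \<in> f ` U" using x' by blast
      have "dirderiv v (\<lambda>x. g (f x)) x' = dirderiv (dirderiv v f x') g (f x')"
        by (rule dirderiv_compose[OF differentiableI[OF df] D(3)[OF fx]])
      moreover have "dirderiv v (\<lambda>x. g (f x)) x' = dirderiv v (\<lambda>x. x) x'"
        by (rule dirderiv_cong[OF openU x']) (use inv(4) closure_subset in blast)
      moreover have "dirderiv v (\<lambda>x. x) x' = v"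
        by (rule dirderiv_eqI) (rule has_derivative_ident)
      ultimately show ?thesis
        using gK[OF fx, of "dirderiv v f x'"] by (simp add: dirderiv_eqI[OF df])
    qed
    moreover have "continuous_on (closure U) (\<lambda>x'. K * norm (E (x', y) v))"
      using y by (intro continuous_intros continuous_on_compose2[OF E(1)]) (auto simp: closure_Times)
    ultimately have "norm v \<le> K * norm (E (x, y) v)"
      using continuous_ge_on_closure[OF _ x] by blast
    then show ?thesis using v by auto
  qed
  have "continuous_on (closure W \<times> sphere 0 1) (\<lambda>p. norm (E (fst p) (snd p)))"
    by (intro continuous_intros continuous_on_compose2[OF E(1)]) auto
  moreover have "compact (closure W \<times> sphere (0::'a) 1)"
    using boundedW by (intro compact_Times) (auto simp: compact_closure)
  moreover have "closure W \<times> sphere (0::'a) 1 \<noteq> {}"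
    using ne by (auto simp: closure_eq_empty)
  ultimately obtain p where p: "p \<in> closure W \<times> sphere 0 1"
    "\<And>p'. p' \<in> closure W \<times> sphere 0 1 \<Longrightarrow> norm (E (fst p) (snd p)) \<le> norm (E (fst p') (snd p'))"
    using continuous_attains_inf[of "closure W \<times> sphere (0::'a) 1" "\<lambda>p. norm (E (fst p) (snd p))"] by blast
  define m where "m = norm (E (fst p) (snd p))"
  have "m > 0"
  proof -
    have "snd p \<noteq> 0" "fst (fst p) \<in> closure U" "snd (fst p) \<in> closure V"
      using p(1) by (auto simp: closure_Times)
    then show ?thesis unfolding m_def using inj[of "fst (fst p)" "snd (fst p)" "snd p"] by simp
  qed
  moreover have "m * norm v \<le> norm (Dxy c x y v)" if "x \<in> U" "y \<in> V" for x y v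
  proof (cases "v = 0")
    case False
    have "(x, y) \<in> closure W" using that closure_subset[of W] by blast
    then have "m \<le> norm (E (x, y) (v /\<^sub>R norm v))"
      unfolding m_def using p(2)[of "((x, y), v /\<^sub>R norm v)"] False by simp
    also have "\<dots> = norm (Dxy c x y v) / norm v"
      using False by (simp add: E(2)[OF that] blinfun.scaleR_right divide_inverse_commute)
    finally show ?thesis using False by (simp add: pos_le_divide_eq)
  qed simp
  ultimately show ?thesis using that by blast
qed

text \<open>The uniform lower bound makes the inverses \<open>N\<close> bounded and continuous on
  \<open>W\<close>, so the essential supremum in \<open>beta_minus\<close> really dominates them at
  every point.\<close>

lemma norm_le_beta_minus:
  assumes x: "x \<in> U" and y: "y \<in> V"
  shows "norm v \<le> beta_minus U V c * norm (Dxy c x y v)" "0 \<le> beta_minus U V c"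
proof -
  obtain m where m: "m > 0" "\<And>x y v. x \<in> U \<Longrightarrow> y \<in> V \<Longrightarrow> m * norm v \<le> norm (Dxy c x y v)"
    by (rule Dxy_lower_bound) blast
  define N where "N x y = Blinfun (inv (blinfun_apply (Dxy c x y)))" for x y
  have NW: "N x y (Dxy c x y v) = v" "Dxy c x y (N x y v) = v" "norm (N x y v) \<le> norm v / m"
    if "x \<in> U" "y \<in> V" for x y v
  proof -
    have lin: "linear (Dxy c x y)" by (rule bounded_linear.linear[OF blinfun.bounded_linear_right])
    have "v = 0" if "Dxy c x y v = 0" for v
      using m(2)[OF \<open>x \<in> U\<close> \<open>y \<in> V\<close>, of v] m(1) that by (simp add: mult_le_0_iff)
    then have inj: "inj (Dxy c x y)" using linear_injective_0[OF lin] by blast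
    have surj: "surj (Dxy c x y)" by (rule linear_inj_imp_surj[OF lin inj])
    have "linear (inv (Dxy c x y))"
      by (rule inj_linear_imp_inv_linear[OF lin inj])
    then have "bounded_linear (inv (Dxy c x y))" by (simp add: linear_conv_bounded_linear)
    then have app: "blinfun_apply (N x y) = inv (Dxy c x y)"
      unfolding N_def by (rule bounded_linear_Blinfun_apply)
    show "N x y (Dxy c x y v) = v" "Dxy c x y (N x y v) = v"
      using inj surj by (simp_all add: app surj_f_inv_f)
    then show "norm (N x y v) \<le> norm v / m"
      using m(2)[OF that, of "N x y v"] m(1) by (simp add: pos_le_divide_eq mult.commute)
  qed
  have norm: "norm (N x y) \<le> 1 / m" if "x \<in> U" "y \<in> V" for x y
    using NW(3)[OF that] m(1) by (intro norm_blinfun_bound) auto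
  have contD: "continuous_on W (\<lambda>z. Dxy c (fst z) (snd z))"
    by (rule extends_continuous[OF extends_Dxy])
  have cont: "continuous_on W (\<lambda>z. N (fst z) (snd z))"
    unfolding continuous_on_def
  proof
    fix z0 assume z0: "z0 \<in> W"
    let ?D = "\<lambda>z. Dxy c (fst z) (snd z)"
    have le: "norm (N (fst z) (snd z) - N (fst z0) (snd z0)) \<le> norm (?D z - ?D z0) * (1 / m)\<^sup>2" if z: "z \<in> W" for z
    proof (rule norm_blinfun_bound)
      fix w
      define w' where "w' = N (fst z0) (snd z0) w"
      \<comment> \<open>The identity A^-1 - B^-1 = A^-1 (B - A) B^-1, which makes inversion
        continuous.\<close>
      have "(N (fst z) (snd z) - N (fst z0) (snd z0)) w
          = N (fst z) (snd z) (?D z0 w' - ?D z w')"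
        using z z0 NW(1,2) by (auto simp: w'_def blinfun.diff_left blinfun.diff_right)
      then have "norm ((N (fst z) (snd z) - N (fst z0) (snd z0)) w)
          = norm (N (fst z) (snd z) ((?D z - ?D z0) w'))"
        by (simp add: blinfun.diff_left blinfun.diff_right norm_minus_commute)
      also have "\<dots> \<le> norm ((?D z - ?D z0) w') / m"
        using NW(3) z by auto
      also have "\<dots> \<le> (norm (?D z - ?D z0) * norm w') / m"
        using m(1) by (intro divide_right_mono norm_blinfun) auto
      also have "\<dots> \<le> (norm (?D z - ?D z0) * (norm w / m)) / m"
        using m(1) NW(3) z0 by (intro divide_right_mono mult_left_mono) (auto simp: w'_def)
      finally show "norm ((N (fst z) (snd z) - N (fst z0) (snd z0)) w) \<le> norm (?D z - ?D z0) * (1 / m)\<^sup>2 * norm w"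
        by (simp add: power2_eq_square)
    qed auto
    have "((\<lambda>z. norm (?D z - ?D z0) * (1 / m)\<^sup>2) \<longlongrightarrow> 0) (at z0 within W)"
    proof (intro tendsto_mult_left_zero tendsto_norm_zero LIM_zero)
      show "(?D \<longlongrightarrow> ?D z0) (at z0 within W)"
        using contD z0 unfolding continuous_on_def by blast
    qed
    then have "((\<lambda>z. N (fst z) (snd z) - N (fst z0) (snd z0)) \<longlongrightarrow> 0) (at z0 within W)"
      by (rule Lim_null_comparison[rotated]) (use le in \<open>auto simp: eventually_at_filter\<close>)
    then show "((\<lambda>z. N (fst z) (snd z)) \<longlongrightarrow> N (fst z0) (snd z0)) (at z0 within W)"
      by (rule LIM_zero_cancel)
  qed
  have "bounded ((\<lambda>z. N (fst z) (snd z)) ` W)"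
    using norm by (auto simp: bounded_iff)
  from norm_le_Linf_norm[OF openW cont this, of x y] x y
  have "norm (N x y) \<le> beta_minus U V c"
    by (simp add: beta_minus_def N_def[abs_def])
  then show "0 \<le> beta_minus U V c" by (meson norm_ge_zero order_trans)
  have "norm v = norm (N x y (Dxy c x y v))" using NW(1)[OF x y] by simp
  also have "\<dots> \<le> norm (N x y) * norm (Dxy c x y v)" by (rule norm_blinfun)
  also have "\<dots> \<le> beta_minus U V c * norm (Dxy c x y v)"
    using \<open>norm (N x y) \<le> beta_minus U V c\<close> by (intro mult_right_mono) auto
  finally show "norm v \<le> beta_minus U V c * norm (Dxy c x y v)" .
qed

text \<open>With \<open>k\<close> and \<open>l\<close> the first and second derivatives of x(q)
  along \<open>v\<close>, differentiating -D_y c(x(q), yA) = q once and twice gives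
  \<open>Dxy k = - v\<close> and \<open>Dxy l = - DxxDy k k\<close>. So |k| has one factor
  \<open>beta_minus\<close> and |l| has three; the two terms of the chain rule produce the two
  summands of \<open>M_const\<close>.\<close>

lemma M_const_bound:
  assumes yA: "yA \<in> V" and U: "U \<noteq> {}" and q: "q \<in> U_coord U V c yA" and y: "y \<in> V"
  shows "\<bar>dirderiv v (dirderiv v (\<lambda>q. C (cost_exp U V c yA q, y))) q\<bar> \<le> M_const U V c * (norm v)\<^sup>2"
proof -
  define X where "X = cost_exp U V c yA"
  define x0 where "x0 = X q"
  define k where "k = dirderiv v X q"
  define l where "l = dirderiv v (dirderiv v X) q"
  have x0: "x0 \<in> U" using exp_x(3)[OF yA U] q by (auto simp: x0_def X_def)
  let ?b = "beta_minus U V c" and ?n = "norm v"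
  note b = norm_le_beta_minus[OF x0 yA]
  define S where "S = Linf_norm W (Dxx c)"
  define L where "L = Linf_norm W (Dx c)"
  define P where "P = Linf_norm W (DxxDy c)"
  note Linf = Linf_bounds[OF x0 y] Linf_bounds(3)[OF x0 yA]
  have nonneg: "0 \<le> S" "0 \<le> L" "0 \<le> P"
    using Linf norm_ge_zero unfolding S_def L_def P_def by (meson order_trans)+
  note lift = lift_X[OF yA y U, of q v]
  have q0: "0 \<in> (\<lambda>s. q + s *\<^sub>R v) -` U_coord U V c yA" using q by simp
  have "w \<bullet> Dxy c x0 yA k = w \<bullet> (- v)" for w
    using lift_x(2)[OF lift q0 yA, of w] inner_Dxy[OF x0 yA, of w k]
    by (simp add: x0_def X_def k_def)
  then have "Dxy c x0 yA k = - v" using vector_eq_rdot by (metis inner_commute)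
  then have k: "norm k \<le> ?b * ?n" using b(1)[of k] by simp
  have "w \<bullet> Dxy c x0 yA l = w \<bullet> (- DxxDy c x0 yA k k)" for w
    using lift_x(3)[OF lift q0 yA, of w] inner_Dxy[OF x0 yA, of w l] inner_DxxDy[OF x0 yA, of w k k]
    by (simp add: x0_def X_def k_def l_def)
  then have "Dxy c x0 yA l = - DxxDy c x0 yA k k" using vector_eq_rdot by (metis inner_commute)
  then have "norm l \<le> ?b * norm (DxxDy c x0 yA k k)" using b(1)[of l] by simp
  also have "\<dots> \<le> ?b * (P * (?b * ?n) * (?b * ?n))"
  proof (rule mult_left_mono[OF _ b(2)])
    have "norm (DxxDy c x0 yA k k) \<le> norm (DxxDy c x0 yA) * norm k * norm k"
      using norm_blinfun[of "DxxDy c x0 yA k" k] norm_blinfun[of "DxxDy c x0 yA" k]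
      by (meson mult_right_mono norm_ge_zero order_trans)
    also have "\<dots> \<le> P * (?b * ?n) * (?b * ?n)"
      using Linf(4) k nonneg b(2) by (intro mult_mono) (auto simp: P_def)
    finally show "norm (DxxDy c x0 yA k k) \<le> P * (?b * ?n) * (?b * ?n)" .
  qed
  finally have l: "norm l \<le> ?b * (P * (?b * ?n) * (?b * ?n))" .
  have 1: "\<bar>dirderiv (k, 0) (dirderiv (k, 0) C) (x0, y)\<bar> \<le> (?b * ?n) * (S * (?b * ?n))"
  proof -
    have "\<bar>dirderiv (k, 0) (dirderiv (k, 0) C) (x0, y)\<bar> = \<bar>k \<bullet> Dxx c x0 y k\<bar>"
      by (simp add: inner_Dxx[OF x0 y])
    also have "\<dots> \<le> norm k * (norm (Dxx c x0 y) * norm k)"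
      by (rule order_trans[OF Cauchy_Schwarz_ineq2]) (intro mult_left_mono norm_blinfun norm_ge_zero)
    also have "\<dots> \<le> (?b * ?n) * (S * (?b * ?n))"
      using Linf(2) k nonneg b(2) by (intro mult_mono) (auto simp: S_def)
    finally show ?thesis .
  qed
  have 2: "\<bar>dirderiv (l, 0) C (x0, y)\<bar> \<le> ?b * (P * (?b * ?n) * (?b * ?n)) * L"
  proof -
    have "\<bar>dirderiv (l, 0) C (x0, y)\<bar> = \<bar>l \<bullet> Dx c x0 y\<bar>" by (simp add: inner_Dx[OF x0 y])
    also have "\<dots> \<le> norm l * norm (Dx c x0 y)" by (rule Cauchy_Schwarz_ineq2)
    also have "\<dots> \<le> ?b * (P * (?b * ?n) * (?b * ?n)) * L"
      using Linf(1) l nonneg b(2) by (intro mult_mono) (auto simp: L_def)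
    finally show ?thesis .
  qed
  have "dirderiv v (dirderiv v (\<lambda>q. C (cost_exp U V c yA q, y))) q
      = dirderiv (k, 0) (dirderiv (k, 0) C) (x0, y) + dirderiv (l, 0) C (x0, y)"
    using dirderiv_C_X(2)[OF yA y U q y] by (simp add: k_def l_def x0_def X_def)
  also have "\<bar>\<dots>\<bar> \<le> (?b * ?n) * (S * (?b * ?n)) + ?b * (P * (?b * ?n) * (?b * ?n)) * L"
    using 1 2 by linarith
  also have "\<dots> = M_const U V c * ?n\<^sup>2"
    unfolding M_const_def S_def L_def P_def by (simp add: algebra_simps power2_eq_square power3_eq_cube)
  finally show ?thesis .
qed

lemma mountain_hessian_M_const:
  assumes yA: "yA \<in> V" and yB: "yB \<in> V" and U: "U \<noteq> {}" and q: "q \<in> U_coord U V c yA"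
  shows "dirderiv v (dirderiv v (mountain yA yB)) q \<ge> - 2 * M_const U V c * (norm v)\<^sup>2"
  using M_const_bound[OF yA U q yA, of v] M_const_bound[OF yA U q yB, of v]
  unfolding dirderiv_mountain(2)[OF yA yB U q] by (simp add: abs_le_iff)

end

section \<open>Passage to the boundary and c-convex potentials\<close>

lemma cSUP_add_const:
  fixes f :: "'b \<Rightarrow> real"
  assumes "A \<noteq> {}" "bdd_above (f ` A)"
  shows "(SUP y\<in>A. f y + k) = (SUP y\<in>A. f y) + k"
proof (rule antisym)
  show "(SUP y\<in>A. f y + k) \<le> (SUP y\<in>A. f y) + k"
    using assms by (intro cSUP_least) (auto intro: cSUP_upper)
  obtain B where "\<And>y. y \<in> A \<Longrightarrow> f y \<le> B" using assms(2) by (auto simp: bdd_above_def)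
  then have "bdd_above ((\<lambda>y. f y + k) ` A)" by (intro bdd_aboveI[of _ "B + k"]) auto
  then have "(SUP y\<in>A. f y) \<le> (SUP y\<in>A. f y + k) - k"
    using assms(1) by (intro cSUP_least) (auto simp: le_diff_eq intro: cSUP_upper2)
  then show "(SUP y\<in>A. f y) + k \<le> (SUP y\<in>A. f y + k)" by simp
qed

lemma c_convex_on_bdd:
  fixes c :: "'b \<Rightarrow> 'd \<Rightarrow> real"
  assumes c: "\<And>x y. x \<in> S \<Longrightarrow> y \<in> R \<Longrightarrow> \<bar>c x y\<bar> \<le> B" and ne: "S \<noteq> {}" "R \<noteq> {}"
    and u: "c_convex_on S R c u"
  shows "y \<in> R \<Longrightarrow> bdd_above ((\<lambda>x. - c x y - u x) ` S)"
    and "x \<in> S \<Longrightarrow> bdd_above ((\<lambda>y. - c x y - cstar_transform S c u y) ` R)"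
proof -
  have unb: "bdd_below (u ` S)"
  proof (rule ccontr)
    assume not: "\<not> bdd_below (u ` S)"
    \<comment> \<open>Otherwise every supremum in \<open>cstar_transform\<close> is taken over an unbounded set, where \<open>Sup\<close>
      has one and the same junk value; hence \<open>u\<close> is the transform of a constant, and bounded.\<close>
    define j where "j = (LEAST z::real. False)"
    have "cstar_transform S c u y = j" if y: "y \<in> R" for y
    proof -
      have "\<not> (\<forall>x\<in>(\<lambda>x. - c x y - u x) ` S. x \<le> z)" for z
      proof
        assume *: "\<forall>x\<in>(\<lambda>x. - c x y - u x) ` S. x \<le> z"
        have "- B - z \<le> u x" if "x \<in> S" for x
          using *[rule_format, of "- c x y - u x"] c[OF that y] that by force
        then have "bdd_below (u ` S)" by (rule bdd_belowI2)
        with not show False by simp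
      qed
      then have "(\<lambda>z. \<forall>x\<in>(\<lambda>x. - c x y - u x) ` S. x \<le> z) = (\<lambda>z. False)"
        by (intro ext) simp
      then show ?thesis unfolding cstar_transform_def Sup_real_def j_def by simp
    qed
    then have "u x = (SUP y\<in>R. - c x y - j)" if "x \<in> S" for x
      using u that by (simp add: c_convex_on_def c_transform_def)
    moreover have "- B - j \<le> (SUP y\<in>R. - c x y - j)" if x: "x \<in> S" for x
    proof -
      obtain y where y: "y \<in> R" using ne(2) by blast
      have "bdd_above ((\<lambda>y. - c x y - j) ` R)"
        using c[OF x] by (intro bdd_aboveI2[of _ _ "B - j"]) (fastforce simp: abs_le_iff)
      then show ?thesis
        by (rule cSUP_upper2[OF _ y]) (use c[OF x y] in auto)
    qed
    ultimately have "- B - j \<le> u x" if "x \<in> S" for x using that by metis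
    then have "bdd_below (u ` S)" by (rule bdd_belowI2)
    with not show False by simp
  qed
  then obtain m where m: "\<And>x. x \<in> S \<Longrightarrow> m \<le> u x" by (auto simp: bdd_below_def)
  show bdd: "bdd_above ((\<lambda>x. - c x y - u x) ` S)" if "y \<in> R" for y
  proof (rule bdd_aboveI2)
    show "- c x y - u x \<le> B - m" if "x \<in> S" for x
      using m[OF that] c[OF that \<open>y \<in> R\<close>] by auto
  qed
  \<comment> \<open>A single fixed point already bounds \<open>cstar_transform S c u y\<close> from
    below, uniformly in \<open>y\<close>.\<close>
  obtain x' where x': "x' \<in> S" using ne(1) by blast
  show "bdd_above ((\<lambda>y. - c x y - cstar_transform S c u y) ` R)" if "x \<in> S"
  proof (rule bdd_aboveI2)
    fix y assume y: "y \<in> R"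
    have "- c x' y - u x' \<le> cstar_transform S c u y"
      unfolding cstar_transform_def by (rule cSUP_upper[OF x' bdd[OF y]])
    then show "- c x y - cstar_transform S c u y \<le> 2 * B + u x'"
      using c[OF that y] c[OF x' y] by linarith
  qed
qed

context cost_domain
begin

section \<open>Approximation of boundary points from the interior\<close>

lemma interior_segment:
  assumes x: "x0 \<in> U" "x1 \<in> U" and yA: "yA \<in> V" and s: "s \<in> {0..1}"
  obtains x where "x \<in> U" "Gx yA x = Gx yA x0 + s *\<^sub>R (Gx yA x1 - Gx yA x0)"
proof -
  have U: "U \<noteq> {}" using x by auto
  have T: "Gx yA x0 \<in> U_coord U V c yA" "Gx yA x1 \<in> U_coord U V c yA"
    using x by (auto simp: U_coord_def)
  have "convex (U_coord U V c yA)" using convex_U_coord yA closure_subset by blast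
  from convexD_alt[OF this T, of s] s
  have "Gx yA x0 + s *\<^sub>R (Gx yA x1 - Gx yA x0) \<in> U_coord U V c yA"
    by (simp add: algebra_simps)
  then show ?thesis using exp_x[OF yA U] that by (meson image_subset_iff)
qed

lemma C_continuous: "continuous_on (closure U \<times> closure V) C"
  using Ck_closure_continuous[OF C_closure] by (simp add: closure_Times)

lemma Gx_continuous: "continuous_on (closure U \<times> closure V) (\<lambda>z. Gx (snd z) (fst z))"
  using Dy_closure_continuous by (auto simp: closure_Times intro: continuous_on_minus)

text \<open>Endpoints and \<open>y\<close>-points are approximated from the interior, but
  approximations of \<open>x\<close> chosen independently would violate the segment equation. So the
  intermediate points are solved for in \<open>U\<close>; a subsequence converges, its limit
  satisfies the same equation as \<open>x\<close>, and injectivity of \<open>Gx yA\<close> on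
  \<open>closure U\<close> identifies the two.\<close>

lemma closure_limit:
  fixes F :: "('a \<times> 'a \<times> 'a) \<times> ('a \<times> 'a) \<Rightarrow> real"
  assumes F: "continuous_on ((closure U \<times> closure U \<times> closure U) \<times> (closure V \<times> closure V)) F"
    and interior: "\<And>x0 x1 x yA yB. \<lbrakk>x0 \<in> U; x1 \<in> U; x \<in> U; yA \<in> V; yB \<in> V;
      Gx yA x = Gx yA x0 + s *\<^sub>R (Gx yA x1 - Gx yA x0)\<rbrakk> \<Longrightarrow> F ((x0, x1, x), (yA, yB)) \<le> 0"
    and s: "s \<in> {0..1}"
    and x: "x0 \<in> closure U" "x1 \<in> closure U" "x \<in> closure U" and y: "yA \<in> closure V" "yB \<in> closure V"
    and eq: "Gx yA x = Gx yA x0 + s *\<^sub>R (Gx yA x1 - Gx yA x0)"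
  shows "F ((x0, x1, x), (yA, yB)) \<le> 0"
proof -
  obtain a b p q where seq: "\<And>n. a n \<in> U" "a \<longlonglongrightarrow> x0" "\<And>n. b n \<in> U" "b \<longlonglongrightarrow> x1"
    "\<And>n. p n \<in> V" "p \<longlonglongrightarrow> yA" "\<And>n. q n \<in> V" "q \<longlonglongrightarrow> yB"
    using x(1,2) y unfolding closure_sequential by metis
  have "\<exists>z. z \<in> U \<and> Gx (p n) z = Gx (p n) (a n) + s *\<^sub>R (Gx (p n) (b n) - Gx (p n) (a n))" for n
    using interior_segment[OF seq(1,3,5) s] by metis
  then obtain z where z: "\<And>n. z n \<in> U"
    "\<And>n. Gx (p n) (z n) = Gx (p n) (a n) + s *\<^sub>R (Gx (p n) (b n) - Gx (p n) (a n))"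
    by metis
  have "compact (closure U)" using boundedU by (simp add: compact_closure)
  moreover have "z n \<in> closure U" for n using z(1) closure_subset by blast
  ultimately obtain x' r where x': "x' \<in> closure U" "strict_mono r" "(z \<circ> r) \<longlonglongrightarrow> x'"
    by (meson seq_compactE compact_imp_seq_compact)
  have sub: "(\<lambda>n. a (r n)) \<longlonglongrightarrow> x0" "(\<lambda>n. b (r n)) \<longlonglongrightarrow> x1"
    "(\<lambda>n. p (r n)) \<longlonglongrightarrow> yA" "(\<lambda>n. q (r n)) \<longlonglongrightarrow> yB" "(\<lambda>n. z (r n)) \<longlonglongrightarrow> x'"
    using LIMSEQ_subseq_LIMSEQ[OF seq(2) x'(2)] LIMSEQ_subseq_LIMSEQ[OF seq(4) x'(2)]
      LIMSEQ_subseq_LIMSEQ[OF seq(6) x'(2)] LIMSEQ_subseq_LIMSEQ[OF seq(8) x'(2)] x'(3)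
    by (simp_all add: o_def)
  have cl: "w \<in> U \<Longrightarrow> w \<in> closure U" "w \<in> V \<Longrightarrow> w \<in> closure V" for w
    using closure_subset by blast+
  have lim: "(\<lambda>n. Gx (p (r n)) (w n)) \<longlonglongrightarrow> Gx yA w0"
    if "w \<longlonglongrightarrow> w0" "\<And>n. w n \<in> U" "w0 \<in> closure U" for w w0
    using continuous_on_tendsto_compose[OF Gx_continuous tendsto_Pair[OF that(1) sub(3)]] that y cl seq
    by simp
  have "(\<lambda>n. Gx (p (r n)) (z (r n))) \<longlonglongrightarrow> Gx yA x0 + s *\<^sub>R (Gx yA x1 - Gx yA x0)"
    unfolding z(2) by (intro tendsto_intros lim sub seq x)
  then have "Gx yA x' = Gx yA x"
    using lim[OF sub(5) z(1) x'(1)] LIMSEQ_unique eq by metis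
  moreover have "inj_on (Gx yA) (closure U)"
  proof -
    have "U \<noteq> {}" using x(1) by auto
    then show ?thesis using diffeo_x[OF y(1)] unfolding diffeo_closure_def by blast
  qed
  ultimately have "x' = x" using x'(1) x(3) by (meson inj_onD)
  have "(\<lambda>n. F ((a (r n), b (r n), z (r n)), (p (r n), q (r n)))) \<longlonglongrightarrow> F ((x0, x1, x'), (yA, yB))"
    by (rule continuous_on_tendsto_compose[OF F]) (use sub x x' y cl seq z in \<open>auto intro!: tendsto_intros\<close>)
  then show ?thesis
    unfolding \<open>x' = x\<close>
    by (rule LIMSEQ_le_const2) (use interior seq z in auto)
qed

lemma slide_quasiconvex:
  assumes B3: "condB3 U V c" and s: "s \<in> {0..1}"
    and x: "x0 \<in> closure U" "x1 \<in> closure U" "x \<in> closure U" and y: "yA \<in> closure V" "yB \<in> closure V"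
    and eq: "Gx yA x = Gx yA x0 + s *\<^sub>R (Gx yA x1 - Gx yA x0)"
  shows "c x yA - c x yB \<le> max (c x0 yA - c x0 yB) (c x1 yA - c x1 yB)"
proof -
  define F where "F p = (case p of ((x0, x1, x), (yA, yB)) \<Rightarrow>
    C (x, yA) - C (x, yB) - max (C (x0, yA) - C (x0, yB)) (C (x1, yA) - C (x1, yB)))" for p
  have "F ((x0, x1, x), (yA, yB)) \<le> 0"
  proof (rule closure_limit[OF _ _ s x y eq])
    show "continuous_on ((closure U \<times> closure U \<times> closure U) \<times> (closure V \<times> closure V)) F"
      unfolding F_def case_prod_beta'
      by (intro continuous_intros continuous_on_max continuous_on_compose2[OF C_continuous]) auto
  next
    fix x0 x1 x yA yB assume *: "x0 \<in> U" "x1 \<in> U" "x \<in> U" "yA \<in> V" "yB \<in> V"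
      "Gx yA x = Gx yA x0 + s *\<^sub>R (Gx yA x1 - Gx yA x0)"
    then have U: "U \<noteq> {}" by auto
    have "Gx yA x0 \<in> U_coord U V c yA" "Gx yA x1 \<in> U_coord U V c yA"
      using * by (auto simp: U_coord_def)
    from mountain_quasiconvex[OF *(4,5) U B3 this s]
    have "C (x, yA) - C (x, yB) \<le> max (C (x0, yA) - C (x0, yB)) (C (x1, yA) - C (x1, yB))"
      unfolding *(6)[symmetric] mountain_def exp_x(5)[OF *(4) U *(1)] exp_x(5)[OF *(4) U *(2)]
        exp_x(5)[OF *(4) U *(3)] .
    then show "F ((x0, x1, x), (yA, yB)) \<le> 0" by (simp add: F_def)
  qed
  then show ?thesis by (simp add: F_def C_def)
qed

text \<open>The Hessian bound is a parameter because it is used twice: with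
  \<open>M_const U V c\<close>, and with 0 under (B4).\<close>

lemma slide_convex:
  assumes K: "\<And>yA yB q v. \<lbrakk>yA \<in> V; yB \<in> V; U \<noteq> {}; q \<in> U_coord U V c yA\<rbrakk> \<Longrightarrow>
      dirderiv v (dirderiv v (mountain yA yB)) q \<ge> - 2 * K * (norm v)\<^sup>2" and s: "s \<in> {0..1}"
    and x: "x0 \<in> closure U" "x1 \<in> closure U" "x \<in> closure U" and y: "yA \<in> closure V" "yB \<in> closure V"
    and eq: "Gx yA x = Gx yA x0 + s *\<^sub>R (Gx yA x1 - Gx yA x0)"
  shows "c x yA - c x yB + K * (norm (Gx yA x))\<^sup>2
    \<le> (1 - s) * (c x0 yA - c x0 yB + K * (norm (Gx yA x0))\<^sup>2)
      + s * (c x1 yA - c x1 yB + K * (norm (Gx yA x1))\<^sup>2)"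
proof -
  define F where "F p = (case p of ((x0, x1, x), (yA, yB)) \<Rightarrow>
    C (x, yA) - C (x, yB) + K * (norm (Gx yA x))\<^sup>2
    - ((1 - s) * (C (x0, yA) - C (x0, yB) + K * (norm (Gx yA x0))\<^sup>2)
      + s * (C (x1, yA) - C (x1, yB) + K * (norm (Gx yA x1))\<^sup>2)))" for p
  have "F ((x0, x1, x), (yA, yB)) \<le> 0"
  proof (rule closure_limit[OF _ _ s x y eq])
    have G: "continuous_on (closure U \<times> closure V) (\<lambda>z. Dy_closure U V c (fst z) (snd z))"
      using Dy_closure_continuous by (simp add: closure_Times)
    have G': "continuous_on D (\<lambda>p. Dy_closure U V c (f p) (g p))"
      if "continuous_on D f" "continuous_on D g" "f ` D \<subseteq> closure U" "g ` D \<subseteq> closure V"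
      for D :: "(('a \<times> 'a \<times> 'a) \<times> ('a \<times> 'a)) set" and f g
      using continuous_on_compose2[OF G continuous_on_Pair[OF that(1,2)]] that(3,4) by force
    show "continuous_on ((closure U \<times> closure U \<times> closure U) \<times> (closure V \<times> closure V)) F"
      unfolding F_def case_prod_beta'
      by (intro continuous_intros G' continuous_on_compose2[OF C_continuous]) auto
  next
    fix x0 x1 x yA yB assume *: "x0 \<in> U" "x1 \<in> U" "x \<in> U" "yA \<in> V" "yB \<in> V"
      "Gx yA x = Gx yA x0 + s *\<^sub>R (Gx yA x1 - Gx yA x0)"
    then have U: "U \<noteq> {}" by auto
    have T: "Gx yA x0 \<in> U_coord U V c yA" "Gx yA x1 \<in> U_coord U V c yA"
      using * by (auto simp: U_coord_def)
    from convex_on_if_hessian[OF *(4,5) U mountain_Ck[OF *(4,5) U] K[OF *(4,5) U] T s]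
    have "C (x, yA) - C (x, yB) + K * (norm (Gx yA x))\<^sup>2
      \<le> (1 - s) * (C (x0, yA) - C (x0, yB) + K * (norm (Gx yA x0))\<^sup>2)
        + s * (C (x1, yA) - C (x1, yB) + K * (norm (Gx yA x1))\<^sup>2)"
      unfolding *(6)[symmetric] mountain_def exp_x(5)[OF *(4) U *(1)] exp_x(5)[OF *(4) U *(2)]
        exp_x(5)[OF *(4) U *(3)] .
    then show "F ((x0, x1, x), (yA, yB)) \<le> 0" by (simp add: F_def)
  qed
  then show ?thesis by (simp add: F_def C_def)
qed

section \<open>The potential in exponential coordinates\<close>

lemma coord_closure:
  assumes y: "y \<in> closure V" and U: "U \<noteq> {}"
  shows "closure (U_coord U V c y) = Gx y ` closure U"
    and "\<And>x. x \<in> closure U \<Longrightarrow> cost_exp U V c y (Gx y x) = x"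
proof -
  have d: "diffeo_closure U (Gx y)" by (rule diffeo_x[OF y U])
  then have cont: "continuous_on (closure U) (Gx y)"
    unfolding diffeo_closure_def using Ck_closure_continuous by blast
  have "compact (Gx y ` closure U)"
    using cont boundedU by (intro compact_continuous_image) (auto simp: compact_closure)
  then have "closure (Gx y ` U) \<subseteq> Gx y ` closure U"
    by (intro closure_minimal image_mono closure_subset compact_imp_closed)
  moreover have "Gx y ` closure U \<subseteq> closure (Gx y ` U)"
    by (rule image_closure_subset[OF cont]) (auto intro: closure_subset[THEN subsetD])
  ultimately show "closure (U_coord U V c y) = Gx y ` closure U"
    unfolding U_coord_def by simp
  show "\<And>x. x \<in> closure U \<Longrightarrow> cost_exp U V c y (Gx y x) = x"
    using diffeo_closure_inverse(4)[OF openU d] by (simp add: cost_exp_def)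
qed

context
  fixes yt :: 'a and u :: "'a \<Rightarrow> real"
  assumes yt: "yt \<in> closure V" and U: "U \<noteq> {}"
    and u: "c_convex_on (closure U) (closure V) c u"
begin

abbreviation "Q \<equiv> closure (U_coord U V c yt)"
abbreviation "e \<equiv> cost_exp U V c yt"
abbreviation "ut \<equiv> u_tilde U V c yt u"
abbreviation "us \<equiv> cstar_transform (closure U) c u"

lemma exp_Q: "q \<in> Q \<Longrightarrow> e q \<in> closure U" "q \<in> Q \<Longrightarrow> Gx yt (e q) = q" "e ` Q = closure U"
  using coord_closure[OF yt U] by force+

lemma convex_Q: "convex Q"
  using convex_U_coord[OF yt] by (rule convex_closure)

lemma potential_bdd:
  "y \<in> closure V \<Longrightarrow> bdd_above ((\<lambda>x. - c x y - u x) ` closure U)"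
  "x \<in> closure U \<Longrightarrow> bdd_above ((\<lambda>y. - c x y - us y) ` closure V)"
proof -
  have "bounded (C ` (closure U \<times> closure V))"
    using C_continuous boundedU boundedV
    by (intro compact_imp_bounded compact_continuous_image compact_Times) (auto simp: compact_closure)
  then obtain B where "\<forall>z\<in>closure U \<times> closure V. \<bar>C z\<bar> \<le> B"
    unfolding bounded_iff by auto
  then have B: "\<bar>c x y\<bar> \<le> B" if "x \<in> closure U" "y \<in> closure V" for x y
    using that by (force simp: C_def)
  have ne: "closure U \<noteq> {}" "closure V \<noteq> {}" using U yt by (auto simp: closure_eq_empty)
  note bdd = c_convex_on_bdd[OF B ne u]
  show "y \<in> closure V \<Longrightarrow> bdd_above ((\<lambda>x. - c x y - u x) ` closure U)"
    "x \<in> closure U \<Longrightarrow> bdd_above ((\<lambda>y. - c x y - us y) ` closure V)"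
    using bdd by auto
qed

lemma u_tilde_SUP:
  assumes q: "q \<in> Q"
  shows "ut q = (SUP y\<in>closure V. c (e q) yt - c (e q) y - us y)"
    and "bdd_above ((\<lambda>y. c (e q) yt - c (e q) y - us y) ` closure V)"
proof -
  have ne: "closure V \<noteq> {}" using yt by auto
  note bdd = potential_bdd(2)[OF exp_Q(1)[OF q]]
  have "(SUP y\<in>closure V. (- c (e q) y - us y) + c (e q) yt) = ut q"
    unfolding cSUP_add_const[OF ne bdd] u_tilde_def
    using u exp_Q(1)[OF q] by (simp add: c_convex_on_def c_transform_def)
  then show "ut q = (SUP y\<in>closure V. c (e q) yt - c (e q) y - us y)"
    by (simp add: algebra_simps)
  obtain B where "\<And>y. y \<in> closure V \<Longrightarrow> - c (e q) y - us y \<le> B"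
    using bdd by (auto simp: bdd_above_def)
  then show "bdd_above ((\<lambda>y. c (e q) yt - c (e q) y - us y) ` closure V)"
    by (intro bdd_aboveI2[of _ _ "B + c (e q) yt"]) fastforce
qed

lemma u_tilde_ge:
  "q \<in> Q \<Longrightarrow> y \<in> closure V \<Longrightarrow> c (e q) yt - c (e q) y - us y \<le> ut q"
  by (subst u_tilde_SUP(1), assumption, rule cSUP_upper[OF _ u_tilde_SUP(2)])

lemma u_tilde_le:
  "q \<in> Q \<Longrightarrow> (\<And>y. y \<in> closure V \<Longrightarrow> c (e q) yt - c (e q) y - us y \<le> k) \<Longrightarrow> ut q \<le> k"
  using yt by (subst u_tilde_SUP(1)) (auto intro!: cSUP_least)

lemma segment_Q:
  assumes "q0 \<in> Q" "q1 \<in> Q" "s \<in> {0..1}"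
  defines "q \<equiv> (1 - s) *\<^sub>R q0 + s *\<^sub>R q1"
  shows "q \<in> Q" "Gx yt (e q) = Gx yt (e q0) + s *\<^sub>R (Gx yt (e q1) - Gx yt (e q0))"
proof -
  show q: "q \<in> Q"
    unfolding q_def using convexD_alt[OF convex_Q assms(1,2)] assms(3) by simp
  show "Gx yt (e q) = Gx yt (e q0) + s *\<^sub>R (Gx yt (e q1) - Gx yt (e q0))"
    unfolding exp_Q(2)[OF q] exp_Q(2)[OF assms(1)] exp_Q(2)[OF assms(2)] by (simp add: q_def algebra_simps)
qed

lemma sublevel_convex:
  assumes B3: "condB3 U V c"
  shows "convex {q \<in> Q. ut q \<le> k}"
  unfolding convex_alt
proof (intro ballI allI impI)
  fix q0 q1 s assume q: "q0 \<in> {q \<in> Q. ut q \<le> k}" "q1 \<in> {q \<in> Q. ut q \<le> k}" and "0 \<le> s \<and> s \<le> (1::real)"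
  then have s: "s \<in> {0..1}" and q0: "q0 \<in> Q" and q1: "q1 \<in> Q" by auto
  let ?q = "(1 - s) *\<^sub>R q0 + s *\<^sub>R q1"
  note seg = segment_Q[OF q0 q1 s]
  have "ut ?q \<le> k"
  proof (rule u_tilde_le[OF seg(1)])
    fix y assume y: "y \<in> closure V"
    show "c (e ?q) yt - c (e ?q) y - us y \<le> k"
      using slide_quasiconvex[OF B3 s exp_Q(1)[OF q0] exp_Q(1)[OF q1] exp_Q(1)[OF seg(1)] yt y seg(2)]
        u_tilde_ge[OF q0 y] u_tilde_ge[OF q1 y] q by auto
  qed
  then show "?q \<in> {q \<in> Q. ut q \<le> k}" using seg(1) by simp
qed

lemma u_tilde_semiconvex:
  assumes K: "\<And>yA yB q v. \<lbrakk>yA \<in> V; yB \<in> V; U \<noteq> {}; q \<in> U_coord U V c yA\<rbrakk> \<Longrightarrow>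
      dirderiv v (dirderiv v (mountain yA yB)) q \<ge> - 2 * K * (norm v)\<^sup>2"
  shows "convex_on Q (\<lambda>q. ut q + K * (norm q)\<^sup>2)"
proof (rule convex_onI[OF _ convex_Q])
  fix s q0 q1 assume "0 < s" "s < (1::real)" and q0: "q0 \<in> Q" and q1: "q1 \<in> Q"
  then have s: "s \<in> {0..1}" by auto
  let ?q = "(1 - s) *\<^sub>R q0 + s *\<^sub>R q1"
  note seg = segment_Q[OF q0 q1 s]
  let ?r = "(1 - s) * (ut q0 + K * (norm q0)\<^sup>2) + s * (ut q1 + K * (norm q1)\<^sup>2)"
  have "ut ?q \<le> ?r - K * (norm ?q)\<^sup>2"
  proof (rule u_tilde_le[OF seg(1)])
    fix y assume y: "y \<in> closure V"
    define m0 where "m0 = c (e q0) yt - c (e q0) y"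
    define m1 where "m1 = c (e q1) yt - c (e q1) y"
    have "(1 - s) * m0 + s * m1 \<le> (1 - s) * (ut q0 + us y) + s * (ut q1 + us y)"
      using u_tilde_ge[OF q0 y] u_tilde_ge[OF q1 y] s
      by (intro add_mono mult_left_mono) (auto simp: m0_def m1_def)
    then show "c (e ?q) yt - c (e ?q) y - us y \<le> ?r - K * (norm ?q)\<^sup>2"
      using slide_convex[OF K s exp_Q(1)[OF q0] exp_Q(1)[OF q1] exp_Q(1)[OF seg(1)] yt y seg(2)]
      unfolding exp_Q(2)[OF q0] exp_Q(2)[OF q1] exp_Q(2)[OF seg(1)] m0_def[symmetric] m1_def[symmetric]
      by (simp add: algebra_simps)
  qed
  then show "ut ?q + K * (norm ?q)\<^sup>2 \<le> ?r" by simp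
qed

text \<open>Membership of \<open>yt\<close> in the subdifferential says
  \<open>ut q0 = - us yt\<close>. The right-hand side is the term \<open>y = yt\<close> of the
  supremum defining \<open>ut\<close>, which is constant in \<open>q\<close> and hence a global
  lower bound.\<close>

lemma u_tilde_min:
  assumes "q0 \<in> Q" "yt \<in> c_subdiff (closure U) (closure V) c u (e q0)" "q \<in> Q"
  shows "ut q0 \<le> ut q"
  using assms(2) u_tilde_ge[OF assms(3) yt] by (simp add: c_subdiff_def u_tilde_def)

text \<open>The term c(x(q), yt) added to the potential cancels against the one subtracted from the
  cost, and \<open>e\<close> only reparametrises \<open>closure U\<close>. Both remaining claims
  about the modified cost follow from this equality of transforms.\<close>

lemma cstar_u_tilde: "cstar_transform Q (c_tilde U V c yt) ut = us"
proof
  fix y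
  have "cstar_transform Q (c_tilde U V c yt) ut y = (SUP q\<in>Q. - c (e q) y - u (e q))"
    by (simp add: cstar_transform_def c_tilde_def u_tilde_def)
  also have "\<dots> = (SUP x\<in>e ` Q. - c x y - u x)" by (simp add: image_image)
  finally show "cstar_transform Q (c_tilde U V c yt) ut y = us y"
    unfolding exp_Q(3) cstar_transform_def .
qed

lemma u_tilde_c_convex: "c_convex_on Q (closure V) (c_tilde U V c yt) ut"
  unfolding c_convex_on_def cstar_u_tilde
  by (simp add: u_tilde_SUP(1) c_transform_def c_tilde_def)

lemma c_subdiff_u_tilde:
  "c_subdiff Q (closure V) (c_tilde U V c yt) ut q = c_subdiff (closure U) (closure V) c u (e q)"
  unfolding c_subdiff_def cstar_u_tilde by (simp add: u_tilde_def c_tilde_def algebra_simps)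

end

end

theorem theorem4p3:
  fixes U V :: "'a::euclidean_space set"
    and c :: "'a \<Rightarrow> 'a \<Rightarrow> real"
    and yt :: 'a
    and u :: "'a \<Rightarrow> real"
  assumes "condB0 U V c" and "condB1 U V c" and "condB2 U V c" and "condB3 U V c"
    and "yt \<in> closure V"
    and "c_convex_on (closure U) (closure V) c u"
  shows "(\<forall>k. convex {q \<in> closure (U_coord U V c yt). u_tilde U V c yt u q \<le> k})
    \<and> convex_on (closure (U_coord U V c yt))
        (\<lambda>q. u_tilde U V c yt u q + M_const U V c * (norm q)^2)
    \<and> (condB4 U V c \<longrightarrow> convex_on (closure (U_coord U V c yt)) (u_tilde U V c yt u))
    \<and> (\<forall>q0 \<in> closure (U_coord U V c yt).
         yt \<in> c_subdiff (closure U) (closure V) c u (cost_exp U V c yt q0) \<longrightarrow>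
         (\<forall>q \<in> closure (U_coord U V c yt). u_tilde U V c yt u q0 \<le> u_tilde U V c yt u q))
    \<and> c_convex_on (closure (U_coord U V c yt)) (closure V) (c_tilde U V c yt) (u_tilde U V c yt u)
    \<and> (\<forall>q \<in> closure (U_coord U V c yt).
         c_subdiff (closure (U_coord U V c yt)) (closure V)
           (c_tilde U V c yt) (u_tilde U V c yt u) q
         = c_subdiff (closure U) (closure V) c u (cost_exp U V c yt q))"
proof (cases "U = {}")
  case True
  then show ?thesis by (simp add: U_coord_def c_convex_on_def convex_on_def)
next
  case False
  interpret cost_domain U V c
    by unfold_locales (rule assms)+
  note asm = assms(5) False assms(6)
  \<comment> \<open>With \<open>K = 0\<close> the Hessian hypothesis is plain nonnegativity and the
    quadratic term disappears.\<close>
  have B4: "convex_on (closure (U_coord U V c yt)) (u_tilde U V c yt u)" if "condB4 U V c"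
    using u_tilde_semiconvex[OF asm, of 0] mountain_hessian that by simp
  show ?thesis
    using sublevel_convex[OF asm assms(4)] u_tilde_semiconvex[OF asm mountain_hessian_M_const] B4
      u_tilde_min[OF asm] u_tilde_c_convex[OF asm] c_subdiff_u_tilde[OF asm]
    by blast
qed

end
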